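(* For all multi-indices $\alpha=\alpha^{(k)}_i\in[k]$, $\alpha'=\alpha^{(\ell)}_j\in[\ell]$ and all $a\in\{1,\dots,D\}$: (1) The Baker and adjoint Baker functions satisfy $$\frac{\partial\Psi_i}{\partial t_{\alpha'}}=(J_{\alpha'})_+\Psi_i,\qquad\frac{\partial\Psi_i^*}{\partial t_{\alpha'}}=-(J_{\alpha'})_+^\top\Psi_i^*,\qquad i=1,2.$$ (2) The orthogonal polynomials and second kind functions satisfy $$\frac{\partial P}{\partial t_{\alpha'}}=-x^{\alpha'}P+(J_{\alpha'})_+P,\qquad\frac{\partial C}{\partial t_{\alpha'}}=(J_{\alpha'})_+C.$$ (3) The Lax equations hold: $$\frac{\partial J_{\alpha}}{\partial t_{\alpha'}}=\big[(J_{\alpha'})_+,J_{\alpha}\big].$$ (4) The Zakharov–Shabat type equations hold: $$\frac{\partial(J_{\alpha})_+}{\partial t_{\alpha'}}-\frac{\partial(J_{\alpha'})_+}{\partial t_{\alpha}}+\big[(J_{\alpha})_+,(J_{\alpha'})_+\big]=0,\qquad\frac{\partial\omega_a}{\partial t_{\alpha}}-(T_aJ_{\alpha})_+\,\omega_a+\omega_a\,(J_{\alpha})_+=0.$$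
   Context: Let $D\ge 1$. For $k\in\mathbb Z_+$ let $[k]=\{\alpha\in\mathbb Z_+^D:|\alpha|=k\}$, ordered so that $\alpha>\alpha'$ iff at the first coordinate where they differ the entry of $\alpha$ is smaller. $\chi_{[k]}(x)$ is the column vector of monomials $x^\alpha$, $\alpha\in[k]$, and $\chi$ stacks $\chi_{[0]},\chi_{[1]},\dots$; $\chi^*(x)=\big(\prod_ax_a^{-1}\big)\chi(x_1^{-1},\dots,x_D^{-1})$. Semi-infinite matrices are partitioned in blocks $A_{[k],[\ell]}\in\mathbb R^{|[k]|\times|[\ell]|}$. Shift matrices: $\Lambda_a$ has as only nonzero blocks $(\Lambda_a)_{[k],[k+1]}$, with entries $\delta_{\alpha+e_a,\alpha'}$, $\alpha\in[k]$, $\alpha'\in[k+1]$; $\Lambda_\alpha=\Lambda_1^{\alpha_1}\cdots\Lambda_D^{\alpha_D}$; $n\cdot\Lambda=\sum_an_a\Lambda_a$. They satisfy $\Lambda_\alpha\chi=x^\alpha\chi$. Flows: fix an invertible $N=(n_{a,b})\in GL(\mathbb R^D)$ with rows $n_a$, and $q\in\mathbb R^D$ with all $q_a\ne0$. Let $\mu$ be a Borel measure with finite moments, supported in $\{x:|n_a\cdot x|<|q_a|\ \forall a\}$, and $G=\int\chi\,d\mu\,\chi^\top$. For real times $t=(t_\alpha)_{\alpha\in\mathbb Z_+^D}$ and $m\in\mathbb Z^D$ put $t(x)=\sum_\alpha t_\alpha x^\alpha$, $$W_0(t,m)=\exp\Big(\sum_\alpha t_\alpha\Lambda_\alpha\Big)\prod_{a=1}^D(n_a\cdot\Lambda-q_a)^{m_a},\qquad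 G(t,m)=W_0(t,m)G,$$ which is the moment matrix of $e^{t(x)}\prod_a(n_a\cdot x-q_a)^{m_a}d\mu(x)$. It is assumed that $G(t,m)=S^{-1}H(S^{-1})^\top$ with $S=S(t,m)$ block lower triangular with identity diagonal blocks and $H=H(t,m)$ block diagonal with invertible blocks. Put $P=S\chi$, $C=H(S^{-1})^\top\chi^*$ (Laurent series), $W_1=SW_0$, $W_2=H(S^{-1})^\top$, so that $G=W_1^{-1}W_2$ (used to give meaning to $W_1^{-1}=GW_2^{-1}$). Baker functions: $\Psi_1=W_1\chi$, $\Psi_2=W_2\chi^*$; adjoint Baker functions: $\Psi_1^*=(W_1^{-1})^\top\chi^*$, $\Psi_2^*=(W_2^{-1})^\top\chi$. Jacobi type matrices: $J_\alpha=S\Lambda_\alpha S^{-1}$. $(T_af)(m)=f(m+e_a)$. Lattice resolvent: $\omega_a=(T_aS)(n_a\cdot\Lambda-q_a)S^{-1}$. For a semi-infinite matrix $M$, $M_+$ is its block upper triangular part (including the block diagonal). *)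

theory Defs
  imports "HOL-Analysis.Analysis" "HOL-Library.Function_Algebras"
begin

text \<open>
  The coordinates \<open>1, \<dots>, D\<close> are the elements of a finite linearly ordered index type \<open>'d\<close>.
  Semi-infinite matrices are indexed directly by multi-indices; the order chosen inside a
  degree block \<open>[k]\<close> only fixes how a block is written down as an array and enters none of the
  notions below.  Addition, subtraction and negation of matrices are entrywise
  (pointwise operations on functions).
\<close>

type_synonym 'd mindex = "nat ^ 'd"
type_synonym 'd smat = "'d mindex \<Rightarrow> 'd mindex \<Rightarrow> real"
type_synonym 'd flow = "'d mindex \<Rightarrow> real"
type_synonym 'd point = "real ^ 'd"
type_synonym 'd rmat = "real ^ 'd ^ 'd"
type_synonym 'd lattice = "int ^ 'd"

definition mdeg :: "'d::finite mindex \<Rightarrow> nat" where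
  "mdeg \<alpha> = (\<Sum>a\<in>UNIV. \<alpha> $ a)"

definition level :: "nat \<Rightarrow> 'd::finite mindex set" where
  "level k = {\<alpha>. mdeg \<alpha> = k}"

definition xpow :: "'d::finite mindex \<Rightarrow> 'd point \<Rightarrow> real" where
  "xpow \<alpha> x = (\<Prod>a\<in>UNIV. (x $ a) ^ (\<alpha> $ a))"


subsection \<open>Semi-infinite matrices\<close>

text \<open>
  Products are block products: the sum over the middle index is a series over the degree blocks
  of finite sums inside each block.  For row-finite left factors or column-finite right factors
  this is a finite sum; it is a genuine series in \<open>W\<^sub>0 G\<close> and \<open>W\<^sub>0 \<chi>\<close>.
\<close>

definition smat_mult :: "'d::finite smat \<Rightarrow> 'd smat \<Rightarrow> 'd smat" (infixl "\<odot>" 70) where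
  "(A \<odot> B) \<alpha> \<beta> = (\<Sum>k. \<Sum>\<gamma>\<in>level k. A \<alpha> \<gamma> * B \<gamma> \<beta>)"

text \<open>
  A column vector has as entries functions on a set of type \<open>'p\<close>: either functions of the
  point \<open>x\<close>, or formal Laurent series, i.e. functions of the exponent in \<open>int ^ 'd\<close>
  giving the coefficients.
\<close>

definition svec :: "'d::finite smat \<Rightarrow> ('d mindex \<Rightarrow> 'p \<Rightarrow> real) \<Rightarrow> 'd mindex \<Rightarrow> 'p \<Rightarrow> real"
    (infixr "\<odot>\<^sub>v" 69) where
  "(A \<odot>\<^sub>v V) \<alpha> p = (\<Sum>k. \<Sum>\<gamma>\<in>level k. A \<alpha> \<gamma> * V \<gamma> p)"

definition sone :: "'d::finite smat" where
  "sone \<alpha> \<beta> = (if \<alpha> = \<beta> then 1 else 0)"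

definition sscale :: "real \<Rightarrow> 'd::finite smat \<Rightarrow> 'd smat" where
  "sscale c A \<alpha> \<beta> = c * A \<alpha> \<beta>"

definition strans :: "'d::finite smat \<Rightarrow> 'd smat" where
  "strans A \<alpha> \<beta> = A \<beta> \<alpha>"

definition scomm :: "'d::finite smat \<Rightarrow> 'd smat \<Rightarrow> 'd smat" where
  "scomm A B = A \<odot> B - B \<odot> A"

definition splus :: "'d::finite smat \<Rightarrow> 'd smat" where
  "splus A \<alpha> \<beta> = (if mdeg \<alpha> \<le> mdeg \<beta> then A \<alpha> \<beta> else 0)"

primrec spow :: "'d::finite smat \<Rightarrow> nat \<Rightarrow> 'd smat" where
  "spow A 0 = sone"
| "spow A (Suc n) = A \<odot> spow A n"

definition sprod_list :: "'d::finite smat list \<Rightarrow> 'd smat" where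
  "sprod_list As = foldr (\<odot>) As sone"

definition sexp :: "'d::finite smat \<Rightarrow> 'd smat" where
  "sexp A \<alpha> \<beta> = (\<Sum>n. spow A n \<alpha> \<beta> / fact n)"

definition block_lower :: "'d::finite smat \<Rightarrow> bool" where
  "block_lower A \<longleftrightarrow> (\<forall>\<alpha> \<beta>. mdeg \<alpha> < mdeg \<beta> \<longrightarrow> A \<alpha> \<beta> = 0)"

definition block_upper :: "'d::finite smat \<Rightarrow> bool" where
  "block_upper A \<longleftrightarrow> (\<forall>\<alpha> \<beta>. mdeg \<beta> < mdeg \<alpha> \<longrightarrow> A \<alpha> \<beta> = 0)"

text \<open>
  Left and right inverses of infinite matrices need not be unique (\<open>n \<cdot> \<Lambda> - q\<close> annihilates
  \<open>\<chi>(x)\<close> whenever \<open>n \<bullet> x = q\<close>).  Inverses of block triangular matrices are therefore taken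
  among the block triangular matrices of the same shape, where they are unique.
\<close>

definition lower_inv :: "'d::finite smat \<Rightarrow> 'd smat" where
  "lower_inv A = (THE B. block_lower B \<and> A \<odot> B = sone \<and> B \<odot> A = sone)"

definition upper_inv :: "'d::finite smat \<Rightarrow> 'd smat" where
  "upper_inv A = (THE B. block_upper B \<and> A \<odot> B = sone \<and> B \<odot> A = sone)"

definition upper_powi :: "'d::finite smat \<Rightarrow> int \<Rightarrow> 'd smat" where
  "upper_powi A m = (if 0 \<le> m then spow A (nat m) else spow (upper_inv A) (nat (- m)))"

definition block_unilower :: "'d::finite smat \<Rightarrow> bool" where
  "block_unilower A \<longleftrightarrow>
     block_lower A \<and> (\<forall>\<alpha> \<beta>. mdeg \<alpha> = mdeg \<beta> \<longrightarrow> A \<alpha> \<beta> = sone \<alpha> \<beta>)"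

definition block_diagonal :: "'d::finite smat \<Rightarrow> bool" where
  "block_diagonal A \<longleftrightarrow> (\<forall>\<alpha> \<beta>. mdeg \<alpha> \<noteq> mdeg \<beta> \<longrightarrow> A \<alpha> \<beta> = 0)"

definition diag_block_invertible :: "'d::finite smat \<Rightarrow> nat \<Rightarrow> bool" where
  "diag_block_invertible A k \<longleftrightarrow>
     (\<exists>B. \<forall>\<alpha>\<in>level k. \<forall>\<beta>\<in>level k.
        (\<Sum>\<gamma>\<in>level k. A \<alpha> \<gamma> * B \<gamma> \<beta>) = sone \<alpha> \<beta> \<and>
        (\<Sum>\<gamma>\<in>level k. B \<alpha> \<gamma> * A \<gamma> \<beta>) = sone \<alpha> \<beta>)"

definition gauss_borel :: "'d::finite smat \<Rightarrow> 'd smat \<Rightarrow> 'd smat \<Rightarrow> bool" where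
  "gauss_borel G S H \<longleftrightarrow>
     block_unilower S \<and> block_diagonal H \<and> (\<forall>k. diag_block_invertible H k) \<and>
     G = lower_inv S \<odot> H \<odot> strans (lower_inv S)"


subsection \<open>Monomial vectors and shift matrices\<close>

definition chi :: "'d::finite mindex \<Rightarrow> 'd point \<Rightarrow> real" where
  "chi \<alpha> x = xpow \<alpha> x"

text \<open>
  The entry of \<open>\<chi>\<^sup>*\<close> at \<open>\<alpha>\<close> is the Laurent monomial
  with exponent \<open>- \<alpha>\<^sub>a - 1\<close> in the variable \<open>x\<^sub>a\<close>.
\<close>

definition chi_star :: "'d::finite mindex \<Rightarrow> 'd lattice \<Rightarrow> real" where
  "chi_star \<alpha> e = (if e = (\<chi> a. - int (\<alpha> $ a) - 1) then 1 else 0)"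

definition Lam :: "'d::finite \<Rightarrow> 'd smat" where
  "Lam a \<alpha> \<beta> = (if \<alpha> + axis a 1 = \<beta> then 1 else 0)"

definition Lam_mi :: "'d::{finite,linorder} mindex \<Rightarrow> 'd smat" where
  "Lam_mi \<alpha> = sprod_list (map (\<lambda>a. spow (Lam a) (\<alpha> $ a)) (sorted_list_of_set UNIV))"

definition dot_Lam :: "'d point \<Rightarrow> 'd::finite smat" where
  "dot_Lam n \<alpha> \<beta> = (\<Sum>a\<in>UNIV. n $ a * Lam a \<alpha> \<beta>)"


subsection \<open>Measure, flows and dressing\<close>

definition msupport :: "'a::topological_space measure \<Rightarrow> 'a set" where
  "msupport \<mu> = {x. \<forall>U. open U \<longrightarrow> x \<in> U \<longrightarrow> emeasure \<mu> U \<noteq> 0}"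

definition flow_region :: "'d rmat \<Rightarrow> 'd point \<Rightarrow> 'd::finite point set" where
  "flow_region N q = {x. \<forall>a. \<bar>N $ a \<bullet> x\<bar> < \<bar>q $ a\<bar>}"

text \<open>
  Infinitely many times may be nonzero; the requirement is that the series for \<open>t(x)\<close>
  makes sense on the region in which the measure is supported.  Every finitely
  supported \<open>t\<close> is admissible, and changing one time preserves admissibility.
\<close>

definition admissible_times :: "'d rmat \<Rightarrow> 'd point \<Rightarrow> 'd::finite flow set" where
  "admissible_times N q =
     {t. \<forall>x\<in>flow_region N q. (\<lambda>\<alpha>. t \<alpha> * xpow \<alpha> x) summable_on UNIV}"

definition moment_matrix :: "'d point measure \<Rightarrow> 'd::finite smat" where
  "moment_matrix \<mu> \<alpha> \<beta> = (\<integral>x. chi \<alpha> x * chi \<beta> x \<partial>\<mu>)"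

text \<open>Each entry of the infinite sum below has at most one nonzero summand.\<close>

definition time_Lam :: "'d::{finite,linorder} flow \<Rightarrow> 'd smat" where
  "time_Lam t \<beta> \<gamma> = (\<Sum>\<^sub>\<infinity>\<alpha>. t \<alpha> * Lam_mi \<alpha> \<beta> \<gamma>)"

definition lin_Lam :: "'d rmat \<Rightarrow> 'd point \<Rightarrow> 'd \<Rightarrow> 'd::finite smat" where
  "lin_Lam N q a = dot_Lam (N $ a) - sscale (q $ a) sone"

definition W0 ::
  "'d rmat \<Rightarrow> 'd point \<Rightarrow> 'd flow \<Rightarrow> 'd lattice \<Rightarrow> 'd::{finite,linorder} smat" where
  "W0 N q t m =
     sexp (time_Lam t) \<odot>
     sprod_list (map (\<lambda>a. upper_powi (lin_Lam N q a) (m $ a)) (sorted_list_of_set UNIV))"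

definition G_flow ::
  "'d rmat \<Rightarrow> 'd point \<Rightarrow> 'd point measure \<Rightarrow> 'd flow \<Rightarrow> 'd lattice
     \<Rightarrow> 'd::{finite,linorder} smat" where
  "G_flow N q \<mu> t m = W0 N q t m \<odot> moment_matrix \<mu>"


subsection \<open>Wave matrices, Baker functions, Jacobi matrices, resolvents\<close>

text \<open>
  In this part \<open>S\<close> and \<open>H\<close> are the Gauss--Borel factors at one
  value of \<open>(t, m)\<close>, \<open>W\<close> stands for \<open>W\<^sub>0(t, m)\<close>, and
  \<open>G\<close> is the initial moment matrix.
\<close>

definition W1 :: "'d::finite smat \<Rightarrow> 'd smat \<Rightarrow> 'd smat" where
  "W1 W S = S \<odot> W"

definition W2 :: "'d::finite smat \<Rightarrow> 'd smat \<Rightarrow> 'd smat" where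
  "W2 S H = H \<odot> strans (lower_inv S)"

definition W1_inv :: "'d::finite smat \<Rightarrow> 'd smat \<Rightarrow> 'd smat \<Rightarrow> 'd smat" where
  "W1_inv G S H = G \<odot> upper_inv (W2 S H)"

definition orth_poly :: "'d::finite smat \<Rightarrow> 'd mindex \<Rightarrow> 'd point \<Rightarrow> real" where
  "orth_poly S = S \<odot>\<^sub>v chi"

definition second_kind :: "'d::finite smat \<Rightarrow> 'd smat \<Rightarrow> 'd mindex \<Rightarrow> 'd lattice \<Rightarrow> real" where
  "second_kind S H = (H \<odot> strans (lower_inv S)) \<odot>\<^sub>v chi_star"

definition Psi1 :: "'d::finite smat \<Rightarrow> 'd smat \<Rightarrow> 'd mindex \<Rightarrow> 'd point \<Rightarrow> real" where
  "Psi1 W S = W1 W S \<odot>\<^sub>v chi"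

definition Psi2 :: "'d::finite smat \<Rightarrow> 'd smat \<Rightarrow> 'd mindex \<Rightarrow> 'd lattice \<Rightarrow> real" where
  "Psi2 S H = W2 S H \<odot>\<^sub>v chi_star"

definition Psi1_adj ::
  "'d::finite smat \<Rightarrow> 'd smat \<Rightarrow> 'd smat \<Rightarrow> 'd mindex \<Rightarrow> 'd lattice \<Rightarrow> real" where
  "Psi1_adj G S H = strans (W1_inv G S H) \<odot>\<^sub>v chi_star"

definition Psi2_adj :: "'d::finite smat \<Rightarrow> 'd smat \<Rightarrow> 'd mindex \<Rightarrow> 'd point \<Rightarrow> real" where
  "Psi2_adj S H = strans (upper_inv (W2 S H)) \<odot>\<^sub>v chi"

text \<open>
  The function \<open>\<Psi>\<^sub>1\<close> is an infinite series in the monomials, because \<open>W\<^sub>0\<close> is not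
  row-finite.  It converges where \<open>t(x)\<close> does and the geometric series of the
  negative powers do; for admissible times this contains the region of support.
\<close>

definition Psi1_domain ::
  "'d rmat \<Rightarrow> 'd point \<Rightarrow> 'd flow \<Rightarrow> 'd lattice \<Rightarrow> 'd::finite point set" where
  "Psi1_domain N q t m =
     {x. (\<lambda>\<alpha>. t \<alpha> * xpow \<alpha> x) summable_on UNIV \<and>
         (\<forall>a. m $ a < 0 \<longrightarrow> \<bar>N $ a \<bullet> x\<bar> < \<bar>q $ a\<bar>)}"

definition jacobi :: "'d::{finite,linorder} smat \<Rightarrow> 'd mindex \<Rightarrow> 'd smat" where
  "jacobi S \<alpha> = S \<odot> Lam_mi \<alpha> \<odot> lower_inv S"

definition resolvent ::
  "'d rmat \<Rightarrow> 'd point \<Rightarrow> ('d lattice \<Rightarrow> 'd smat) \<Rightarrow> 'd \<Rightarrow> 'd lattice \<Rightarrow> 'd::finite smat" where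
  "resolvent N q S a m = S (m + axis a 1) \<odot> lin_Lam N q a \<odot> lower_inv (S m)"

text \<open>
  \<open>F\<close> is a matrix or vector depending on the times; the partial derivative in the
  time \<open>t\<^sub>\<alpha>\<close> is taken entrywise (and for vectors of functions at each point of
  \<open>X\<close>, for vectors of Laurent series coefficientwise).
\<close>

definition has_time_deriv_on ::
  "'p set \<Rightarrow> ('d::finite flow \<Rightarrow> 'd mindex \<Rightarrow> 'p \<Rightarrow> real) \<Rightarrow> ('d mindex \<Rightarrow> 'p \<Rightarrow> real)
     \<Rightarrow> 'd mindex \<Rightarrow> 'd flow \<Rightarrow> bool" where
  "has_time_deriv_on X F F' \<alpha> t \<longleftrightarrow>
     (\<forall>\<beta>. \<forall>p\<in>X. ((\<lambda>s. F (t(\<alpha> := s)) \<beta> p) has_real_derivative F' \<beta> p) (at (t \<alpha>)))"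

abbreviation has_time_deriv ::
  "('d::finite flow \<Rightarrow> 'd mindex \<Rightarrow> 'p \<Rightarrow> real) \<Rightarrow> ('d mindex \<Rightarrow> 'p \<Rightarrow> real)
     \<Rightarrow> 'd mindex \<Rightarrow> 'd flow \<Rightarrow> bool" where
  "has_time_deriv \<equiv> has_time_deriv_on UNIV"

end

theory Submission
  imports Defs
begin

text \<open>
  Since the support of \<open>\<mu>\<close> is compact, \<open>W\<^sub>0(t, m) G\<close> is the moment matrix of
  \<open>\<mu>\<close> with density \<open>exp (t(x)) \<Prod>\<^sub>a (n\<^sub>a \<bullet> x - q\<^sub>a) ^ m\<^sub>a\<close>, where
  the series has to be summed by homogeneous degree; hence \<open>\<partial>G/\<partial>t\<^sub>\<alpha> = \<Lambda>\<^sub>\<alpha> G\<close>.  The inverse of a truncation of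
  \<open>G\<close> depends differentiably on the times, and its last block row is that of \<open>H\<inverse> S\<close>, so
  \<open>S\<close> and \<open>H\<close> are differentiable.  Differentiating \<open>S G = W\<^sub>2\<close> gives
  \<open>\<partial>W\<^sub>2 W\<^sub>2\<inverse> = \<partial>S S\<inverse> + J\<^sub>\<alpha>\<close> with an upper triangular left-hand side and a strictly lower
  triangular first summand on the right.  Thus \<open>\<partial>W\<^sub>2 = (J\<^sub>\<alpha>)\<^sub>+ W\<^sub>2\<close> and
  \<open>\<partial>S = ((J\<^sub>\<alpha>)\<^sub>+ - J\<^sub>\<alpha>) S\<close>, and all the assertions follow from these two equations.
\<close>

subsection \<open>Products of semi-infinite matrices\<close>

text \<open>Infinite block products are not associative in general: \<open>G\<close> is a full
  matrix, and the upper triangular \<open>W0\<close> and \<open>W2\<close> have infinite rows. Each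
  regrouping therefore rests on row- or column-finiteness of suitable factors. The action of
  \<open>W0\<close> on \<open>chi\<close> is instead analytic: \<open>W0\<close> is a Toeplitz
  matrix and multiplies \<open>chi\<close> by a power series, its symbol. The support is compact
  because it is closed and the region containing it is bounded, \<open>N\<close> being invertible.
  Compactness gives a ratio below 1 for the geometric series of the negative lattice powers.
  Admissibility of the times is only pointwise, so a majorant uniform on the support has to be
  constructed. No smoothness of \<open>S\<close> and \<open>H\<close> is assumed. The factorization
  at every admissible time makes all truncations of \<open>G\<close> invertible, and smoothness is
  extracted from them. The function \<open>Psi1\<close> is treated apart: at a point of its domain,
  which may lie outside the support, it is a scalar multiple of the polynomial vector, so its
  equation follows from the one for \<open>orth_poly\<close>.\<close>

definition dle :: "nat \<Rightarrow> 'd::finite mindex set" where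
  "dle n = {\<gamma>. mdeg \<gamma> \<le> n}"

lemma finite_dle [simp]: "finite (dle n :: 'd::finite mindex set)"
proof -
  have "dle n \<subseteq> vec_lambda ` (PiE (UNIV :: 'd set) (\<lambda>_. {..n}))"
  proof
    fix \<gamma> :: "'d mindex" assume "\<gamma> \<in> dle n"
    then have "\<gamma> $ i \<le> n" for i
      using member_le_sum[of i UNIV "\<lambda>i. \<gamma> $ i"] by (auto simp: dle_def mdeg_def)
    then have "vec_nth \<gamma> \<in> PiE UNIV (\<lambda>_. {..n})" by auto
    then show "\<gamma> \<in> vec_lambda ` (PiE (UNIV :: 'd set) (\<lambda>_. {..n}))"
      by (metis image_eqI vec_nth_inverse)
  qed
  then show ?thesis
    by (rule finite_subset) (intro finite_imageI finite_PiE, auto)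
qed

lemma mem_dle [simp]: "\<gamma> \<in> dle n \<longleftrightarrow> mdeg \<gamma> \<le> n"
  by (simp add: dle_def)

lemma mem_level [simp]: "\<gamma> \<in> level k \<longleftrightarrow> mdeg \<gamma> = k"
  by (simp add: level_def)

lemma finite_level [simp]: "finite (level k :: 'd::finite mindex set)"
  by (rule finite_subset[of _ "dle k"]) auto

lemma sum_levels:
  fixes f :: "'d::finite mindex \<Rightarrow> 'b::comm_monoid_add"
  shows "(\<Sum>k\<le>n. \<Sum>\<gamma>\<in>level k. f \<gamma>) = (\<Sum>\<gamma>\<in>dle n. f \<gamma>)"
proof -
  have "(\<Sum>k\<le>n. \<Sum>\<gamma>\<in>level k. f \<gamma>) = sum f (\<Union>k\<in>{..n}. level k)"
    by (rule sum.UNION_disjoint[symmetric]) auto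
  also have "(\<Union>k\<in>{..n}. level k) = (dle n :: 'd mindex set)"
    by (auto simp: level_def)
  finally show ?thesis .
qed

lemma suminf_levels_finite:
  fixes f :: "'d::finite mindex \<Rightarrow> real"
  assumes "\<And>\<gamma>. n < mdeg \<gamma> \<Longrightarrow> f \<gamma> = 0"
  shows "(\<Sum>k. \<Sum>\<gamma>\<in>level k. f \<gamma>) = (\<Sum>\<gamma>\<in>dle n. f \<gamma>)"
proof -
  have "(\<Sum>k. \<Sum>\<gamma>\<in>level k. f \<gamma>) = (\<Sum>k\<le>n. \<Sum>\<gamma>\<in>level k. f \<gamma>)"
    using assms by (intro suminf_finite) auto
  then show ?thesis by (simp add: sum_levels)
qed

lemma smat_mult_finite:
  assumes "\<And>\<gamma>. n < mdeg \<gamma> \<Longrightarrow> A \<alpha> \<gamma> * B \<gamma> \<beta> = 0"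
  shows "(A \<odot> B) \<alpha> \<beta> = (\<Sum>\<gamma>\<in>dle n. A \<alpha> \<gamma> * B \<gamma> \<beta>)"
  unfolding smat_mult_def using assms by (rule suminf_levels_finite)

lemma svec_finite:
  assumes "\<And>\<gamma>. n < mdeg \<gamma> \<Longrightarrow> A \<alpha> \<gamma> * V \<gamma> p = 0"
  shows "(A \<odot>\<^sub>v V) \<alpha> p = (\<Sum>\<gamma>\<in>dle n. A \<alpha> \<gamma> * V \<gamma> p)"
  unfolding svec_def using assms by (rule suminf_levels_finite)

text \<open>Degree blocks are finite, so a degree bound on a row leaves finitely many nonzero
  entries. Lower triangular matrices and shifts are row-finite, upper triangular ones column-finite;
  these two properties justify the regrouping of matrix products below.\<close>

definition rowfin :: "'d::finite smat \<Rightarrow> bool" where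
  "rowfin A \<longleftrightarrow> (\<forall>\<alpha>. \<exists>n. \<forall>\<gamma>. n < mdeg \<gamma> \<longrightarrow> A \<alpha> \<gamma> = 0)"

definition colfin :: "'d::finite smat \<Rightarrow> bool" where
  "colfin A \<longleftrightarrow> (\<forall>\<beta>. \<exists>n. \<forall>\<gamma>. n < mdeg \<gamma> \<longrightarrow> A \<gamma> \<beta> = 0)"

text \<open>Only finitely many rows have degree at most \<open>k\<close>, so their individual bounds
  have a common maximum.\<close>

lemma rowfin_bound_dle:
  assumes "rowfin A"
  obtains n where "\<And>\<alpha> \<gamma>. mdeg \<alpha> \<le> k \<Longrightarrow> n < mdeg \<gamma> \<Longrightarrow> A \<alpha> \<gamma> = 0"
proof -
  obtain f where f: "\<And>\<alpha> \<gamma>. f \<alpha> < mdeg \<gamma> \<Longrightarrow> A \<alpha> \<gamma> = 0"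
    using assms unfolding rowfin_def by metis
  show thesis
  proof
    fix \<alpha> \<gamma> :: "'a mindex" assume "mdeg \<alpha> \<le> k" "Max (f ` dle k) < mdeg \<gamma>"
    then have "f \<alpha> < mdeg \<gamma>" by (metis Max_ge finite_dle finite_imageI imageI le_less_trans mem_dle)
    then show "A \<alpha> \<gamma> = 0" by (rule f)
  qed
qed

lemma strans_strans [simp]: "strans (strans A) = A"
  by (simp add: strans_def fun_eq_iff)

lemma strans_apply [simp]: "strans A \<alpha> \<beta> = A \<beta> \<alpha>"
  by (simp add: strans_def)

lemma strans_sone [simp]: "strans sone = sone"
  by (auto simp: sone_def fun_eq_iff)

lemma strans_mult: "strans (A \<odot> B) = strans B \<odot> strans A"
  by (simp add: smat_mult_def fun_eq_iff mult.commute)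

lemma rowfin_strans [simp]: "rowfin (strans A) \<longleftrightarrow> colfin A"
  and colfin_strans [simp]: "colfin (strans A) \<longleftrightarrow> rowfin A"
  by (simp_all add: rowfin_def colfin_def)

lemma block_lower_strans [simp]: "block_lower (strans A) \<longleftrightarrow> block_upper A"
  and block_upper_strans [simp]: "block_upper (strans A) \<longleftrightarrow> block_lower A"
  by (auto simp: block_lower_def block_upper_def)

lemma rowfin_lower: "block_lower A \<Longrightarrow> rowfin A"
  unfolding block_lower_def rowfin_def by blast

lemma colfin_upper: "block_upper A \<Longrightarrow> colfin A"
  unfolding block_upper_def colfin_def by blast

lemma smat_mult_lower:
  assumes "block_lower A" "mdeg \<alpha> \<le> n"
  shows "(A \<odot> B) \<alpha> \<beta> = (\<Sum>\<gamma>\<in>dle n. A \<alpha> \<gamma> * B \<gamma> \<beta>)"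
  using assms by (intro smat_mult_finite) (auto simp: block_lower_def)

lemma smat_mult_upper:
  assumes "block_upper B" "mdeg \<beta> \<le> n"
  shows "(A \<odot> B) \<alpha> \<beta> = (\<Sum>\<gamma>\<in>dle n. A \<alpha> \<gamma> * B \<gamma> \<beta>)"
  using assms by (intro smat_mult_finite) (auto simp: block_upper_def)

lemma rowfin_mult:
  assumes A: "rowfin A" and B: "rowfin B"
  shows "rowfin (A \<odot> B)"
  unfolding rowfin_def
proof
  fix \<alpha>
  obtain k where k: "\<And>\<gamma>. k < mdeg \<gamma> \<Longrightarrow> A \<alpha> \<gamma> = 0" using A by (metis rowfin_def)
  obtain n where n: "\<And>\<alpha> \<gamma>. mdeg \<alpha> \<le> k \<Longrightarrow> n < mdeg \<gamma> \<Longrightarrow> B \<alpha> \<gamma> = 0"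
    using B by (rule rowfin_bound_dle[where k=k]) blast
  have "(A \<odot> B) \<alpha> \<beta> = (\<Sum>\<gamma>\<in>dle k. A \<alpha> \<gamma> * B \<gamma> \<beta>)" for \<beta>
    using k by (intro smat_mult_finite) auto
  then show "\<exists>n. \<forall>\<gamma>. n < mdeg \<gamma> \<longrightarrow> (A \<odot> B) \<alpha> \<gamma> = 0"
    using n by (intro exI[of _ n]) auto
qed

lemma colfin_mult: "colfin A \<Longrightarrow> colfin B \<Longrightarrow> colfin (A \<odot> B)"
  using rowfin_mult[of "strans B" "strans A"] by (simp flip: strans_mult)

lemma block_lower_mult:
  assumes "block_lower A" "block_lower B"
  shows "block_lower (A \<odot> B)"
  unfolding block_lower_def
proof (intro allI impI)
  fix \<alpha> \<beta> :: "'a mindex" assume "mdeg \<alpha> < mdeg \<beta>"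
  then show "(A \<odot> B) \<alpha> \<beta> = 0"
    using assms by (subst smat_mult_lower[OF assms(1) order_refl])
      (auto simp: block_lower_def intro!: sum.neutral)
qed

lemma block_upper_mult: "block_upper A \<Longrightarrow> block_upper B \<Longrightarrow> block_upper (A \<odot> B)"
  using block_lower_mult[of "strans B" "strans A"] by (simp flip: strans_mult)

text \<open>Both sums are finite in a fixed row and can be interchanged. \<open>C\<close> is
  arbitrary, which admits a full moment matrix as the last factor.\<close>

lemma smat_mult_assoc_rr:
  assumes A: "rowfin A" and B: "rowfin B"
  shows "A \<odot> B \<odot> C = A \<odot> (B \<odot> C)"
proof (intro ext)
  fix \<alpha> \<beta>
  obtain k where k: "\<And>\<gamma>. k < mdeg \<gamma> \<Longrightarrow> A \<alpha> \<gamma> = 0" using A by (metis rowfin_def)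
  obtain n where n: "\<And>\<alpha> \<gamma>. mdeg \<alpha> \<le> k \<Longrightarrow> n < mdeg \<gamma> \<Longrightarrow> B \<alpha> \<gamma> = 0"
    using B by (rule rowfin_bound_dle[where k=k]) blast
  have AB: "(A \<odot> B) \<alpha> \<delta> = (\<Sum>\<gamma>\<in>dle k. A \<alpha> \<gamma> * B \<gamma> \<delta>)" for \<delta>
    using k by (intro smat_mult_finite) auto
  have BC: "(B \<odot> C) \<gamma> \<beta> = (\<Sum>\<delta>\<in>dle n. B \<gamma> \<delta> * C \<delta> \<beta>)" if "mdeg \<gamma> \<le> k" for \<gamma>
    using n that by (intro smat_mult_finite) auto
  have "(A \<odot> B \<odot> C) \<alpha> \<beta> = (\<Sum>\<delta>\<in>dle n. (A \<odot> B) \<alpha> \<delta> * C \<delta> \<beta>)"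
    using n by (intro smat_mult_finite) (simp add: AB)
  also have "\<dots> = (\<Sum>\<gamma>\<in>dle k. A \<alpha> \<gamma> * (\<Sum>\<delta>\<in>dle n. B \<gamma> \<delta> * C \<delta> \<beta>))"
    by (simp add: AB sum_distrib_left sum_distrib_right mult.assoc) (rule sum.swap)
  also have "\<dots> = (\<Sum>\<gamma>\<in>dle k. A \<alpha> \<gamma> * (B \<odot> C) \<gamma> \<beta>)"
    using BC by (intro sum.cong) auto
  also have "\<dots> = (A \<odot> (B \<odot> C)) \<alpha> \<beta>"
    using k by (intro smat_mult_finite[symmetric]) auto
  finally show "(A \<odot> B \<odot> C) \<alpha> \<beta> = (A \<odot> (B \<odot> C)) \<alpha> \<beta>" .
qed

lemma smat_mult_assoc_cc:
  assumes "colfin B" "colfin C"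
  shows "A \<odot> B \<odot> C = A \<odot> (B \<odot> C)"
proof -
  have "strans (A \<odot> B \<odot> C) = strans (A \<odot> (B \<odot> C))"
    unfolding strans_mult using assms by (subst smat_mult_assoc_rr) auto
  then show ?thesis by (metis strans_strans)
qed

text \<open>The outer factors alone make both sums finite, so the middle factor may be full or have
  infinite rows, as \<open>W2\<close> has.\<close>

lemma smat_mult_assoc_rc:
  assumes A: "rowfin A" and C: "colfin C"
  shows "A \<odot> B \<odot> C = A \<odot> (B \<odot> C)"
proof (intro ext)
  fix \<alpha> \<beta>
  obtain k where k: "\<And>\<gamma>. k < mdeg \<gamma> \<Longrightarrow> A \<alpha> \<gamma> = 0" using A by (metis rowfin_def)
  obtain n where n: "\<And>\<gamma>. n < mdeg \<gamma> \<Longrightarrow> C \<gamma> \<beta> = 0" using C by (metis colfin_def)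
  have AB: "(A \<odot> B) \<alpha> \<delta> = (\<Sum>\<gamma>\<in>dle k. A \<alpha> \<gamma> * B \<gamma> \<delta>)" for \<delta>
    using k by (intro smat_mult_finite) auto
  have BC: "(B \<odot> C) \<gamma> \<beta> = (\<Sum>\<delta>\<in>dle n. B \<gamma> \<delta> * C \<delta> \<beta>)" for \<gamma>
    using n by (intro smat_mult_finite) auto
  have "(A \<odot> B \<odot> C) \<alpha> \<beta> = (\<Sum>\<delta>\<in>dle n. (A \<odot> B) \<alpha> \<delta> * C \<delta> \<beta>)"
    using n by (intro smat_mult_finite) simp
  also have "\<dots> = (\<Sum>\<gamma>\<in>dle k. A \<alpha> \<gamma> * (B \<odot> C) \<gamma> \<beta>)"
    by (simp add: AB BC sum_distrib_left sum_distrib_right mult.assoc) (rule sum.swap)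
  also have "\<dots> = (A \<odot> (B \<odot> C)) \<alpha> \<beta>"
    using k by (intro smat_mult_finite[symmetric]) auto
  finally show "(A \<odot> B \<odot> C) \<alpha> \<beta> = (A \<odot> (B \<odot> C)) \<alpha> \<beta>" .
qed

text \<open>At a fixed \<open>p\<close> a vector is a matrix with equal columns, hence the free
  column index \<open>\<delta>\<close>. Associativity and linearity for vectors are inherited from
  matrices in this way.\<close>

lemma svec_eq_mult: "(A \<odot>\<^sub>v V) \<beta> p = (A \<odot> (\<lambda>\<gamma> _. V \<gamma> p)) \<beta> \<delta>"
  by (simp add: smat_mult_def svec_def)

lemma svec_assocI:
  assumes "\<And>p. A \<odot> B \<odot> (\<lambda>\<gamma> _. V \<gamma> p) = A \<odot> (B \<odot> (\<lambda>\<gamma> _. V \<gamma> p))"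
  shows "(A \<odot> B) \<odot>\<^sub>v V = A \<odot>\<^sub>v B \<odot>\<^sub>v V"
proof (intro ext)
  fix \<alpha> p
  have "(\<lambda>\<gamma> _. (B \<odot>\<^sub>v V) \<gamma> p) = B \<odot> (\<lambda>\<gamma> _. V \<gamma> p)"
    by (intro ext) (rule svec_eq_mult)
  then show "((A \<odot> B) \<odot>\<^sub>v V) \<alpha> p = (A \<odot>\<^sub>v B \<odot>\<^sub>v V) \<alpha> p"
    using assms[of p] by (simp add: svec_eq_mult[where \<delta>=\<alpha>])
qed

lemma svec_assoc: "rowfin A \<Longrightarrow> rowfin B \<Longrightarrow> (A \<odot> B) \<odot>\<^sub>v V = A \<odot>\<^sub>v B \<odot>\<^sub>v V"
  by (intro svec_assocI smat_mult_assoc_rr)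

text \<open>Meant for \<open>chi_star\<close>: each Laurent exponent occurs in at most one entry, so
  the vector is finite at each \<open>p\<close> and \<open>B\<close> may have infinite rows.\<close>

lemma svec_assoc_finite:
  assumes "rowfin A" "\<And>p. \<exists>n. \<forall>\<gamma>. n < mdeg \<gamma> \<longrightarrow> V \<gamma> p = 0"
  shows "(A \<odot> B) \<odot>\<^sub>v V = A \<odot>\<^sub>v B \<odot>\<^sub>v V"
  using assms by (intro svec_assocI smat_mult_assoc_rc) (auto simp: colfin_def)

section \<open>Linearity of the block product, and the identity matrix\<close>

lemma smat_mult_add_right:
  assumes "rowfin A" shows "A \<odot> (B + C) = A \<odot> B + A \<odot> C"
proof (intro ext)
  fix \<alpha> \<beta>
  obtain k where k: "\<And>\<gamma>. k < mdeg \<gamma> \<Longrightarrow> A \<alpha> \<gamma> = 0" using assms by (metis rowfin_def)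
  have "(A \<odot> B) \<alpha> \<beta> = (\<Sum>\<gamma>\<in>dle k. A \<alpha> \<gamma> * B \<gamma> \<beta>)" for B
    using k by (intro smat_mult_finite) auto
  then show "(A \<odot> (B + C)) \<alpha> \<beta> = (A \<odot> B + A \<odot> C) \<alpha> \<beta>"
    by (simp add: algebra_simps sum.distrib)
qed

lemma smat_mult_minus_right: "rowfin A \<or> colfin B \<Longrightarrow> A \<odot> (- B) = - (A \<odot> B)"
proof (intro ext)
  fix \<alpha> \<beta>
  assume *: "rowfin A \<or> colfin B"
  obtain k where k: "\<And>\<gamma>. k < mdeg \<gamma> \<Longrightarrow> A \<alpha> \<gamma> * B \<gamma> \<beta> = 0"
    using * by (metis colfin_def mult_eq_0_iff rowfin_def)
  have "(A \<odot> B) \<alpha> \<beta> = (\<Sum>\<gamma>\<in>dle k. A \<alpha> \<gamma> * B \<gamma> \<beta>)"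
    using k by (intro smat_mult_finite) auto
  moreover have "(A \<odot> (- B)) \<alpha> \<beta> = (\<Sum>\<gamma>\<in>dle k. A \<alpha> \<gamma> * (- B) \<gamma> \<beta>)"
    using k by (intro smat_mult_finite) auto
  ultimately show "(A \<odot> (- B)) \<alpha> \<beta> = (- (A \<odot> B)) \<alpha> \<beta>"
    by (simp add: sum_negf)
qed

lemma smat_mult_diff_right:
  assumes "rowfin A" shows "A \<odot> (B - C) = A \<odot> B - A \<odot> C"
  using smat_mult_add_right[OF assms, of B "- C"] smat_mult_minus_right[of A C] assms
  by simp

lemma rowfin_uminus [simp]: "rowfin (- A) \<longleftrightarrow> rowfin A"
  by (simp add: rowfin_def)

lemma rowfin_add: "rowfin A \<Longrightarrow> rowfin B \<Longrightarrow> rowfin (A + B)"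
  unfolding rowfin_def
proof
  fix \<alpha> assume *: "\<forall>\<alpha>. \<exists>n. \<forall>\<gamma>. n < mdeg \<gamma> \<longrightarrow> A \<alpha> \<gamma> = 0"
    "\<forall>\<alpha>. \<exists>n. \<forall>\<gamma>. n < mdeg \<gamma> \<longrightarrow> B \<alpha> \<gamma> = 0"
  then obtain n k where "\<forall>\<gamma>. n < mdeg \<gamma> \<longrightarrow> A \<alpha> \<gamma> = 0" "\<forall>\<gamma>. k < mdeg \<gamma> \<longrightarrow> B \<alpha> \<gamma> = 0"
    by blast
  then show "\<exists>n. \<forall>\<gamma>. n < mdeg \<gamma> \<longrightarrow> (A + B) \<alpha> \<gamma> = 0"
    by (intro exI[of _ "max n k"]) auto
qed

lemma rowfin_diff: "rowfin A \<Longrightarrow> rowfin B \<Longrightarrow> rowfin (A - B)"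
  using rowfin_add[of A "- B"] by simp

lemma smat_mult_add_left:
  assumes "rowfin A" "rowfin B" shows "(A + B) \<odot> C = A \<odot> C + B \<odot> C"
proof (intro ext)
  fix \<alpha> \<beta>
  obtain k where k: "\<And>\<gamma>. k < mdeg \<gamma> \<Longrightarrow> A \<alpha> \<gamma> = 0" using assms(1) by (metis rowfin_def)
  obtain l where l: "\<And>\<gamma>. l < mdeg \<gamma> \<Longrightarrow> B \<alpha> \<gamma> = 0" using assms(2) by (metis rowfin_def)
  have "(A \<odot> C) \<alpha> \<beta> = (\<Sum>\<gamma>\<in>dle (max k l). A \<alpha> \<gamma> * C \<gamma> \<beta>)"
    "(B \<odot> C) \<alpha> \<beta> = (\<Sum>\<gamma>\<in>dle (max k l). B \<alpha> \<gamma> * C \<gamma> \<beta>)"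
    "((A + B) \<odot> C) \<alpha> \<beta> = (\<Sum>\<gamma>\<in>dle (max k l). (A + B) \<alpha> \<gamma> * C \<gamma> \<beta>)"
    using k l by (intro smat_mult_finite; auto)+
  then show "((A + B) \<odot> C) \<alpha> \<beta> = (A \<odot> C + B \<odot> C) \<alpha> \<beta>"
    by (simp add: algebra_simps sum.distrib)
qed

lemma smat_mult_minus_left: "rowfin A \<or> colfin B \<Longrightarrow> (- A) \<odot> B = - (A \<odot> B)"
proof -
  assume "rowfin A \<or> colfin B"
  moreover have m: "strans (- X) = - strans X" for X :: "'a smat" by (simp add: fun_eq_iff)
  ultimately have "strans ((- A) \<odot> B) = strans (- (A \<odot> B))"
    using smat_mult_minus_right[of "strans B" "strans A"] by (auto simp: strans_mult)
  then show ?thesis by (metis strans_strans)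
qed

lemma smat_mult_diff_left:
  assumes "rowfin A" "rowfin B" shows "(A - B) \<odot> C = A \<odot> C - B \<odot> C"
  using smat_mult_add_left[of A "- B" C] smat_mult_minus_left[of B C] assms by simp

lemma block_upper_sone [simp]: "block_upper sone"
  and block_lower_sone [simp]: "block_lower sone"
  by (auto simp: block_upper_def block_lower_def sone_def)

lemma rowfin_sone [simp]: "rowfin sone" and colfin_sone [simp]: "colfin sone"
  by (auto intro: rowfin_lower colfin_upper)

lemma sone_mult [simp]: "sone \<odot> A = A"
proof (intro ext)
  fix \<alpha> \<beta>
  have "(sone \<odot> A) \<alpha> \<beta> = (\<Sum>\<gamma>\<in>dle (mdeg \<alpha>). sone \<alpha> \<gamma> * A \<gamma> \<beta>)"
    by (intro smat_mult_lower) auto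
  also have "\<dots> = (\<Sum>\<gamma>\<in>{\<alpha>}. sone \<alpha> \<gamma> * A \<gamma> \<beta>)"
    by (rule sum.mono_neutral_right) (auto simp: sone_def)
  finally show "(sone \<odot> A) \<alpha> \<beta> = A \<alpha> \<beta>" by (simp add: sone_def)
qed

lemma mult_sone [simp]: "A \<odot> sone = A"
  using sone_mult[of "strans A"] by (metis strans_mult strans_sone strans_strans)

subsection \<open>Triangular inverses\<close>

lemma block_upper_spow: "block_upper A \<Longrightarrow> block_upper (spow A n)"
  by (induction n) (auto intro: block_upper_mult)

text \<open>Each factor lowers the degree by at least one on the way from the row to the column
  index.\<close>

lemma spow_strictly_lower:
  fixes A :: "'d::finite smat" and \<alpha> \<beta> :: "'d mindex"
  assumes "\<And>\<alpha> \<beta> :: 'd mindex. mdeg \<alpha> \<le> mdeg \<beta> \<Longrightarrow> A \<alpha> \<beta> = 0" "mdeg \<alpha> < mdeg \<beta> + n"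
  shows "spow A n \<alpha> \<beta> = 0"
  using assms(2)
proof (induction n arbitrary: \<alpha>)
  case 0 then show ?case by (auto simp: sone_def)
next
  case (Suc n)
  have "(A \<odot> spow A n) \<alpha> \<beta> = (\<Sum>\<gamma>\<in>dle (mdeg \<alpha>). A \<alpha> \<gamma> * spow A n \<gamma> \<beta>)"
    using assms(1) by (intro smat_mult_finite) auto
  also have "\<dots> = 0"
  proof (rule sum.neutral, rule ballI)
    fix \<gamma> :: "'d mindex"
    show "A \<alpha> \<gamma> * spow A n \<gamma> \<beta> = 0"
    proof (cases "mdeg \<gamma> < mdeg \<alpha>")
      case True then show ?thesis using Suc by simp
    next
      case False then show ?thesis using assms(1) by simp
    qed
  qed
  finally show ?case by simp
qed

lemma unilower_right_inverse:
  assumes "block_unilower S"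
  shows "\<exists>B. block_unilower B \<and> S \<odot> B = sone"
proof -
  \<comment> \<open>the Neumann series of \<open>S = 1 - E\<close> with \<open>E\<close> strictly lower triangular\<close>
  define E where "E = sone - S"
  have E0: "E \<alpha> \<beta> = 0" if "mdeg \<alpha> \<le> mdeg \<beta>" for \<alpha> \<beta>
  proof (cases "mdeg \<alpha> = mdeg \<beta>")
    case True
    then show ?thesis using assms by (simp add: E_def block_unilower_def)
  next
    case False
    then have "\<alpha> \<noteq> \<beta>" by blast
    with False show ?thesis using assms that 
      by (simp add: E_def block_unilower_def block_lower_def sone_def)
  qed
  have Er: "rowfin E" using E0 by (intro rowfin_lower) (auto simp: block_lower_def)
  \<comment> \<open>In row \<open>\<alpha>\<close> all powers beyond \<open>mdeg \<alpha>\<close>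
    vanish, so this finite sum is the whole series and may be lengthened at will, as
    \<open>Bn\<close> does.\<close>
  define B where "B = (\<lambda>\<alpha> \<beta>. \<Sum>j\<le>mdeg \<alpha>. spow E j \<alpha> \<beta>)"
  have z: "spow E j \<alpha> \<beta> = 0" if "mdeg \<alpha> < mdeg \<beta> + j" for \<alpha> \<beta> j
    using E0 that by (rule spow_strictly_lower)
  have Bn: "B \<alpha> \<beta> = (\<Sum>j<n. spow E j \<alpha> \<beta>)" if "mdeg \<alpha> < n" for \<alpha> \<beta> n
    unfolding B_def using that z by (intro sum.mono_neutral_left) auto
  have EB: "(E \<odot> B) \<alpha> \<beta> = B \<alpha> \<beta> - sone \<alpha> \<beta>" for \<alpha> \<beta>
  proof -
    have "(E \<odot> B) \<alpha> \<beta> = (\<Sum>\<gamma>\<in>dle (mdeg \<alpha>). E \<alpha> \<gamma> * B \<gamma> \<beta>)"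
      using E0 by (intro smat_mult_finite) auto
    \<comment> \<open>A nonzero \<open>E \<alpha> \<gamma>\<close> forces
      \<open>mdeg \<gamma> < mdeg \<alpha>\<close>, so all inner sums can be given the same range
      and then exchanged with the outer one.\<close>
    also have "\<dots> = (\<Sum>\<gamma>\<in>dle (mdeg \<alpha>). E \<alpha> \<gamma> * (\<Sum>j<mdeg \<alpha>. spow E j \<gamma> \<beta>))"
    proof (rule sum.cong)
      fix \<gamma> show "E \<alpha> \<gamma> * B \<gamma> \<beta> = E \<alpha> \<gamma> * (\<Sum>j<mdeg \<alpha>. spow E j \<gamma> \<beta>)"
        using E0[of \<alpha> \<gamma>] Bn[of \<gamma> "mdeg \<alpha>" \<beta>] by (cases "mdeg \<gamma> < mdeg \<alpha>") auto
    qed simp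
    also have "\<dots> = (\<Sum>j<mdeg \<alpha>. \<Sum>\<gamma>\<in>dle (mdeg \<alpha>). E \<alpha> \<gamma> * spow E j \<gamma> \<beta>)"
      by (simp add: sum_distrib_left) (rule sum.swap)
    also have "\<dots> = (\<Sum>j<mdeg \<alpha>. spow E (Suc j) \<alpha> \<beta>)"
      unfolding spow.simps using E0
      by (intro sum.cong refl smat_mult_finite[symmetric]) auto
    also have "\<dots> = (\<Sum>j<Suc (mdeg \<alpha>). spow E j \<alpha> \<beta>) - sone \<alpha> \<beta>"
      by (simp add: sum.lessThan_Suc_shift del: spow.simps(2) sum.lessThan_Suc)
    finally show ?thesis using Bn[of \<alpha> "Suc (mdeg \<alpha>)"] by simp
  qed
  have "S \<odot> B = (sone - E) \<odot> B" by (simp add: E_def)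
  also have "\<dots> = B - E \<odot> B" using Er by (simp add: smat_mult_diff_left)
  also have "\<dots> = sone" using EB by (auto simp: fun_eq_iff)
  finally have "S \<odot> B = sone" .
  moreover have "block_unilower B"
    unfolding block_unilower_def block_lower_def
  proof (intro conjI allI impI)
    fix \<alpha> \<beta> :: "'a mindex" assume "mdeg \<alpha> < mdeg \<beta>"
    then show "B \<alpha> \<beta> = 0" by (simp add: B_def z)
  next
    fix \<alpha> \<beta> :: "'a mindex" assume "mdeg \<alpha> = mdeg \<beta>"
    then have "B \<alpha> \<beta> = (\<Sum>j\<in>{0}. spow E j \<alpha> \<beta>)"
      unfolding B_def by (intro sum.mono_neutral_right) (auto simp: z simp del: spow.simps)
    then show "B \<alpha> \<beta> = sone \<alpha> \<beta>" by simp
  qed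
  ultimately show ?thesis by blast
qed

text \<open>The right inverse has a right inverse in turn, and associativity of lower triangular
  products identifies the latter with \<open>S\<close>.\<close>

lemma unilower_inverse:
  assumes "block_unilower S"
  obtains B where "block_unilower B" "S \<odot> B = sone" "B \<odot> S = sone"
proof -
  obtain B where B: "block_unilower B" "S \<odot> B = sone" using unilower_right_inverse[OF assms] by blast
  obtain C where C: "block_unilower C" "B \<odot> C = sone" using unilower_right_inverse[OF B(1)] by blast
  have "S = S \<odot> (B \<odot> C)" by (simp add: C)
  also have "\<dots> = C" using assms B C 
    by (subst smat_mult_assoc_rr[symmetric]) (auto simp: block_unilower_def rowfin_lower)
  finally show thesis using that B C by blast
qed

lemma lower_inv_eqI:
  assumes "block_lower A" "block_lower B" "A \<odot> B = sone" "B \<odot> A = sone"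
  shows "lower_inv A = B"
  unfolding lower_inv_def
proof (rule the_equality)
  fix C assume C: "block_lower C \<and> A \<odot> C = sone \<and> C \<odot> A = sone"
  have "C = C \<odot> (A \<odot> B)" by (simp add: assms)
  also have "\<dots> = C \<odot> A \<odot> B"
    using C assms(1) by (intro smat_mult_assoc_rr[symmetric]) (auto intro: rowfin_lower)
  finally show "C = B" using C by simp
qed (use assms in auto)

lemma upper_inv_eqI:
  assumes "block_upper A" "block_upper B" "A \<odot> B = sone" "B \<odot> A = sone"
  shows "upper_inv A = B"
  unfolding upper_inv_def
proof (rule the_equality)
  fix C assume C: "block_upper C \<and> A \<odot> C = sone \<and> C \<odot> A = sone"
  have "B = C \<odot> A \<odot> B" using C by simp
  also have "\<dots> = C \<odot> (A \<odot> B)"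
    using C assms by (intro smat_mult_assoc_cc) (auto intro: colfin_upper)
  finally show "C = B" using assms by simp
qed (use assms in auto)

lemma block_unilower_lower: "block_unilower S \<Longrightarrow> block_lower S"
  by (simp add: block_unilower_def)

lemma lower_inv:
  assumes "block_unilower S"
  shows block_unilower_lower_inv: "block_unilower (lower_inv S)"
    and mult_lower_inv: "S \<odot> lower_inv S = sone"
    and lower_inv_mult: "lower_inv S \<odot> S = sone"
proof -
  obtain B where B: "block_unilower B" "S \<odot> B = sone" "B \<odot> S = sone"
    using unilower_inverse[OF assms] .
  then have "lower_inv S = B"
    using assms by (intro lower_inv_eqI) (auto intro: block_unilower_lower)
  with B show "block_unilower (lower_inv S)" "S \<odot> lower_inv S = sone" "lower_inv S \<odot> S = sone"
    by auto
qed

lemma block_diagonal_lower: "block_diagonal H \<Longrightarrow> block_lower H"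
  and block_diagonal_upper: "block_diagonal H \<Longrightarrow> block_upper H"
  by (auto simp: block_diagonal_def block_lower_def block_upper_def)

lemma block_diagonal_mult:
  assumes "block_diagonal H" "block_diagonal K"
  shows "(H \<odot> K) \<alpha> \<beta> = (if mdeg \<alpha> = mdeg \<beta> then (\<Sum>\<gamma>\<in>level (mdeg \<alpha>). H \<alpha> \<gamma> * K \<gamma> \<beta>) else 0)"
proof -
  have "(H \<odot> K) \<alpha> \<beta> = (\<Sum>\<gamma>\<in>dle (mdeg \<alpha>). H \<alpha> \<gamma> * K \<gamma> \<beta>)"
    using assms by (intro smat_mult_lower) (auto intro: block_diagonal_lower)
  also have "\<dots> = (\<Sum>\<gamma>\<in>level (mdeg \<alpha>). H \<alpha> \<gamma> * K \<gamma> \<beta>)"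
    using assms by (intro sum.mono_neutral_right) (auto simp: block_diagonal_def)
  finally show ?thesis using assms by (auto simp: block_diagonal_def)
qed

lemma block_diagonal_inverse:
  assumes "block_diagonal H" "\<And>k. diag_block_invertible H k"
  obtains K where "block_diagonal K" "H \<odot> K = sone" "K \<odot> H = sone"
proof -
  have "\<forall>k. \<exists>B. \<forall>\<alpha>\<in>level k. \<forall>\<beta>\<in>level k.
      (\<Sum>\<gamma>\<in>level k. H \<alpha> \<gamma> * B \<gamma> \<beta>) = sone \<alpha> \<beta> \<and>
      (\<Sum>\<gamma>\<in>level k. B \<alpha> \<gamma> * H \<gamma> \<beta>) = sone \<alpha> \<beta>"
    using assms(2) unfolding diag_block_invertible_def by blast
  from choice[OF this] obtain B where B: "\<And>k. \<forall>\<alpha>\<in>level k. \<forall>\<beta>\<in>level k.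
      (\<Sum>\<gamma>\<in>level k. H \<alpha> \<gamma> * B k \<gamma> \<beta>) = sone \<alpha> \<beta> \<and>
      (\<Sum>\<gamma>\<in>level k. B k \<alpha> \<gamma> * H \<gamma> \<beta>) = sone \<alpha> \<beta>"
    by blast
  define K where "K = (\<lambda>\<alpha> \<beta>. if mdeg \<alpha> = mdeg \<beta> then B (mdeg \<alpha>) \<alpha> \<beta> else 0)"
  have K: "block_diagonal K" by (simp add: K_def block_diagonal_def)
  have "(H \<odot> K) \<alpha> \<beta> = sone \<alpha> \<beta>" "(K \<odot> H) \<alpha> \<beta> = sone \<alpha> \<beta>" for \<alpha> \<beta>
    unfolding block_diagonal_mult[OF assms(1) K] block_diagonal_mult[OF K assms(1)]
    using B[of "mdeg \<alpha>"] by (auto simp: K_def sone_def)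
  with K show thesis by (intro that) (auto simp: fun_eq_iff)
qed

subsection \<open>Shift matrices\<close>

text \<open>This is \<open>Lam_mi \<delta>\<close> without the ordered product of powers, see
  \<open>Lam_mi_eq_shift\<close>; it multiplies \<open>chi\<close> by the monomial with exponent
  \<open>\<delta>\<close>.\<close>

definition shift :: "'d::finite mindex \<Rightarrow> 'd smat" where
  "shift \<delta> \<alpha> \<beta> = (if \<alpha> + \<delta> = \<beta> then 1 else 0)"

lemma mdeg_add [simp]: "mdeg (\<alpha> + \<beta>) = mdeg \<alpha> + mdeg \<beta>"
  by (simp add: mdeg_def sum.distrib)

lemma mdeg_axis [simp]: "mdeg (axis a n) = n"
  by (simp add: mdeg_def axis_def)

lemma mdeg_0 [simp]: "mdeg 0 = 0"
  by (simp add: mdeg_def)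

lemma shift_mult [simp]: "(shift \<delta> \<odot> B) \<alpha> \<beta> = B (\<alpha> + \<delta>) \<beta>"
proof -
  have "(shift \<delta> \<odot> B) \<alpha> \<beta> = (\<Sum>\<gamma>\<in>dle (mdeg (\<alpha> + \<delta>)). shift \<delta> \<alpha> \<gamma> * B \<gamma> \<beta>)"
    by (intro smat_mult_finite) (auto simp: shift_def)
  also have "\<dots> = (\<Sum>\<gamma>\<in>{\<alpha> + \<delta>}. shift \<delta> \<alpha> \<gamma> * B \<gamma> \<beta>)"
    by (rule sum.mono_neutral_right) (auto simp: shift_def)
  finally show ?thesis by (simp add: shift_def)
qed

lemma shift_svec [simp]: "(shift \<delta> \<odot>\<^sub>v V) \<alpha> p = V (\<alpha> + \<delta>) p"
proof -
  have "(shift \<delta> \<odot>\<^sub>v V) \<alpha> p = (\<Sum>\<gamma>\<in>dle (mdeg (\<alpha> + \<delta>)). shift \<delta> \<alpha> \<gamma> * V \<gamma> p)"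
    by (intro svec_finite) (auto simp: shift_def)
  also have "\<dots> = (\<Sum>\<gamma>\<in>{\<alpha> + \<delta>}. shift \<delta> \<alpha> \<gamma> * V \<gamma> p)"
    by (rule sum.mono_neutral_right) (auto simp: shift_def)
  finally show ?thesis by (simp add: shift_def)
qed

lemma rowfin_shift [simp]: "rowfin (shift \<delta>)"
  unfolding rowfin_def
proof
  fix \<alpha> :: "'a mindex"
  show "\<exists>n. \<forall>\<gamma>. n < mdeg \<gamma> \<longrightarrow> shift \<delta> \<alpha> \<gamma> = 0"
    by (rule exI[of _ "mdeg (\<alpha> + \<delta>)"]) (auto simp: shift_def)
qed

lemma block_upper_shift [simp]: "block_upper (shift \<delta>)"
  by (auto simp: block_upper_def shift_def)

lemma shift_shift: "shift \<delta> \<odot> shift \<epsilon> = shift (\<delta> + \<epsilon>)"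
  by (auto simp: fun_eq_iff shift_def add.assoc)

lemma shift_commute: "shift \<delta> \<odot> shift \<epsilon> = shift \<epsilon> \<odot> shift \<delta>"
  by (simp add: shift_shift add.commute)

lemma shift_0: "shift 0 = sone"
  by (auto simp: fun_eq_iff shift_def sone_def)

lemma Lam_eq_shift: "Lam a = shift (axis a 1)"
  by (auto simp: fun_eq_iff shift_def Lam_def)

lemma spow_Lam: "spow (Lam a) n = shift (axis a n)"
proof (induction n)
  case 0
  have "axis a 0 = (0 :: 'a mindex)" by (simp add: axis_def vec_eq_iff)
  then show ?case by (simp only: shift_0 spow.simps)
next
  case (Suc n)
  have "axis a 1 + axis a n = (axis a (Suc n) :: 'a mindex)" by (simp add: axis_def vec_eq_iff)
  with Suc show ?case by (simp add: Lam_eq_shift shift_shift)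
qed

text \<open>Offsets of successive shifts add up, so the sorted list contributes only the sum of its
  axis vectors, in which the order has disappeared.\<close>

lemma Lam_mi_eq_shift: "Lam_mi \<alpha> = shift \<alpha>"
proof -
  have "sprod_list (map (\<lambda>a. spow (Lam a) (\<alpha> $ a)) as) = shift (\<Sum>a\<leftarrow>as. axis a (\<alpha> $ a))" for as
    by (induction as) (auto simp: sprod_list_def shift_0 spow_Lam shift_shift)
  then have "Lam_mi \<alpha> = shift (\<Sum>a\<leftarrow>sorted_list_of_set UNIV. axis a (\<alpha> $ a))"
    by (simp add: Lam_mi_def)
  also have "(\<Sum>a\<leftarrow>sorted_list_of_set UNIV. axis a (\<alpha> $ a)) = (\<Sum>a\<in>UNIV. axis a (\<alpha> $ a))"
    by (simp add: sum_list_distinct_conv_sum_set)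
  also have "\<dots> = \<alpha>"
    by (simp add: vec_eq_iff axis_def)
  finally show ?thesis .
qed

lemma rowfin_lin_Lam [simp]: "rowfin (lin_Lam N q a)"
  unfolding rowfin_def
proof
  fix \<alpha> :: "'a mindex"
  show "\<exists>n. \<forall>\<gamma>. n < mdeg \<gamma> \<longrightarrow> lin_Lam N q a \<alpha> \<gamma> = 0"
    by (rule exI[of _ "mdeg \<alpha> + 1"])
      (auto simp: lin_Lam_def dot_Lam_def sscale_def sone_def Lam_def intro!: sum.neutral)
qed

lemma block_upper_lin_Lam [simp]: "block_upper (lin_Lam N q a)"
  by (auto simp: block_upper_def lin_Lam_def dot_Lam_def sscale_def sone_def Lam_def intro!: sum.neutral)

text \<open>Both matrices are Toeplitz: an entry depends only on the offset from row to column. This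
  later makes the resolvent intertwine the Jacobi matrices at neighbouring lattice sites.\<close>

lemma lin_Lam_shift_commute: "shift \<delta> \<odot> lin_Lam N q a = lin_Lam N q a \<odot> shift \<delta>"
proof (intro ext)
  fix \<alpha> \<beta>
  have comm: "\<alpha> + \<delta> + axis b 1 = \<alpha> + axis b 1 + \<delta>" for b
    by (simp add: add_ac)
  have "(lin_Lam N q a \<odot> shift \<delta>) \<alpha> \<beta> = (\<Sum>\<gamma>\<in>dle (mdeg \<alpha> + mdeg \<beta> + 1). lin_Lam N q a \<alpha> \<gamma> * shift \<delta> \<gamma> \<beta>)"
    by (intro smat_mult_finite) (auto simp: shift_def)
  also have "(\<Sum>\<gamma>\<in>dle (mdeg \<alpha> + mdeg \<beta> + 1). lin_Lam N q a \<alpha> \<gamma> * shift \<delta> \<gamma> \<beta>) = lin_Lam N q a (\<alpha> + \<delta>) \<beta>"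
  \<comment> \<open>Exponents are natural numbers, so column \<open>\<beta>\<close> of the shift is
    zero unless \<open>\<delta>\<close> can be taken off \<open>\<beta>\<close>; otherwise exactly
    one middle index survives.\<close>
  proof (cases "\<exists>\<gamma>. \<gamma> + \<delta> = \<beta>")
    case True
    then obtain \<gamma> where \<gamma>: "\<beta> = \<gamma> + \<delta>" by metis
    have "(\<Sum>\<gamma>'\<in>dle (mdeg \<alpha> + mdeg \<beta> + 1). lin_Lam N q a \<alpha> \<gamma>' * shift \<delta> \<gamma>' \<beta>) =
      (\<Sum>\<gamma>'\<in>{\<gamma>}. lin_Lam N q a \<alpha> \<gamma>' * shift \<delta> \<gamma>' \<beta>)"
      by (rule sum.mono_neutral_right) (auto simp: shift_def \<gamma>)
    moreover have "\<alpha> + \<delta> + axis b 1 = \<beta> \<longleftrightarrow> \<alpha> + axis b 1 = \<gamma>" for b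
      using comm[of b] by (simp add: \<gamma>)
    ultimately show ?thesis 
      by (simp add: shift_def \<gamma> lin_Lam_def dot_Lam_def sscale_def sone_def Lam_def)
  next
    case False
    then have "\<alpha> + \<delta> + axis b 1 \<noteq> \<beta>" "\<alpha> + \<delta> \<noteq> \<beta>" for b
      unfolding comm[of b] by blast+
    with False show ?thesis
      by (auto simp: shift_def lin_Lam_def dot_Lam_def sscale_def sone_def Lam_def intro!: sum.neutral)
  qed
  finally show "(shift \<delta> \<odot> lin_Lam N q a) \<alpha> \<beta> = (lin_Lam N q a \<odot> shift \<delta>) \<alpha> \<beta>" by simp
qed

subsection \<open>Differentiating matrix-valued functions\<close>

definition mderiv :: "(real \<Rightarrow> 'd::finite smat) \<Rightarrow> 'd smat \<Rightarrow> real \<Rightarrow> bool" where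
  "mderiv F F' s0 \<longleftrightarrow> (\<forall>\<alpha> \<beta>. ((\<lambda>s. F s \<alpha> \<beta>) has_real_derivative F' \<alpha> \<beta>) (at s0))"

lemma mderivD: "mderiv F F' s0 \<Longrightarrow> ((\<lambda>s. F s \<alpha> \<beta>) has_real_derivative F' \<alpha> \<beta>) (at s0)"
  by (simp add: mderiv_def)

text \<open>Carries zero patterns of a family of matrices over to its derivative; also applied to
  the constant identity blocks of \<open>S\<close>.\<close>

lemma mderiv_const_entry:
  assumes "mderiv F F' s0" "\<And>s. F s \<alpha> \<beta> = c"
  shows "F' \<alpha> \<beta> = 0"
  using DERIV_unique[OF mderivD[OF assms(1), of \<alpha> \<beta>], of 0] assms(2) by simp

lemma mderiv_const: "mderiv (\<lambda>_. A) 0 s0"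
  by (simp add: mderiv_def)

lemma mderiv_strans: "mderiv F F' s0 \<Longrightarrow> mderiv (\<lambda>s. strans (F s)) (strans F') s0"
  by (simp add: mderiv_def)

text \<open>The cutoff \<open>n\<close> must not depend on \<open>s\<close>: then the product entry
  is one fixed finite sum for all \<open>s\<close>. Since a factor that vanishes for all
  \<open>s\<close> has zero derivative, the same cutoff serves both terms of the product
  rule.\<close>

lemma mderiv_mult:
  assumes F: "mderiv F F' s0" and G: "mderiv G G' s0"
    and fin: "\<And>\<alpha> \<beta>. \<exists>n. \<forall>\<gamma>. n < mdeg \<gamma> \<longrightarrow> (\<forall>s. F s \<alpha> \<gamma> = 0) \<or> (\<forall>s. G s \<gamma> \<beta> = 0)"
  shows "mderiv (\<lambda>s. F s \<odot> G s) (F' \<odot> G s0 + F s0 \<odot> G') s0"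
  unfolding mderiv_def
proof (intro allI)
  fix \<alpha> \<beta>
  obtain n where n: "\<And>\<gamma>. n < mdeg \<gamma> \<Longrightarrow> (\<forall>s. F s \<alpha> \<gamma> = 0) \<or> (\<forall>s. G s \<gamma> \<beta> = 0)"
    using fin[of \<alpha> \<beta>] by blast
  have z: "F' \<alpha> \<gamma> * G s0 \<gamma> \<beta> = 0" "F s0 \<alpha> \<gamma> * G' \<gamma> \<beta> = 0" if "n < mdeg \<gamma>" for \<gamma>
    using n[OF that] mderiv_const_entry[OF F, of \<alpha> \<gamma> 0] mderiv_const_entry[OF G, of \<gamma> \<beta> 0] by auto
  have "(F s \<odot> G s) \<alpha> \<beta> = (\<Sum>\<gamma>\<in>dle n. F s \<alpha> \<gamma> * G s \<gamma> \<beta>)" for s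
    using n by (intro smat_mult_finite) auto
  moreover have "((\<lambda>s. \<Sum>\<gamma>\<in>dle n. F s \<alpha> \<gamma> * G s \<gamma> \<beta>) has_real_derivative
     (\<Sum>\<gamma>\<in>dle n. F' \<alpha> \<gamma> * G s0 \<gamma> \<beta> + F s0 \<alpha> \<gamma> * G' \<gamma> \<beta>)) (at s0)"
    by (intro DERIV_sum) (auto intro!: derivative_eq_intros mderivD[OF F] mderivD[OF G])
  moreover have "(\<Sum>\<gamma>\<in>dle n. F' \<alpha> \<gamma> * G s0 \<gamma> \<beta> + F s0 \<alpha> \<gamma> * G' \<gamma> \<beta>) =
     (F' \<odot> G s0 + F s0 \<odot> G') \<alpha> \<beta>"
    using smat_mult_finite[of n F' \<alpha> "G s0" \<beta>, OF z(1)] smat_mult_finite[of n "F s0" \<alpha> G' \<beta>, OF z(2)]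
    by (simp add: sum.distrib)
  ultimately show "((\<lambda>s. (F s \<odot> G s) \<alpha> \<beta>) has_real_derivative (F' \<odot> G s0 + F s0 \<odot> G') \<alpha> \<beta>) (at s0)"
    by simp
qed

lemma mderiv_mult_lower:
  assumes "mderiv F F' s0" "mderiv G G' s0" "\<And>s. block_lower (F s)"
  shows "mderiv (\<lambda>s. F s \<odot> G s) (F' \<odot> G s0 + F s0 \<odot> G') s0"
  using assms(3) by (intro mderiv_mult assms) (auto simp: block_lower_def)

lemma mderiv_mult_upper:
  assumes "mderiv F F' s0" "mderiv G G' s0" "\<And>s. block_upper (G s)"
  shows "mderiv (\<lambda>s. F s \<odot> G s) (F' \<odot> G s0 + F s0 \<odot> G') s0"
  using assms(3) by (intro mderiv_mult assms) (auto simp: block_upper_def)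

lemma mderiv_const_mult:
  assumes "rowfin A" "mderiv G G' s0"
  shows "mderiv (\<lambda>s. A \<odot> G s) (A \<odot> G') s0"
proof -
  have "mderiv (\<lambda>s. A \<odot> G s) (0 \<odot> G s0 + A \<odot> G') s0"
    using assms(1) by (intro mderiv_mult mderiv_const assms) (metis rowfin_def)
  moreover have "0 \<odot> G s0 = 0" by (simp add: fun_eq_iff smat_mult_def)
  ultimately show ?thesis by simp
qed

text \<open>Everything comes from the identity B(s) - B(s0) = - B(s) (A(s) - A(s0)) B(s0). Its
  right-hand side still contains B(s), so local boundedness and then continuity of \<open>B\<close>
  are established before dividing by s - s0.\<close>

lemma finite_inverse_has_derivative:
  fixes A B :: "real \<Rightarrow> 'i \<Rightarrow> 'i \<Rightarrow> real"
  assumes I: "finite I"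
    and AB: "\<And>s i j. i \<in> I \<Longrightarrow> j \<in> I \<Longrightarrow> (\<Sum>k\<in>I. A s i k * B s k j) = (if i = j then 1 else 0)"
    and BA: "\<And>s i j. i \<in> I \<Longrightarrow> j \<in> I \<Longrightarrow> (\<Sum>k\<in>I. B s i k * A s k j) = (if i = j then 1 else 0)"
    and A': "\<And>i j. i \<in> I \<Longrightarrow> j \<in> I \<Longrightarrow> ((\<lambda>s. A s i j) has_real_derivative A' i j) (at s0)"
    and ij: "i \<in> I" "j \<in> I"
  shows "((\<lambda>s. B s i j) has_real_derivative - (\<Sum>k\<in>I. \<Sum>l\<in>I. B s0 i k * A' k l * B s0 l j)) (at s0)"
proof -
  have res: "B s i j - B s0 i j = - (\<Sum>k\<in>I. \<Sum>l\<in>I. B s i k * (A s k l - A s0 k l) * B s0 l j)"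
    if ij: "i \<in> I" "j \<in> I" for s i j
  proof -
    have "(\<Sum>k\<in>I. \<Sum>l\<in>I. B s i k * A s k l * B s0 l j) = (\<Sum>l\<in>I. (\<Sum>k\<in>I. B s i k * A s k l) * B s0 l j)"
      by (subst sum.swap) (simp add: sum_distrib_right)
    also have "\<dots> = (\<Sum>l\<in>I. if i = l then B s0 l j else 0)"
      using ij BA by (intro sum.cong) auto
    also have "\<dots> = B s0 i j" using ij I by simp
    finally have 1: "(\<Sum>k\<in>I. \<Sum>l\<in>I. B s i k * A s k l * B s0 l j) = B s0 i j" .
    have "(\<Sum>k\<in>I. \<Sum>l\<in>I. B s i k * A s0 k l * B s0 l j) = (\<Sum>k\<in>I. B s i k * (\<Sum>l\<in>I. A s0 k l * B s0 l j))"
      by (simp add: sum_distrib_left mult.assoc)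
    also have "\<dots> = (\<Sum>k\<in>I. if k = j then B s i k else 0)"
      using ij AB by (intro sum.cong) auto
    also have "\<dots> = B s i j" using ij I by simp
    finally have "(\<Sum>k\<in>I. \<Sum>l\<in>I. B s i k * A s0 k l * B s0 l j) = B s i j" .
    with 1 show ?thesis
      by (simp add: algebra_simps sum_subtractf)
  qed
  define b where "b s = (\<Sum>i\<in>I. \<Sum>j\<in>I. \<bar>B s i j\<bar>)" for s
  define e where "e s = (\<Sum>k\<in>I. \<Sum>l\<in>I. \<bar>A s k l - A s0 k l\<bar>)" for s
  have b_ge: "\<bar>B s i j\<bar> \<le> b s" if "i \<in> I" "j \<in> I" for s i j
  proof -
    have "\<bar>B s i j\<bar> \<le> (\<Sum>j\<in>I. \<bar>B s i j\<bar>)" using that I by (intro member_le_sum) auto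
    also have "\<dots> \<le> b s" unfolding b_def using that I
      by (intro member_le_sum[where f="\<lambda>i. \<Sum>j\<in>I. \<bar>B s i j\<bar>"]) (auto intro: sum_nonneg)
    finally show ?thesis .
  qed
  have diff: "\<bar>B s i j - B s0 i j\<bar> \<le> b s * (e s * b s0)" if "i \<in> I" "j \<in> I" for s i j
  proof -
    have "\<bar>B s i j - B s0 i j\<bar> \<le> (\<Sum>k\<in>I. \<Sum>l\<in>I. \<bar>B s i k * (A s k l - A s0 k l) * B s0 l j\<bar>)"
      unfolding res[OF that] abs_minus_cancel by (intro order.trans[OF sum_abs] sum_mono sum_abs)
    also have "\<dots> \<le> (\<Sum>k\<in>I. \<Sum>l\<in>I. b s * \<bar>A s k l - A s0 k l\<bar> * b s0)"
      unfolding abs_mult using that b_ge by (intro sum_mono mult_mono) (auto simp: b_def sum_nonneg)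
    also have "\<dots> = b s * (e s * b s0)"
      by (simp add: e_def sum_distrib_left sum_distrib_right mult.assoc)
    finally show ?thesis .
  qed
  \<comment> \<open>Summing the bound \<open>diff\<close> over all pairs of indices produces the
    square of \<open>card I\<close>.\<close>
  define c where "c = real (card I) * real (card I) * b s0"
  have bs: "b s \<le> b s0 + b s * (e s * c)" for s
  proof -
    have "b s \<le> (\<Sum>i\<in>I. \<Sum>j\<in>I. \<bar>B s0 i j\<bar> + b s * (e s * b s0))"
      unfolding b_def[of s]
    proof (intro sum_mono)
      fix i j assume "i \<in> I" "j \<in> I"
      from diff[OF this, of s] show "\<bar>B s i j\<bar> \<le> \<bar>B s0 i j\<bar> + (\<Sum>i\<in>I. \<Sum>j\<in>I. \<bar>B s i j\<bar>) * (e s * b s0)"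
        unfolding b_def[of s] by linarith
    qed
    also have "\<dots> = b s0 + b s * (e s * c)"
      by (simp add: sum.distrib b_def[of s0] c_def)
    finally show ?thesis .
  qed
  have e0: "(e \<longlongrightarrow> 0) (at s0)"
  proof -
    have "((\<lambda>s. A s k l) \<longlongrightarrow> A s0 k l) (at s0)" if "k \<in> I" "l \<in> I" for k l
      using DERIV_isCont[OF A'[OF that]] by (simp add: isCont_def)
    then have "(e \<longlongrightarrow> (\<Sum>k\<in>I. \<Sum>l\<in>I. \<bar>A s0 k l - A s0 k l\<bar>)) (at s0)"
      unfolding e_def by (intro tendsto_sum tendsto_rabs tendsto_diff tendsto_const)
    then show ?thesis by simp
  qed
  have "((\<lambda>s. e s * c) \<longlongrightarrow> 0 * c) (at s0)" by (intro tendsto_mult e0 tendsto_const)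
  then have "eventually (\<lambda>s. e s * c < 1/2) (at s0)"
    by (intro order_tendstoD(2)) auto
  \<comment> \<open>Once \<open>e s * c\<close> is below 1/2, the term containing \<open>b s\<close>
    on the right of \<open>bs\<close> is absorbed into the left-hand side.\<close>
  then have b2: "eventually (\<lambda>s. b s \<le> 2 * b s0) (at s0)"
  proof eventually_elim
    case (elim s)
    have "0 \<le> b s" by (simp add: b_def sum_nonneg)
    then have "b s * (e s * c) \<le> b s * (1/2)" using elim by (intro mult_left_mono) auto
    with bs[of s] show ?case by simp
  qed
  have Bcont: "((\<lambda>s. B s i j) \<longlongrightarrow> B s0 i j) (at s0)" if "i \<in> I" "j \<in> I" for i j
  proof -
    have "((\<lambda>s. B s i j - B s0 i j) \<longlongrightarrow> 0) (at s0)"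
    proof (rule Lim_null_comparison)
      show "eventually (\<lambda>s. norm (B s i j - B s0 i j) \<le> 2 * b s0 * (e s * b s0)) (at s0)"
        using b2
      proof eventually_elim
        case (elim s)
        have "0 \<le> e s * b s0" by (simp add: e_def b_def sum_nonneg)
        then show ?case
          using diff[OF that, of s] mult_right_mono[OF elim, of "e s * b s0"] by simp
      qed
      have "((\<lambda>s. 2 * b s0 * (e s * b s0)) \<longlongrightarrow> 2 * b s0 * (0 * b s0)) (at s0)"
        by (intro tendsto_intros e0)
      then show "((\<lambda>s. 2 * b s0 * (e s * b s0)) \<longlongrightarrow> 0) (at s0)" by simp
    qed
    then show ?thesis by (simp add: LIM_zero_iff)
  qed
  have "((\<lambda>s. - (\<Sum>k\<in>I. \<Sum>l\<in>I. B s i k * ((A s k l - A s0 k l) / (s - s0)) * B s0 l j))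
      \<longlongrightarrow> - (\<Sum>k\<in>I. \<Sum>l\<in>I. B s0 i k * A' k l * B s0 l j)) (at s0)"
    using ij Bcont A' by (intro tendsto_intros) (auto simp: has_field_derivative_iff)
  moreover have "- (\<Sum>k\<in>I. \<Sum>l\<in>I. B s i k * ((A s k l - A s0 k l) / (s - s0)) * B s0 l j) =
      (B s i j - B s0 i j) / (s - s0)" for s
    unfolding res[OF ij] by (simp add: sum_divide_distrib)
  ultimately show ?thesis by (simp add: has_field_derivative_iff)
qed

lemma mderiv_upper:
  assumes "mderiv F F' s0" "\<And>s. block_upper (F s)"
  shows "block_upper F'"
  using mderiv_const_entry[OF assms(1)] assms(2) unfolding block_upper_def by blast

text \<open>Truncation at degree \<open>n\<close> respects products of upper triangular matrices, so
  each entry of the inverse is an entry of the inverse of a finite matrix.\<close>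

lemma mderiv_upper_inverse:
  assumes A: "\<And>s. block_upper (A s)" and B: "\<And>s. block_upper (B s)"
    and AB: "\<And>s. A s \<odot> B s = sone" and BA: "\<And>s. B s \<odot> A s = sone"
    and A': "mderiv A A' s0"
  shows "mderiv B (- (B s0 \<odot> A' \<odot> B s0)) s0"
  unfolding mderiv_def
proof (intro allI)
  fix \<alpha> \<beta> :: "'a mindex"
  define n where "n = max (mdeg \<alpha>) (mdeg \<beta>)"
  have "((\<lambda>s. B s \<alpha> \<beta>) has_real_derivative
     - (\<Sum>k\<in>dle n. \<Sum>l\<in>dle n. B s0 \<alpha> k * A' k l * B s0 l \<beta>)) (at s0)"
  proof (rule finite_inverse_has_derivative[where A=A])
    fix s :: real and i j :: "'a mindex" assume ij: "i \<in> dle n" "j \<in> dle n"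
    show "(\<Sum>k\<in>dle n. A s i k * B s k j) = (if i = j then 1 else 0)"
      using ij smat_mult_upper[OF B[of s], of j n "A s" i] by (simp add: AB sone_def)
    show "(\<Sum>k\<in>dle n. B s i k * A s k j) = (if i = j then 1 else 0)"
      using ij smat_mult_upper[OF A[of s], of j n "B s" i] by (simp add: BA sone_def)
  qed (auto simp: n_def intro: mderivD[OF A'])
  also have "(\<Sum>k\<in>dle n. \<Sum>l\<in>dle n. B s0 \<alpha> k * A' k l * B s0 l \<beta>) =
      (\<Sum>l\<in>dle n. (\<Sum>k\<in>dle n. B s0 \<alpha> k * A' k l) * B s0 l \<beta>)"
    by (subst sum.swap) (simp add: sum_distrib_right)
  also have "\<dots> = (\<Sum>l\<in>dle n. (B s0 \<odot> A') \<alpha> l * B s0 l \<beta>)"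
    using smat_mult_upper[OF mderiv_upper[OF A' A], of _ n "B s0" \<alpha>] by (intro sum.cong) auto
  also have "\<dots> = (B s0 \<odot> A' \<odot> B s0) \<alpha> \<beta>"
    by (rule smat_mult_upper[OF B, symmetric]) (simp add: n_def)
  finally show "((\<lambda>s. B s \<alpha> \<beta>) has_real_derivative (- (B s0 \<odot> A' \<odot> B s0)) \<alpha> \<beta>) (at s0)"
    by simp
qed

lemma mderiv_lower_inverse:
  assumes A: "\<And>s. block_lower (A s)" and B: "\<And>s. block_lower (B s)"
    and AB: "\<And>s. A s \<odot> B s = sone" and BA: "\<And>s. B s \<odot> A s = sone"
    and A': "mderiv A A' s0"
  shows "mderiv B (- (B s0 \<odot> (A' \<odot> B s0))) s0"
proof -
  have "mderiv (\<lambda>s. strans (B s)) (- (strans (B s0) \<odot> strans A' \<odot> strans (B s0))) s0"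
    using A B AB BA by (intro mderiv_upper_inverse[where A="\<lambda>s. strans (A s)"] mderiv_strans A')
      (auto simp flip: strans_mult)
  from mderiv_strans[OF this] show ?thesis
    by (simp add: mderiv_def flip: strans_mult)
qed

subsection \<open>Gauss--Borel factors along a flow\<close>

text \<open>Padding with zeros keeps truncations among the semi-infinite matrices, where they are
  row- and column-finite; \<open>trunc n sone\<close> is their unit.\<close>

definition trunc :: "nat \<Rightarrow> 'd::finite smat \<Rightarrow> 'd smat" where
  "trunc n A \<alpha> \<beta> = (if mdeg \<alpha> \<le> n \<and> mdeg \<beta> \<le> n then A \<alpha> \<beta> else 0)"

lemma rowfin_trunc [simp]: "rowfin (trunc n A)" and colfin_trunc [simp]: "colfin (trunc n A)"
  by (auto simp: rowfin_def colfin_def trunc_def intro!: exI[of _ n])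

lemma trunc_mult_apply: "(trunc n A \<odot> B) \<alpha> \<beta> = (\<Sum>\<gamma>\<in>dle n. trunc n A \<alpha> \<gamma> * B \<gamma> \<beta>)"
  by (intro smat_mult_finite) (auto simp: trunc_def)

text \<open>A lower left factor or an upper right factor never passes through a middle index of
  degree above \<open>n\<close>. A factorization lower times diagonal times upper is therefore
  inherited by truncations.\<close>

lemma trunc_mult:
  assumes "block_lower A \<or> block_upper B"
  shows "trunc n A \<odot> trunc n B = trunc n (A \<odot> B)"
proof (intro ext)
  fix \<alpha> \<beta>
  show "(trunc n A \<odot> trunc n B) \<alpha> \<beta> = trunc n (A \<odot> B) \<alpha> \<beta>"
  proof (cases "mdeg \<alpha> \<le> n \<and> mdeg \<beta> \<le> n")
    case True
    then have "(A \<odot> B) \<alpha> \<beta> = (\<Sum>\<gamma>\<in>dle n. A \<alpha> \<gamma> * B \<gamma> \<beta>)"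
      using assms by (auto intro: smat_mult_lower smat_mult_upper)
    then show ?thesis using True by (simp add: trunc_mult_apply) (simp add: trunc_def)
  next
    case False
    then show ?thesis by (auto simp: trunc_mult_apply) (auto simp: trunc_def)
  qed
qed

lemma trunc_sone_mult [simp]: "trunc n sone \<odot> trunc n A = trunc n A"
  by (simp add: trunc_mult)

lemma gauss_borel_inverse_factor:
  assumes "gauss_borel G S H"
  obtains K where "block_diagonal K" "H \<odot> K = sone" "K \<odot> H = sone"
  using assms block_diagonal_inverse unfolding gauss_borel_def by metis

text \<open>Since \<open>S\<close> and its inverse are row-finite, they can be cancelled against
  each other in front of the full matrix \<open>G\<close>.\<close>

lemma
  assumes gb: "gauss_borel G S H"
  shows block_upper_W2: "block_upper (W2 S H)"
    and gauss_borel_eq: "G = lower_inv S \<odot> W2 S H"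
    and gauss_borel_mult: "S \<odot> G = W2 S H"
proof -
  have S: "block_unilower S" and H: "block_diagonal H" and G: "G = lower_inv S \<odot> H \<odot> strans (lower_inv S)"
    using gb by (auto simp: gauss_borel_def)
  note rf = block_unilower_lower[OF S] block_unilower_lower[OF block_unilower_lower_inv[OF S]]
  show "block_upper (W2 S H)"
    unfolding W2_def using rf H by (intro block_upper_mult) (auto intro: block_diagonal_upper)
  show GL: "G = lower_inv S \<odot> W2 S H"
    unfolding W2_def G using rf by (intro smat_mult_assoc_rc) (auto intro: rowfin_lower)
  show "S \<odot> G = W2 S H"
    unfolding GL using rf
    by (subst smat_mult_assoc_rr[symmetric]) (auto intro: rowfin_lower simp: mult_lower_inv[OF S])
qed

text \<open>With \<open>K\<close> the inverse of \<open>H\<close>, the transpose of \<open>S\<close>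
  times \<open>K\<close> inverts \<open>W2\<close>; being upper triangular, it is the inverse
  selected by \<open>upper_inv\<close>.\<close>

lemma
  assumes S: "block_unilower S" and H: "block_diagonal H" and K: "block_diagonal K" "H \<odot> K = sone" "K \<odot> H = sone"
  shows block_upper_strans_mult: "block_upper (strans S \<odot> K)"
    and W2_inverse_right: "W2 S H \<odot> (strans S \<odot> K) = sone"
    and W2_inverse_left: "(strans S \<odot> K) \<odot> W2 S H = sone"
    and upper_inv_W2: "upper_inv (W2 S H) = strans S \<odot> K"
proof -
  note rf = block_unilower_lower[OF S] block_unilower_lower[OF block_unilower_lower_inv[OF S]]
  have cf: "colfin H" "colfin K" "colfin (strans S)" "colfin (strans (lower_inv S))"
    using H K rf by (auto intro: colfin_upper block_diagonal_upper rowfin_lower)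
  have u: "block_upper (W2 S H)"
    unfolding W2_def using rf H by (intro block_upper_mult) (auto intro: block_diagonal_upper)
  show v: "block_upper (strans S \<odot> K)"
    using rf K by (intro block_upper_mult) (auto intro: block_diagonal_upper)
  have t: "strans (lower_inv S) \<odot> strans S = sone" "strans S \<odot> strans (lower_inv S) = sone"
    by (simp_all add: mult_lower_inv[OF S] lower_inv_mult[OF S] flip: strans_mult)
  have "W2 S H \<odot> (strans S \<odot> K) = H \<odot> (strans (lower_inv S) \<odot> strans S \<odot> K)"
    unfolding W2_def using cf by (simp add: smat_mult_assoc_cc colfin_mult)
  then show a: "W2 S H \<odot> (strans S \<odot> K) = sone" by (simp add: t K)
  have "(strans S \<odot> K) \<odot> W2 S H = strans S \<odot> (K \<odot> H \<odot> strans (lower_inv S))"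
    unfolding W2_def using cf by (simp add: smat_mult_assoc_cc colfin_mult)
  then show b: "(strans S \<odot> K) \<odot> W2 S H = sone" by (simp add: t K)
  show "upper_inv (W2 S H) = strans S \<odot> K"
    using u v a b by (rule upper_inv_eqI)
qed

text \<open>\<open>R\<close> inverts the truncated factors of \<open>G\<close> in reverse order.
  Inside the truncation, a row of degree \<open>n\<close> of the transpose of \<open>S\<close> is a
  row of the identity, so the bottom block row of \<open>R\<close> is that of
  \<open>K \<odot> S\<close>, with no contribution from higher degrees.\<close>

lemma gauss_borel_trunc_inverse:
  fixes G S H K :: "'d::finite smat" and n :: nat
  assumes gb: "gauss_borel G S H" and K: "block_diagonal K" "H \<odot> K = sone" "K \<odot> H = sone"
  defines "R \<equiv> trunc n (strans S) \<odot> (trunc n K \<odot> trunc n S)"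
  shows "trunc n G \<odot> R = trunc n sone" and "R \<odot> trunc n G = trunc n sone"
    and "mdeg \<alpha> = n \<Longrightarrow> mdeg \<beta> \<le> n \<Longrightarrow> R \<alpha> \<beta> = (K \<odot> S) \<alpha> \<beta>"
proof -
  have S: "block_unilower S" and H: "block_diagonal H" and G: "G = lower_inv S \<odot> H \<odot> strans (lower_inv S)"
    using gb by (auto simp: gauss_borel_def)
  note rf = block_unilower_lower[OF S] block_unilower_lower[OF block_unilower_lower_inv[OF S]]
  let ?t = "trunc n" and ?L = "lower_inv S"
  have up: "block_lower H" "block_upper K" "block_lower K" "block_upper H"
    using H K by (auto intro: block_diagonal_upper block_diagonal_lower)
  have "?t G = ?t (?L \<odot> H) \<odot> ?t (strans ?L)"
    unfolding G using rf up by (intro trunc_mult[symmetric]) (auto intro: block_lower_mult)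
  also have "?t (?L \<odot> H) = ?t ?L \<odot> ?t H"
    using rf by (intro trunc_mult[symmetric]) auto
  finally have Gt: "?t G = ?t ?L \<odot> (?t H \<odot> ?t (strans ?L))"
    by (simp only: smat_mult_assoc_rr rowfin_trunc)
  have e: "?t (strans ?L) \<odot> ?t (strans S) = ?t sone" "?t (strans S) \<odot> ?t (strans ?L) = ?t sone"
    "?t S \<odot> ?t ?L = ?t sone" "?t ?L \<odot> ?t S = ?t sone" "?t H \<odot> ?t K = ?t sone" "?t K \<odot> ?t H = ?t sone"
    using rf up K by (simp_all add: trunc_mult mult_lower_inv[OF S] lower_inv_mult[OF S] flip: strans_mult)
  have as: "?t X \<odot> (?t Y \<odot> Z) = ?t sone \<odot> Z" if "?t X \<odot> ?t Y = ?t sone" for X Y Z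
    unfolding that[symmetric] by (simp add: smat_mult_assoc_rr)
  have i: "?t sone \<odot> (?t X \<odot> Z) = ?t X \<odot> Z" for X Z
    using smat_mult_assoc_rr[of "?t sone" "?t X" Z] by simp
  show "?t G \<odot> R = ?t sone"
    unfolding R_def Gt by (simp add: smat_mult_assoc_rr rowfin_mult as e i)
  show "R \<odot> ?t G = ?t sone"
    unfolding R_def Gt by (simp add: smat_mult_assoc_rr rowfin_mult as e i)
  show "R \<alpha> \<beta> = (K \<odot> S) \<alpha> \<beta>" if "mdeg \<alpha> = n" "mdeg \<beta> \<le> n"
  proof -
    have "R \<alpha> \<beta> = (\<Sum>\<gamma>\<in>dle n. ?t (strans S) \<alpha> \<gamma> * (?t K \<odot> ?t S) \<gamma> \<beta>)"
      unfolding R_def by (rule trunc_mult_apply)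
    also have "\<dots> = (\<Sum>\<gamma>\<in>{\<alpha>}. ?t (strans S) \<alpha> \<gamma> * (?t K \<odot> ?t S) \<gamma> \<beta>)"
    proof (rule sum.mono_neutral_right)
      have "S \<gamma> \<alpha> = 0" if "mdeg \<gamma> \<le> n" "\<gamma> \<noteq> \<alpha>" for \<gamma>
        using that S \<open>mdeg \<alpha> = n\<close>
        by (cases "mdeg \<gamma> = n") (auto simp: block_unilower_def block_lower_def sone_def)
      then show "\<forall>\<gamma>\<in>dle n - {\<alpha>}. ?t (strans S) \<alpha> \<gamma> * (?t K \<odot> ?t S) \<gamma> \<beta> = 0"
        by (auto simp: trunc_def)
    qed (use that in auto)
    also have "\<dots> = (?t K \<odot> ?t S) \<alpha> \<beta>"
      using S that by (simp add: trunc_def block_unilower_def sone_def)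
    also have "\<dots> = (K \<odot> S) \<alpha> \<beta>"
      using that up by (simp add: trunc_mult) (simp add: trunc_def)
    finally show ?thesis .
  qed
qed

text \<open>Uniqueness of the splitting into an upper and a strictly lower part, applied to
  \<open>J = U - E\<close>.\<close>

lemma splus_sum_lower:
  assumes "block_upper U" "\<And>\<alpha> \<beta>. mdeg \<alpha> \<le> mdeg \<beta> \<Longrightarrow> E \<alpha> \<beta> = 0" "U = E + J"
  shows "splus J = U" "E = splus J - J"
proof -
  have "E \<alpha> \<beta> + J \<alpha> \<beta> = 0" if "mdeg \<beta> < mdeg \<alpha>" for \<alpha> \<beta>
    using assms(1,3) that by (simp add: block_upper_def)
  then show "splus J = U" "E = splus J - J"
    using assms(2,3) by (fastforce simp: fun_eq_iff splus_def not_le eq_neg_iff_add_eq_0)+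
qed

text \<open>The measure enters only through the linear equation for \<open>G\<close> along one line
  of times. The factors are merely assumed to exist for all \<open>s\<close>; their
  differentiability is part of the conclusion.\<close>

lemma gauss_borel_factors_deriv:
  fixes G S H :: "real \<Rightarrow> 'd::finite smat"
  assumes gb: "\<And>s. gauss_borel (G s) (S s) (H s)"
    and A: "rowfin A" and G': "mderiv G (A \<odot> G s0) s0"
  defines "J \<equiv> S s0 \<odot> A \<odot> lower_inv (S s0)"
  shows "mderiv S ((splus J - J) \<odot> S s0) s0"
    and "mderiv (\<lambda>s. lower_inv (S s)) (lower_inv (S s0) \<odot> (J - splus J)) s0"
    and "mderiv (\<lambda>s. W2 (S s) (H s)) (splus J \<odot> W2 (S s0) (H s0)) s0"
    and "mderiv (\<lambda>s. upper_inv (W2 (S s) (H s))) (- (upper_inv (W2 (S s0) (H s0)) \<odot> splus J)) s0"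
proof -
  have "\<forall>s. \<exists>K. block_diagonal K \<and> H s \<odot> K = sone \<and> K \<odot> H s = sone"
    using gauss_borel_inverse_factor[OF gb] by blast
  then obtain K where K: "\<And>s. block_diagonal (K s)" "\<And>s. H s \<odot> K s = sone" "\<And>s. K s \<odot> H s = sone"
    by metis
  have S: "block_unilower (S s)" and H: "block_diagonal (H s)" for s
    using gb by (auto simp: gauss_borel_def)
  note Sl = block_unilower_lower[OF S] 
  note Ll = block_unilower_lower[OF block_unilower_lower_inv[OF S]]
  have KS: "\<exists>D. mderiv (\<lambda>s. K s \<odot> S s) D s0"
  proof -
    have "\<exists>d. ((\<lambda>s. (K s \<odot> S s) \<alpha> \<beta>) has_real_derivative d) (at s0)" for \<alpha> \<beta>
    proof (cases "mdeg \<beta> \<le> mdeg \<alpha>")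
      case True
      \<comment> \<open>Each row is read off at the truncation by its own degree, where it lies in
        the bottom block row; entries with a column of larger degree are identically zero.\<close>
      define n where "n = mdeg \<alpha>"
      define R where "R s = trunc n (strans (S s)) \<odot> (trunc n (K s) \<odot> trunc n (S s))" for s
      have "((\<lambda>s. R s \<alpha> \<beta>) has_real_derivative
        - (\<Sum>k\<in>dle n. \<Sum>l\<in>dle n. R s0 \<alpha> k * trunc n (A \<odot> G s0) k l * R s0 l \<beta>)) (at s0)"
      proof (rule finite_inverse_has_derivative[where A="\<lambda>s. trunc n (G s)"])
        fix s :: real and i j :: "'d mindex" assume ij: "i \<in> dle n" "j \<in> dle n"
        note r = gauss_borel_trunc_inverse[OF gb K, where n=n, folded R_def]
        show "(\<Sum>k\<in>dle n. trunc n (G s) i k * R s k j) = (if i = j then 1 else 0)"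
          using fun_cong[OF fun_cong[OF r(1)[of s]], of i j] ij
          by (simp add: trunc_mult_apply) (simp add: trunc_def sone_def)
        have "(R s \<odot> trunc n (G s)) i j = (\<Sum>k\<in>dle n. R s i k * trunc n (G s) k j)"
          by (intro smat_mult_finite) (auto simp: trunc_def)
        then show "(\<Sum>k\<in>dle n. R s i k * trunc n (G s) k j) = (if i = j then 1 else 0)"
          using fun_cong[OF fun_cong[OF r(2)[of s]], of i j] ij
          by (auto simp: trunc_def sone_def)
        show "((\<lambda>s. trunc n (G s) i j) has_real_derivative trunc n (A \<odot> G s0) i j) (at s0)"
          using mderivD[OF G', of i j] ij by (simp add: trunc_def)
      qed (use True in \<open>auto simp: n_def\<close>)
      moreover have "(K s \<odot> S s) \<alpha> \<beta> = R s \<alpha> \<beta>" for s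
        unfolding R_def using gauss_borel_trunc_inverse(3)[OF gb K, of \<alpha> n \<beta> s] True by (simp add: n_def)
      ultimately show ?thesis by auto
    next
      case False
      have "block_lower (K s \<odot> S s)" for s
        using K Sl by (intro block_lower_mult) (auto intro: block_diagonal_lower)
      then have "(K s \<odot> S s) \<alpha> \<beta> = 0" for s using False by (auto simp: block_lower_def)
      then show ?thesis by (auto intro: DERIV_const)
    qed
    then have "\<forall>\<alpha>. \<exists>D. \<forall>\<beta>. ((\<lambda>s. (K s \<odot> S s) \<alpha> \<beta>) has_real_derivative D \<beta>) (at s0)"
      by metis
    then show ?thesis unfolding mderiv_def by (rule choice)
  qed
  then obtain D where D: "mderiv (\<lambda>s. K s \<odot> S s) D s0" by blast
  have Hlu: "block_upper (H s)" "block_lower (H s)" "block_upper (K s)" "block_lower (K s)" for s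
    using H K by (auto intro: block_diagonal_upper block_diagonal_lower)
  \<comment> \<open>The identity blocks of \<open>S\<close> make \<open>K\<close> the block diagonal
    of \<open>K \<odot> S\<close>. Hence \<open>K\<close> is differentiable, then its inverse
    \<open>H\<close>, and finally \<open>S\<close> as the product of \<open>H\<close> with
    \<open>K \<odot> S\<close>.\<close>
  have KD: "K s \<alpha> \<beta> = (if mdeg \<alpha> = mdeg \<beta> then (K s \<odot> S s) \<alpha> \<beta> else 0)" for s \<alpha> \<beta>
  proof (cases "mdeg \<alpha> = mdeg \<beta>")
    case True
    have "(K s \<odot> S s) \<alpha> \<beta> = (\<Sum>\<gamma>\<in>dle (mdeg \<alpha>). K s \<alpha> \<gamma> * S s \<gamma> \<beta>)"
      using Hlu by (intro smat_mult_lower) auto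
    also have "\<dots> = (\<Sum>\<gamma>\<in>dle (mdeg \<alpha>). if \<gamma> = \<beta> then K s \<alpha> \<gamma> else 0)"
    proof (rule sum.cong)
      fix \<gamma> :: "'d mindex"
      show "K s \<alpha> \<gamma> * S s \<gamma> \<beta> = (if \<gamma> = \<beta> then K s \<alpha> \<gamma> else 0)"
        using S[of s] K(1)[of s] True
        by (cases "mdeg \<gamma> = mdeg \<alpha>") (auto simp: block_unilower_def block_diagonal_def sone_def)
    qed simp
    also have "\<dots> = K s \<alpha> \<beta>" using True by simp
    finally show ?thesis using True by simp
  next
    case False then show ?thesis using K(1)[of s] by (simp add: block_diagonal_def)
  qed
  have "mderiv K (\<lambda>\<alpha> \<beta>. if mdeg \<alpha> = mdeg \<beta> then D \<alpha> \<beta> else 0) s0"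
    unfolding mderiv_def by (subst KD) (use mderivD[OF D] in auto)
  from mderiv_upper_inverse[OF Hlu(3,1) K(3,2) this]
  obtain H' where H': "mderiv H H' s0" by blast
  have "H s \<odot> (K s \<odot> S s) = S s" for s
    using Hlu by (subst smat_mult_assoc_rr[symmetric]) (auto intro: rowfin_lower simp: K)
  then obtain S' where S': "mderiv S S' s0"
    using mderiv_mult_lower[OF H' D Hlu(2)] by auto
  let ?S = "S s0" and ?L = "lower_inv (S s0)" and ?W = "W2 (S s0) (H s0)" 
  let ?V = "strans (S s0) \<odot> K s0"
  note SL = mult_lower_inv[OF S] lower_inv_mult[OF S]
  have rf: "rowfin ?S" "rowfin ?L" "rowfin S'"
    using Sl Ll mderiv_upper[OF mderiv_strans[OF S']] by (auto intro: rowfin_lower)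
  then have rfJ: "rowfin J" unfolding J_def using A by (intro rowfin_mult)
  note rf = rf rfJ
  have V: "?W \<odot> ?V = sone" "?V \<odot> ?W = sone" "block_upper ?V" "colfin ?V"
    using W2_inverse_right[OF S H K] W2_inverse_left[OF S H K] block_upper_strans_mult[OF S H K]
    by (auto intro: colfin_upper)
  have uiW: "upper_inv (W2 (S s) (H s)) = strans (S s) \<odot> K s" for s
    by (rule upper_inv_W2[OF S H K])
  have Wu: "block_upper (W2 (S s) (H s))" for s by (rule block_upper_W2[OF gb])
  define E where "E = S' \<odot> ?L"
  have rfE: "rowfin E" unfolding E_def using rf by (intro rowfin_mult)
  have "mderiv (\<lambda>s. S s \<odot> G s) (S' \<odot> G s0 + ?S \<odot> (A \<odot> G s0)) s0"
    using Sl by (intro mderiv_mult_lower S' G') 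
  moreover have "S' \<odot> G s0 = E \<odot> ?W"
    unfolding E_def using rf by (simp add: gauss_borel_eq[OF gb, of s0] smat_mult_assoc_rr)
  moreover have "?S \<odot> (A \<odot> G s0) = J \<odot> ?W"
    unfolding J_def using rf A by (simp add: gauss_borel_eq[OF gb, of s0] smat_mult_assoc_rr rowfin_mult)
  ultimately have W': "mderiv (\<lambda>s. W2 (S s) (H s)) ((E + J) \<odot> ?W) s0"
    using rf rfE by (simp add: gauss_borel_mult[OF gb] smat_mult_add_left)
  \<comment> \<open>Multiplying by the upper triangular inverse of \<open>W2\<close> frees
    \<open>E + J\<close>. \<open>W2\<close> has infinite rows, so the cancellation needs
    \<open>E + J\<close> row-finite and \<open>?V\<close> column-finite.\<close>
  have "block_upper ((E + J) \<odot> ?W)" using W' Wu by (rule mderiv_upper)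
  from block_upper_mult[OF this V(3)] have "block_upper ((E + J) \<odot> ?W \<odot> ?V)" .
  moreover have "(E + J) \<odot> ?W \<odot> ?V = E + J"
    using rf rfE V by (simp add: smat_mult_assoc_rc rowfin_add)
  ultimately have up: "block_upper (E + J)" by simp
  \<comment> \<open>On and above the block diagonal the entries of \<open>S s\<close> do not depend
    on \<open>s\<close>.\<close>
  have S'0: "S' \<alpha> \<beta> = 0" if "mdeg \<alpha> \<le> mdeg \<beta>" for \<alpha> \<beta>
  proof (rule mderiv_const_entry[OF S'])
    show "S s \<alpha> \<beta> = sone \<alpha> \<beta>" for s
      using S[of s] that by (cases "mdeg \<alpha> = mdeg \<beta>") 
        (auto simp: block_unilower_def block_lower_def sone_def)
  qed
  have "E \<alpha> \<beta> = 0" if "mdeg \<alpha> \<le> mdeg \<beta>" for \<alpha> \<beta>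
  proof -
    have "E \<alpha> \<beta> = (\<Sum>\<gamma>\<in>dle (mdeg \<alpha>). S' \<alpha> \<gamma> * ?L \<gamma> \<beta>)"
      unfolding E_def using S'0 by (intro smat_mult_finite) auto
    also have "\<dots> = 0"
    proof (rule sum.neutral, rule ballI)
      fix \<gamma> :: "'d mindex"
      show "S' \<alpha> \<gamma> * ?L \<gamma> \<beta> = 0"
        using S'0[of \<alpha> \<gamma>] Ll[of s0] that by (cases "mdeg \<alpha> \<le> mdeg \<gamma>") (auto simp: block_lower_def)
    qed
    finally show ?thesis .
  qed
  note E = splus_sum_lower[OF up this refl]
  have "S' = E \<odot> ?S" unfolding E_def using rf SL by (simp add: smat_mult_assoc_rr)
  then have S'_eq: "S' = (splus J - J) \<odot> ?S" by (simp only: E(2)[symmetric])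
  with S' show "mderiv S ((splus J - J) \<odot> ?S) s0" by simp
  have "mderiv (\<lambda>s. lower_inv (S s)) (- (?L \<odot> (S' \<odot> ?L))) s0"
    using Sl Ll SL S' by (rule mderiv_lower_inverse)
  moreover have "- (?L \<odot> (S' \<odot> ?L)) = ?L \<odot> (J - splus J)"
    using smat_mult_minus_right[of ?L E] rf by (simp add: E(2) flip: E_def)
  ultimately show "mderiv (\<lambda>s. lower_inv (S s)) (?L \<odot> (J - splus J)) s0" by simp
  show W'': "mderiv (\<lambda>s. W2 (S s) (H s)) (splus J \<odot> ?W) s0"
    using W' E(1) by simp
  have "mderiv (\<lambda>s. strans (S s) \<odot> K s) (- (?V \<odot> (splus J \<odot> ?W) \<odot> ?V)) s0"
    using W2_inverse_right[OF S H K] W2_inverse_left[OF S H K] block_upper_strans_mult[OF S H K]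
    by (intro mderiv_upper_inverse[OF Wu _ _ _ W'']) auto
  moreover have "?V \<odot> (splus J \<odot> ?W) \<odot> ?V = ?V \<odot> splus J"
  proof -
    have cf: "colfin (splus J)" "colfin ?W" using up Wu E(1) by (auto intro: colfin_upper)
    then have "?V \<odot> (splus J \<odot> ?W) \<odot> ?V = ?V \<odot> splus J \<odot> (?W \<odot> ?V)"
      using V(4) by (simp add: smat_mult_assoc_cc colfin_mult)
    then show ?thesis by (simp add: V)
  qed
  ultimately show "mderiv (\<lambda>s. upper_inv (W2 (S s) (H s))) (- (upper_inv ?W \<odot> splus J)) s0"
    by (simp add: uiW)
qed

subsection \<open>Symbols of Toeplitz matrices\<close>

lemma xpow_add: "xpow (\<alpha> + \<beta>) x = xpow \<alpha> x * xpow \<beta> x"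
  by (simp add: xpow_def power_add prod.distrib)

lemma xpow_0 [simp]: "xpow 0 x = 1"
  by (simp add: xpow_def)

lemma xpow_axis [simp]: "xpow (axis a (Suc 0)) x = x $ a"
proof -
  have "xpow (axis a (Suc 0)) x = (\<Prod>b\<in>UNIV. if b = a then x $ b else 1)"
    unfolding xpow_def by (intro prod.cong) (auto simp: axis_def)
  then show ?thesis by simp
qed

text \<open>The degree \<open>k\<close> term of the series for row \<open>\<beta>\<close> of
  \<open>A\<close> applied to \<open>chi\<close>. Grouping by degree is the summation order built
  into \<open>svec\<close>, and each term is a finite sum.\<close>

definition level_sum :: "'d::finite smat \<Rightarrow> 'd mindex \<Rightarrow> nat \<Rightarrow> 'd point \<Rightarrow> real" where
  "level_sum A \<beta> k x = (\<Sum>\<delta>\<in>level k. A \<beta> \<delta> * xpow \<delta> x)"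

text \<open>
  A block upper triangular Toeplitz matrix acts on \<open>\<chi>\<close> as multiplication by a formal
  power series; \<open>f k\<close> is the component of that series which is homogeneous of degree \<open>k\<close>.
\<close>

definition has_symbol :: "'d::finite smat \<Rightarrow> (nat \<Rightarrow> 'd point \<Rightarrow> real) \<Rightarrow> bool" where
  "has_symbol A f \<longleftrightarrow> block_upper A \<and>
     (\<forall>\<beta> k x. level_sum A \<beta> k x = (if mdeg \<beta> \<le> k then xpow \<beta> x * f (k - mdeg \<beta>) x else 0))"

lemma has_symbol_upper: "has_symbol A f \<Longrightarrow> block_upper A"
  by (simp add: has_symbol_def)

lemma has_symbolD:
  "has_symbol A f \<Longrightarrow> level_sum A \<beta> k x = (if mdeg \<beta> \<le> k then xpow \<beta> x * f (k - mdeg \<beta>) x else 0)"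
  by (simp add: has_symbol_def)

lemma has_symbolI:
  assumes "block_upper A" "\<And>\<beta> j x. level_sum A \<beta> (mdeg \<beta> + j) x = xpow \<beta> x * f j x"
  shows "has_symbol A f"
  unfolding has_symbol_def
proof (intro conjI allI)
  fix \<beta> k x
  show "level_sum A \<beta> k x = (if mdeg \<beta> \<le> k then xpow \<beta> x * f (k - mdeg \<beta>) x else 0)"
  proof (cases "mdeg \<beta> \<le> k")
    case True
    then show ?thesis using assms(2)[of \<beta> "k - mdeg \<beta>" x] by simp
  next
    case False
    then show ?thesis using assms(1) by (auto simp: level_sum_def block_upper_def intro!: sum.neutral)
  qed
qed fact

text \<open>The Cauchy product of two series graded by degree, taken pointwise; \<open>cpow\<close>
  gives the corresponding powers.\<close>

definition conv :: "(nat \<Rightarrow> 'p \<Rightarrow> real) \<Rightarrow> (nat \<Rightarrow> 'p \<Rightarrow> real) \<Rightarrow> nat \<Rightarrow> 'p \<Rightarrow> real" where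
  "conv f g k x = (\<Sum>i\<le>k. f i x * g (k - i) x)"

primrec cpow :: "(nat \<Rightarrow> 'p \<Rightarrow> real) \<Rightarrow> nat \<Rightarrow> nat \<Rightarrow> 'p \<Rightarrow> real" where
  "cpow f 0 = (\<lambda>k x. if k = 0 then 1 else 0)"
| "cpow f (Suc n) = conv f (cpow f n)"

text \<open>Only the right factor is required to have a symbol, so the identity can also be used to
  determine the symbol of an unknown left factor, namely the inverse of
  \<open>lin_Lam\<close>.\<close>

lemma level_sum_mult:
  assumes "has_symbol B g"
  shows "level_sum (A \<odot> B) \<beta> k x = (\<Sum>l\<le>k. level_sum A \<beta> l x * g (k - l) x)"
proof -
  have "level_sum (A \<odot> B) \<beta> k x = (\<Sum>\<delta>\<in>level k. \<Sum>\<gamma>\<in>dle k. A \<beta> \<gamma> * (B \<gamma> \<delta> * xpow \<delta> x))"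
    unfolding level_sum_def using has_symbol_upper[OF assms]
    by (intro sum.cong refl, subst smat_mult_upper[where n=k])
      (auto simp: sum_distrib_right mult.assoc)
  also have "\<dots> = (\<Sum>\<gamma>\<in>dle k. A \<beta> \<gamma> * level_sum B \<gamma> k x)"
    unfolding level_sum_def by (subst sum.swap) (simp add: sum_distrib_left)
  also have "\<dots> = (\<Sum>\<gamma>\<in>dle k. A \<beta> \<gamma> * (xpow \<gamma> x * g (k - mdeg \<gamma>) x))"
    by (intro sum.cong) (auto simp: has_symbolD[OF assms])
  also have "\<dots> = (\<Sum>l\<le>k. \<Sum>\<gamma>\<in>level l. A \<beta> \<gamma> * (xpow \<gamma> x * g (k - mdeg \<gamma>) x))"
    by (rule sum_levels[symmetric])
  also have "\<dots> = (\<Sum>l\<le>k. level_sum A \<beta> l x * g (k - l) x)"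
    unfolding level_sum_def sum_distrib_right by (intro sum.cong) auto
  finally show ?thesis .
qed

lemma has_symbol_mult:
  assumes f: "has_symbol A f" and g: "has_symbol B g"
  shows "has_symbol (A \<odot> B) (conv f g)"
proof (rule has_symbolI)
  show "block_upper (A \<odot> B)"
    using f g by (intro block_upper_mult) (auto intro: has_symbol_upper)
  fix \<beta> j x
  have "level_sum (A \<odot> B) \<beta> (mdeg \<beta> + j) x
     = (\<Sum>l\<le>mdeg \<beta> + j. level_sum A \<beta> l x * g (mdeg \<beta> + j - l) x)"
    by (rule level_sum_mult[OF g])
  also have "\<dots> = (\<Sum>l\<in>{mdeg \<beta>..mdeg \<beta> + j}. level_sum A \<beta> l x * g (mdeg \<beta> + j - l) x)"
    by (rule sum.mono_neutral_right) (auto simp: has_symbolD[OF f])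
  also have "\<dots> = (\<Sum>i\<le>j. xpow \<beta> x * (f i x * g (j - i) x))"
    by (rule sum.reindex_bij_witness[of _ "\<lambda>i. mdeg \<beta> + i" "\<lambda>l. l - mdeg \<beta>"])
      (auto simp: has_symbolD[OF f] add.commute)
  also have "\<dots> = xpow \<beta> x * conv f g j x"
    by (simp add: conv_def sum_distrib_left)
  finally show "level_sum (A \<odot> B) \<beta> (mdeg \<beta> + j) x = xpow \<beta> x * conv f g j x" .
qed

lemma level_sum_sone: "level_sum sone \<beta> k x = (if k = mdeg \<beta> then xpow \<beta> x else 0)"
proof -
  have "level_sum sone \<beta> k x = (\<Sum>\<delta>\<in>level k. if \<delta> = \<beta> then xpow \<delta> x else 0)"
    unfolding level_sum_def by (intro sum.cong) (auto simp: sone_def)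
  then show ?thesis by auto
qed

lemma has_symbol_sone: "has_symbol sone (cpow f 0)"
  by (intro has_symbolI) (auto simp: level_sum_sone)

lemma has_symbol_spow: "has_symbol A f \<Longrightarrow> has_symbol (spow A n) (cpow f n)"
  by (induction n) (simp_all add: has_symbol_sone[simplified] has_symbol_mult)

text \<open>A column index of degree at most \<open>k\<close> confines all intermediate indices to
  \<open>dle k\<close>, where the sum of absolute entries is a submultiplicative norm. This gives
  entrywise convergence of \<open>sexp\<close>, although \<open>time_Lam\<close> has the diagonal
  entry \<open>t 0\<close> and need not be nilpotent on blocks.\<close>

lemma abs_spow_le:
  assumes A: "block_upper A" and "mdeg \<alpha> \<le> k" "mdeg \<beta> \<le> k"
  shows "\<bar>spow A n \<alpha> \<beta>\<bar> \<le> (\<Sum>i\<in>dle k. \<Sum>j\<in>dle k. \<bar>A i j\<bar>) ^ n"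
  using assms(2,3)
proof (induction n arbitrary: \<alpha>)
  case 0 then show ?case by (simp add: sone_def)
next
  case (Suc n)
  let ?a = "\<Sum>i\<in>dle k. \<Sum>j\<in>dle k. \<bar>A i j\<bar>"
  have "spow A (Suc n) \<alpha> \<beta> = (\<Sum>\<gamma>\<in>dle k. A \<alpha> \<gamma> * spow A n \<gamma> \<beta>)"
    using Suc.prems smat_mult_upper[OF block_upper_spow[OF A]] by simp
  also have "\<bar>\<dots>\<bar> \<le> (\<Sum>\<gamma>\<in>dle k. \<bar>A \<alpha> \<gamma>\<bar> * ?a ^ n)"
    using Suc by (intro order.trans[OF sum_abs] sum_mono) (auto simp: abs_mult intro!: mult_left_mono)
  also have "\<dots> = (\<Sum>\<gamma>\<in>dle k. \<bar>A \<alpha> \<gamma>\<bar>) * ?a ^ n" by (simp add: sum_distrib_right)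
  also have "\<dots> \<le> ?a * ?a ^ n"
    using Suc.prems by (intro mult_right_mono member_le_sum[where f="\<lambda>i. \<Sum>j\<in>dle k. \<bar>A i j\<bar>"])
      (auto intro!: sum_nonneg zero_le_power)
  finally show ?case by simp
qed

lemma summable_sexp:
  assumes "block_upper A"
  shows "summable (\<lambda>n. spow A n \<alpha> \<beta> / fact n)"
proof (rule summable_comparison_test')
  let ?k = "max (mdeg \<alpha>) (mdeg \<beta>)"
  let ?a = "\<Sum>i\<in>dle ?k. \<Sum>j\<in>dle ?k. \<bar>A i j\<bar>"
  show "summable (\<lambda>n. ?a ^ n / fact n)"
    using summable_exp[of ?a] by (simp add: divide_inverse mult.commute)
  show "norm (spow A n \<alpha> \<beta> / fact n) \<le> ?a ^ n / fact n" for n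
    using abs_spow_le[OF assms, of \<alpha> ?k \<beta> n] by (simp add: divide_right_mono)
qed

text \<open>A single degree block is finite, so its sum can be exchanged with the exponential series
  entry by entry.\<close>

lemma has_symbol_sexp:
  assumes f: "has_symbol A f"
  shows "has_symbol (sexp A) (\<lambda>k x. \<Sum>n. cpow f n k x / fact n)"
proof (rule has_symbolI)
  note A = has_symbol_upper[OF f]
  show "block_upper (sexp A)"
    using block_upper_spow[OF A] by (auto simp: block_upper_def sexp_def)
  have eq: "level_sum (sexp A) \<beta> (mdeg \<beta> + j) x = (\<Sum>n. xpow \<beta> x * (cpow f n j x / fact n))"
    and sm: "summable (\<lambda>n. xpow \<beta> x * (cpow f n j x / fact n))" for \<beta> j x
  proof -
    have s: "summable (\<lambda>n. spow A n \<beta> \<delta> / fact n * xpow \<delta> x)" for \<delta>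
      by (rule summable_mult2[OF summable_sexp[OF A]])
    have e: "(\<Sum>\<delta>\<in>level (mdeg \<beta> + j). spow A n \<beta> \<delta> / fact n * xpow \<delta> x) = 
      xpow \<beta> x * (cpow f n j x / fact n)" for n
      using has_symbolD[OF has_symbol_spow[OF f], of n \<beta> "mdeg \<beta> + j" x]
      by (simp add: level_sum_def sum_divide_distrib[symmetric])
    show "summable (\<lambda>n. xpow \<beta> x * (cpow f n j x / fact n))"
      unfolding e[symmetric] by (intro summable_sum s)
    show "level_sum (sexp A) \<beta> (mdeg \<beta> + j) x = (\<Sum>n. xpow \<beta> x * (cpow f n j x / fact n))"
      unfolding e[symmetric] level_sum_def sexp_def suminf_mult2[OF summable_sexp[OF A]]
      by (rule suminf_sum[symmetric]) (rule s)
  qed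
  \<comment> \<open>Row \<open>0\<close> is used because its monomial is 1, whereas
    \<open>xpow \<beta> x\<close> may vanish and could not be divided out.\<close>
  have "summable (\<lambda>n. cpow f n j x / fact n)" for j x
    using sm[of 0 x j] by simp
  then show "level_sum (sexp A) \<beta> (mdeg \<beta> + j) x = xpow \<beta> x * (\<Sum>n. cpow f n j x / fact n)" for \<beta> j x
    unfolding eq by (rule suminf_mult)
qed

lemma level_sum_Lam: "level_sum (Lam a) \<beta> k x = (if k = Suc (mdeg \<beta>) then xpow \<beta> x * x $ a else 0)"
proof -
  have "level_sum (Lam a) \<beta> k x = (\<Sum>\<delta>\<in>level k. if \<delta> = \<beta> + axis a 1 then xpow \<delta> x else 0)"
    unfolding level_sum_def by (intro sum.cong) (auto simp: Lam_def)
  then show ?thesis by (auto simp: xpow_add)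
qed

lemma level_sum_lin_Lam:
  "level_sum (lin_Lam N q a) \<beta> k x = 
     (if k = mdeg \<beta> then - q $ a * xpow \<beta> x else if k = Suc (mdeg \<beta>) then (N $ a \<bullet> x) * xpow \<beta> x else 0)"
proof -
  have "level_sum (lin_Lam N q a) \<beta> k x = 
     (\<Sum>b\<in>UNIV. N $ a $ b * level_sum (Lam b) \<beta> k x) - q $ a * level_sum sone \<beta> k x"
    unfolding level_sum_def lin_Lam_def dot_Lam_def sscale_def
    by (simp add: left_diff_distrib sum_subtractf sum_distrib_left sum_distrib_right mult.assoc)
      (rule sum.swap)
  also have "(\<Sum>b\<in>UNIV. N $ a $ b * level_sum (Lam b) \<beta> k x) = 
     (if k = Suc (mdeg \<beta>) then (N $ a \<bullet> x) * xpow \<beta> x else 0)"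
    by (simp add: level_sum_Lam inner_vec_def sum_distrib_right sum_distrib_left mult_ac)
  finally show ?thesis by (simp add: level_sum_sone)
qed

lemma has_symbol_lin_Lam:
  "has_symbol (lin_Lam N q a) (\<lambda>k x. if k = 0 then - q $ a else if k = 1 then N $ a \<bullet> x else 0)"
  by (intro has_symbolI block_upper_lin_Lam) (auto simp: level_sum_lin_Lam)

text \<open>Dividing by the diagonal value \<open>- q $ a\<close> and transposing gives a lower
  matrix \<open>U\<close> with identity blocks. Thus \<open>lin_Lam\<close> has the form of a
  \<open>W2\<close>, and the explicit inverse found for \<open>W2\<close> applies.\<close>

lemma lin_Lam_inverse:
  assumes q: "q $ a \<noteq> 0"
  shows "block_upper (upper_inv (lin_Lam N q a))"
    and "upper_inv (lin_Lam N q a) \<odot> lin_Lam N q a = sone"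
proof -
  define D where "D c = sscale c (sone :: 'a smat)" for c
  have D: "block_diagonal (D c)" for c by (auto simp: D_def block_diagonal_def sscale_def sone_def)
  have Dm: "(D c \<odot> X) \<alpha> \<beta> = c * X \<alpha> \<beta>" for c X \<alpha> \<beta>
  proof -
    have "(D c \<odot> X) \<alpha> \<beta> = (\<Sum>\<gamma>\<in>dle (mdeg \<alpha>). D c \<alpha> \<gamma> * X \<gamma> \<beta>)"
      using D by (intro smat_mult_lower) (auto intro: block_diagonal_lower)
    also have "\<dots> = (\<Sum>\<gamma>\<in>dle (mdeg \<alpha>). if \<gamma> = \<alpha> then c * X \<gamma> \<beta> else 0)"
      by (intro sum.cong) (auto simp: D_def sscale_def sone_def)
    finally show ?thesis by simp
  qed
  define U where "U = (\<lambda>\<alpha> \<beta>. - lin_Lam N q a \<beta> \<alpha> / q $ a)"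
  have z: "(\<Sum>aa\<in>UNIV. N $ a $ aa * Lam aa \<beta> \<alpha>) = 0" if "mdeg \<alpha> \<le> mdeg \<beta>" for \<alpha> \<beta>
    using that by (intro sum.neutral) (auto simp: Lam_def)
  have U: "block_unilower U"
    using q by (auto simp: block_unilower_def block_lower_def U_def lin_Lam_def dot_Lam_def 
        sscale_def sone_def z)
  note L = block_unilower_lower_inv[OF U]
  have LU: "lower_inv (lower_inv U) = U"
    using U L by (intro lower_inv_eqI) (auto intro: block_unilower_lower simp: lower_inv_mult mult_lower_inv)
  have e: "lin_Lam N q a = W2 (lower_inv U) (D (- q $ a))"
    unfolding W2_def LU using q by (auto simp: Dm fun_eq_iff) (auto simp: U_def)
  have K: "D (- q $ a) \<odot> D (- 1 / q $ a) = sone" "D (- 1 / q $ a) \<odot> D (- q $ a) = sone"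
    using q by (auto simp: fun_eq_iff Dm) (auto simp: D_def sscale_def)
  show "block_upper (upper_inv (lin_Lam N q a))" "upper_inv (lin_Lam N q a) \<odot> lin_Lam N q a = sone"
    unfolding e upper_inv_W2[OF L D D K]
    by (rule block_upper_strans_mult[OF L D D K] W2_inverse_left[OF L D D K])+
qed

text \<open>The components are those of the geometric series of 1 / (y - q) in powers of y =
  \<open>N $ a \<bullet> x\<close>. Comparing degrees in inverse times \<open>lin_Lam\<close> =
  \<open>sone\<close> gives a two-term recursion for them.\<close>

lemma has_symbol_upper_inv_lin_Lam:
  assumes q: "q $ a \<noteq> 0"
  shows "has_symbol (upper_inv (lin_Lam N q a)) (\<lambda>k x. - ((N $ a \<bullet> x) ^ k) / (q $ a) ^ Suc k)"
proof (rule has_symbolI)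
  let ?B = "upper_inv (lin_Lam N q a)"
  show up: "block_upper ?B" by (rule lin_Lam_inverse[OF q])
  fix \<beta> j x
  let ?f = "\<lambda>k x. if k = 0 then - q $ a else if k = 1 then N $ a \<bullet> x else 0"
  have e: "(\<Sum>l\<le>k. level_sum ?B \<beta> l x * ?f (k - l) x) = level_sum sone \<beta> k x" for k
    unfolding lin_Lam_inverse(2)[OF q, of N, symmetric] by (rule level_sum_mult[OF has_symbol_lin_Lam, symmetric])
  have lo: "level_sum ?B \<beta> l x = 0" if "l < mdeg \<beta>" for l
    using up that by (auto simp: level_sum_def block_upper_def intro!: sum.neutral)
  show "level_sum ?B \<beta> (mdeg \<beta> + j) x = xpow \<beta> x * (- ((N $ a \<bullet> x) ^ j) / (q $ a) ^ Suc j)"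
  proof (induction j)
    case 0
    have "(\<Sum>l\<le>mdeg \<beta>. level_sum ?B \<beta> l x * ?f (mdeg \<beta> - l) x) =
      (\<Sum>l\<in>{mdeg \<beta>}. level_sum ?B \<beta> l x * ?f (mdeg \<beta> - l) x)"
      by (rule sum.mono_neutral_right) (auto simp: lo)
    with e[of "mdeg \<beta>"] have "level_sum ?B \<beta> (mdeg \<beta>) x * (- q $ a) = xpow \<beta> x"
      by (simp add: level_sum_sone)
    then show ?case using q by (simp add: field_simps)
  next
    case (Suc j)
    let ?k = "mdeg \<beta> + Suc j"
    have "(\<Sum>l\<le>?k. level_sum ?B \<beta> l x * ?f (?k - l) x) =
      (\<Sum>l\<in>{mdeg \<beta> + j, ?k}. level_sum ?B \<beta> l x * ?f (?k - l) x)"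
      by (rule sum.mono_neutral_right) auto
    with e[of ?k] have "level_sum ?B \<beta> ?k x * q $ a = level_sum ?B \<beta> (mdeg \<beta> + j) x * (N $ a \<bullet> x)"
      by (simp add: level_sum_sone)
    then have "level_sum ?B \<beta> ?k x = level_sum ?B \<beta> (mdeg \<beta> + j) x * (N $ a \<bullet> x) / q $ a"
      using q by (simp add: eq_divide_eq)
    then show ?case using q by (simp only: Suc) (simp add: field_simps)
  qed
qed

lemma block_upper_time_Lam: "block_upper (time_Lam t)"
  unfolding block_upper_def
proof (intro allI impI)
  fix \<alpha> \<beta> :: "'a mindex" assume "mdeg \<beta> < mdeg \<alpha>"
  then have "Lam_mi \<gamma> \<alpha> \<beta> = 0" for \<gamma> by (auto simp: Lam_mi_eq_shift shift_def)
  then show "time_Lam t \<alpha> \<beta> = 0" by (simp add: time_Lam_def)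
qed

lemma time_Lam_apply: "time_Lam t \<beta> (\<beta> + \<alpha>) = t \<alpha>"
proof -
  have "time_Lam t \<beta> (\<beta> + \<alpha>) = (\<Sum>\<^sub>\<infinity>\<gamma>\<in>{\<alpha>}. t \<gamma> * Lam_mi \<gamma> \<beta> (\<beta> + \<alpha>))"
    unfolding time_Lam_def by (rule infsum_cong_neutral) (auto simp: Lam_mi_eq_shift shift_def)
  then show ?thesis by (simp add: Lam_mi_eq_shift shift_def)
qed

lemma time_Lam_eq_0:
  assumes "\<And>\<alpha>. \<gamma> \<noteq> \<beta> + \<alpha>"
  shows "time_Lam t \<beta> \<gamma> = 0"
proof -
  have "Lam_mi \<alpha> \<beta> \<gamma> = 0" for \<alpha>
    using assms[of \<alpha>] by (auto simp: Lam_mi_eq_shift shift_def)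
  then show ?thesis by (simp add: time_Lam_def)
qed

lemma has_symbol_time_Lam: "has_symbol (time_Lam t) (\<lambda>k x. \<Sum>\<alpha>\<in>level k. t \<alpha> * xpow \<alpha> x)"
proof (rule has_symbolI[OF block_upper_time_Lam])
  fix \<beta> j x
  have "level_sum (time_Lam t) \<beta> (mdeg \<beta> + j) x = 
    (\<Sum>\<gamma>\<in>(\<lambda>\<alpha>. \<beta> + \<alpha>) ` level j. time_Lam t \<beta> \<gamma> * xpow \<gamma> x)"
    unfolding level_sum_def
  proof (rule sum.mono_neutral_right)
    have "\<gamma> \<noteq> \<beta> + \<alpha>" if "mdeg \<gamma> = mdeg \<beta> + j" "\<gamma> \<notin> (\<lambda>\<alpha>. \<beta> + \<alpha>) ` level j" for \<gamma> \<alpha>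
      using that by auto
    then show "\<forall>\<gamma>\<in>level (mdeg \<beta> + j) - (+) \<beta> ` level j. time_Lam t \<beta> \<gamma> * xpow \<gamma> x = 0"
      using time_Lam_eq_0 by (metis DiffE mem_level mult_zero_left)
  qed auto
  also have "\<dots> = (\<Sum>\<alpha>\<in>level j. t \<alpha> * xpow (\<beta> + \<alpha>) x)"
    by (subst sum.reindex) (auto simp: time_Lam_apply)
  finally show "level_sum (time_Lam t) \<beta> (mdeg \<beta> + j) x = xpow \<beta> x * (\<Sum>\<alpha>\<in>level j. t \<alpha> * xpow \<alpha> x)"
    by (simp add: xpow_add sum_distrib_left mult_ac)
qed

subsection \<open>Convergence of symbols\<close>

text \<open>Pointwise convergence with a majorant independent of the point, as in the Weierstrass
  test. The uniform majorant is what later justifies integrating term by term.\<close>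

definition dominated_sums :: "'p set \<Rightarrow> (nat \<Rightarrow> 'p \<Rightarrow> real) \<Rightarrow> ('p \<Rightarrow> real) \<Rightarrow> bool" where
  "dominated_sums X f \<phi> \<longleftrightarrow>
     (\<exists>c. summable c \<and> (\<forall>k. 0 \<le> c k) \<and> (\<forall>k. \<forall>x\<in>X. \<bar>f k x\<bar> \<le> c k)) \<and>
     (\<forall>x\<in>X. (\<lambda>k. f k x) sums \<phi> x)"

lemma dominated_sumsE:
  assumes "dominated_sums X f \<phi>"
  obtains c where "summable c" "\<And>k. 0 \<le> c k" "\<And>k x. x \<in> X \<Longrightarrow> \<bar>f k x\<bar> \<le> c k"
    "\<And>x. x \<in> X \<Longrightarrow> (\<lambda>k. f k x) sums \<phi> x"
  using assms unfolding dominated_sums_def by blast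

lemma dominated_sumsI:
  assumes "summable c" "\<And>k. 0 \<le> c k" "\<And>k x. x \<in> X \<Longrightarrow> \<bar>f k x\<bar> \<le> c k"
    "\<And>x. x \<in> X \<Longrightarrow> (\<lambda>k. f k x) sums \<phi> x"
  shows "dominated_sums X f \<phi>"
  using assms unfolding dominated_sums_def by blast

lemma dominated_sums_conv:
  assumes "dominated_sums X f \<phi>" "dominated_sums X g \<psi>"
  shows "dominated_sums X (conv f g) (\<lambda>x. \<phi> x * \<psi> x)"
proof -
  obtain c where c: "summable c" "\<And>k. 0 \<le> c k" "\<And>k x. x \<in> X \<Longrightarrow> \<bar>f k x\<bar> \<le> c k"
    "\<And>x. x \<in> X \<Longrightarrow> (\<lambda>k. f k x) sums \<phi> x" by (rule dominated_sumsE[OF assms(1)]) blast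
  obtain d where d: "summable d" "\<And>k. 0 \<le> d k" "\<And>k x. x \<in> X \<Longrightarrow> \<bar>g k x\<bar> \<le> d k"
    "\<And>x. x \<in> X \<Longrightarrow> (\<lambda>k. g k x) sums \<psi> x" by (rule dominated_sumsE[OF assms(2)]) blast
  show ?thesis
  proof (rule dominated_sumsI)
    show "summable (\<lambda>k. \<Sum>i\<le>k. c i * d (k - i))"
      using c(1,2) d(1,2) by (intro summable_Cauchy_product) auto
    show "0 \<le> (\<Sum>i\<le>k. c i * d (k - i))" for k using c d by (auto intro: sum_nonneg)
    show "\<bar>conv f g k x\<bar> \<le> (\<Sum>i\<le>k. c i * d (k - i))" if "x \<in> X" for k x
      unfolding conv_def using c d that
      by (intro order.trans[OF sum_abs] sum_mono) (auto simp: abs_mult intro!: mult_mono)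
    show "(\<lambda>k. conv f g k x) sums (\<phi> x * \<psi> x)" if x: "x \<in> X" for x
    proof -
      have "summable (\<lambda>k. norm (f k x))"
        using c(3) x by (intro summable_comparison_test'[OF c(1), of 0]) auto
      moreover have "summable (\<lambda>k. norm (g k x))"
        using d(3) x by (intro summable_comparison_test'[OF d(1), of 0]) auto
      ultimately show ?thesis
        using Cauchy_product_sums[of "\<lambda>k. f k x" "\<lambda>k. g k x"] c(4)[OF x] d(4)[OF x]
        by (simp add: conv_def sums_iff)
    qed
  qed
qed

lemma dominated_sums_one: "dominated_sums X (cpow f 0) (\<lambda>_. 1)"
  by (rule dominated_sumsI[where c="\<lambda>k. if k = 0 then 1 else 0"])
    (auto intro: sums_single[of 0 "\<lambda>_. 1", simplified] summable_single[of 0 "\<lambda>_. 1", simplified])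

lemma dominated_sums_cpow: "dominated_sums X f \<phi> \<Longrightarrow> dominated_sums X (cpow f n) (\<lambda>x. \<phi> x ^ n)"
  by (induction n) (simp_all add: dominated_sums_one[simplified] dominated_sums_conv)

lemma cpow_nonneg: "(\<And>k. 0 \<le> f k x) \<Longrightarrow> 0 \<le> cpow f n k x"
  by (induction n arbitrary: k) (auto simp: conv_def intro!: sum_nonneg)

lemma abs_cpow_le: "(\<And>k. \<bar>f k x\<bar> \<le> c k y) \<Longrightarrow> \<bar>cpow f n k x\<bar> \<le> cpow c n k y"
proof (induction n arbitrary: k)
  case (Suc n)
  have "0 \<le> c k y" for k using Suc.prems[of k] by linarith
  then show ?case unfolding cpow.simps conv_def using Suc
    by (intro order.trans[OF sum_abs] sum_mono) (auto simp: abs_mult intro!: mult_mono)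
qed auto

text \<open>Here \<open>n\<close> is the exponent in the exponential series and \<open>k\<close> the
  degree. The nonnegative array \<open>cc n k / fact n\<close> sums by rows to the exponential
  series of \<open>C\<close>, so it is summable as a double family, and everything dominated by it
  may be summed in either order.\<close>

lemma exp_series_swap:
  fixes u cc :: "nat \<Rightarrow> nat \<Rightarrow> real"
  assumes cc: "\<And>n k. 0 \<le> cc n k" "\<And>n. cc n sums C ^ n" and C: "0 \<le> C"
  shows "summable (\<lambda>n. cc n k / fact n)"
    and "summable (\<lambda>k. \<Sum>n. cc n k / fact n)"
    and "(\<And>n k. \<bar>u n k\<bar> \<le> cc n k) \<Longrightarrow> (\<And>n. u n sums z ^ n) \<Longrightarrow>
      (\<lambda>k. \<Sum>n. u n k / fact n) sums exp z"
proof -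
  have exp_sums: "(\<lambda>n. y ^ n / fact n) sums exp y" for y :: real
    using exp_converges[of y] by (simp add: divide_inverse mult.commute)
  have hs: "((\<lambda>k. cc n k / fact n) has_sum (C ^ n / fact n)) UNIV" for n
    using cc by (intro sums_nonneg_imp_has_sum sums_divide) auto
  have ps: "(\<lambda>(n, k). cc n k / fact n) summable_on UNIV \<times> UNIV"
  proof (rule summable_on_SigmaI)
    show "(\<lambda>n. C ^ n / fact n) summable_on UNIV"
      using sums_nonneg_imp_has_sum[OF exp_sums[of C]] C by (auto simp: summable_on_def)
  qed (use hs cc in auto)
  then have ps': "(\<lambda>(k, n). cc n k / fact n) summable_on UNIV \<times> UNIV"
    by (subst (asm) summable_on_swap) (simp add: case_prod_unfold)
  have row: "((\<lambda>n. g n k / fact n) has_sum (\<Sum>n. g n k / fact n)) UNIV"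
    if "(\<lambda>(k, n). g n k / fact n) summable_on UNIV \<times> UNIV" for g :: "nat \<Rightarrow> nat \<Rightarrow> real" and k
  proof -
    have "(\<lambda>n. g n k / fact n) summable_on UNIV" using summable_on_SigmaD1[OF that, of k] by simp
    then show ?thesis
      using has_sum_imp_sums[OF has_sum_infsum] has_sum_infsum by (metis sums_unique)
  qed
  show "summable (\<lambda>n. cc n k / fact n)" for k
    using row[OF ps'] by (blast dest: has_sum_imp_sums sums_summable)
  have col: "((\<lambda>k. \<Sum>n. g n k / fact n) has_sum s) UNIV"
    if "((\<lambda>(k, n). g n k / fact n) has_sum s) (UNIV \<times> UNIV)" for g :: "nat \<Rightarrow> nat \<Rightarrow> real" and s
  proof (rule has_sum_SigmaD[OF that])
    have "(\<lambda>(k, n). g n k / fact n) summable_on UNIV \<times> UNIV" using that by (auto simp: summable_on_def)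
    from row[OF this] show "((\<lambda>n. case (k, n) of (k, n) \<Rightarrow> g n k / fact n) has_sum (\<Sum>n. g n k / fact n)) UNIV" for k
      by simp
  qed
  show "summable (\<lambda>k. \<Sum>n. cc n k / fact n)"
    using col[OF has_sum_infsum[OF ps']] by (blast dest: has_sum_imp_sums sums_summable)
  show "(\<lambda>k. \<Sum>n. u n k / fact n) sums exp z"
    if u: "\<And>n k. \<bar>u n k\<bar> \<le> cc n k" and uz: "\<And>n. u n sums z ^ n"
  proof -
    have "(\<lambda>p. norm (case p of (n, k) \<Rightarrow> u n k / fact n)) summable_on UNIV \<times> UNIV"
      by (rule Infinite_Sum.abs_summable_on_comparison_test'[OF ps]) (auto simp: u divide_right_mono)
    then have us: "(\<lambda>(n, k). u n k / fact n) summable_on UNIV \<times> UNIV"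
      using summable_on_iff_abs_summable_on_real by blast
    then obtain s where s: "((\<lambda>(n, k). u n k / fact n) has_sum s) (UNIV \<times> UNIV)"
      by (auto simp: summable_on_def)
    \<comment> \<open>Summing over \<open>k\<close> first identifies the total \<open>s\<close> as
      \<open>exp z\<close>; summing over \<open>n\<close> first gives the series by degree.\<close>
    have "((\<lambda>n. z ^ n / fact n) has_sum s) UNIV"
    proof (rule has_sum_SigmaD[OF s])
      fix n
      have sc: "summable (\<lambda>k. cc n k / fact n)"
        using cc(2)[of n] by (intro summable_divide) (rule sums_summable)
      have "summable (\<lambda>k. norm (u n k / fact n))"
        by (rule summable_comparison_test'[OF sc, of 0]) (simp add: u divide_right_mono)
      from norm_summable_imp_has_sum[OF this sums_divide[OF uz]]
      show "((\<lambda>k. case (n, k) of (n, k) \<Rightarrow> u n k / fact n) has_sum (z ^ n / fact n)) UNIV"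
        by simp
    qed
    then have "(\<lambda>n. z ^ n / fact n) sums s" by (rule has_sum_imp_sums)
    then have "s = exp z" using exp_sums by (rule sums_unique2)
    moreover have "((\<lambda>(k, n). u n k / fact n) has_sum s) (UNIV \<times> UNIV)"
      using s by (subst (asm) has_sum_swap) (simp add: case_prod_unfold)
    ultimately show ?thesis using has_sum_imp_sums[OF col] by simp
  qed
qed

lemma dominated_sums_exp:
  assumes "dominated_sums X f \<phi>"
  shows "dominated_sums X (\<lambda>k x. \<Sum>n. cpow f n k x / fact n) (\<lambda>x. exp (\<phi> x))"
proof -
  obtain c where c: "summable c" "\<And>k. 0 \<le> c k" "\<And>k x. x \<in> X \<Longrightarrow> \<bar>f k x\<bar> \<le> c k"
    "\<And>x. x \<in> X \<Longrightarrow> (\<lambda>k. f k x) sums \<phi> x" by (rule dominated_sumsE[OF assms]) blast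
  \<comment> \<open>The majorant is regarded as a function on a one-point set so that the lemmas
    about \<open>cpow\<close> apply to it.\<close>
  define cc where "cc n k = cpow (\<lambda>k (_::unit). c k) n k ()" for n k
  have cc0: "0 \<le> cc n k" for n k
    unfolding cc_def using c by (intro cpow_nonneg)
  have "dominated_sums UNIV (\<lambda>k (_::unit). c k) (\<lambda>_. suminf c)"
    using c by (intro dominated_sumsI[where c=c]) (auto intro: summable_sums)
  from dominated_sums_cpow[OF this] have ccs: "cc n sums suminf c ^ n" for n
    unfolding dominated_sums_def cc_def by auto
  have C: "0 \<le> suminf c" using c by (intro suminf_nonneg)
  have u: "\<bar>cpow f n k x\<bar> \<le> cc n k" if "x \<in> X" for n k x
    unfolding cc_def using c that by (intro abs_cpow_le)
  note E = exp_series_swap[OF cc0 ccs C]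
  show ?thesis
  proof (rule dominated_sumsI[OF E(2)])
    show "0 \<le> (\<Sum>n. cc n k / fact n)" for k
      using cc0 by (intro suminf_nonneg E) auto
    show "\<bar>\<Sum>n. cpow f n k x / fact n\<bar> \<le> (\<Sum>n. cc n k / fact n)" if "x \<in> X" for k x
      using norm_suminf_le[OF _ E(1), of "\<lambda>n. cpow f n k x / fact n" k] u[OF that]
      by (simp add: divide_right_mono)
    show "(\<lambda>k. \<Sum>n. cpow f n k x / fact n) sums exp (\<phi> x)" if "x \<in> X" for x
      using u[OF that] dominated_sums_cpow[OF assms] that
      by (intro E(3)) (auto simp: dominated_sums_def)
  qed
qed

text \<open>Bridges the unordered sum defining t(x) and the sum by degree used in matrix products;
  an unordered summable family may be grouped freely.\<close>

lemma level_sums_infsum: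
  fixes f :: "'d::finite mindex \<Rightarrow> real"
  assumes "f summable_on UNIV"
  shows "(\<lambda>k. \<Sum>\<alpha>\<in>level k. f \<alpha>) sums infsum f UNIV"
proof -
  have "bij_betw snd (SIGMA k:UNIV. level k) (UNIV :: 'd mindex set)"
    by (rule bij_betwI[of _ _ _ "\<lambda>\<alpha>. (mdeg \<alpha>, \<alpha>)"]) auto
  then have "((\<lambda>p. f (snd p)) has_sum infsum f UNIV) (SIGMA k:UNIV. level k)"
    using has_sum_infsum[OF assms] by (subst has_sum_reindex_bij_betw)
  then have "((\<lambda>k. \<Sum>\<alpha>\<in>level k. f \<alpha>) has_sum infsum f UNIV) UNIV"
    by (rule has_sum_SigmaD) (auto intro: has_sum_finite)
  then show ?thesis by (rule has_sum_imp_sums)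
qed

lemma dominated_sums_time:
  fixes t b :: "'d::finite flow"
  assumes b: "b summable_on UNIV" "\<And>\<alpha> x. x \<in> X \<Longrightarrow> \<bar>t \<alpha> * xpow \<alpha> x\<bar> \<le> b \<alpha>"
    and b0: "\<And>\<alpha>. 0 \<le> b \<alpha>"
  shows "dominated_sums X (\<lambda>k x. \<Sum>\<alpha>\<in>level k. t \<alpha> * xpow \<alpha> x) (\<lambda>x. \<Sum>\<^sub>\<infinity>\<alpha>. t \<alpha> * xpow \<alpha> x)"
proof (rule dominated_sumsI)
  show "summable (\<lambda>k. \<Sum>\<alpha>\<in>level k. b \<alpha>)"
    using level_sums_infsum[OF b(1)] by (rule sums_summable)
  show "0 \<le> (\<Sum>\<alpha>\<in>level k. b \<alpha>)" for k using b0 by (simp add: sum_nonneg)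
  show "\<bar>\<Sum>\<alpha>\<in>level k. t \<alpha> * xpow \<alpha> x\<bar> \<le> (\<Sum>\<alpha>\<in>level k. b \<alpha>)" if "x \<in> X" for k x
    using b(2)[OF that] by (intro order.trans[OF sum_abs] sum_mono)
  show "(\<lambda>k. \<Sum>\<alpha>\<in>level k. t \<alpha> * xpow \<alpha> x) sums (\<Sum>\<^sub>\<infinity>\<alpha>. t \<alpha> * xpow \<alpha> x)" if "x \<in> X" for x
  proof (rule level_sums_infsum)
    have "(\<lambda>\<alpha>. norm (t \<alpha> * xpow \<alpha> x)) summable_on UNIV"
      using b that by (intro Infinite_Sum.abs_summable_on_comparison_test'[OF b(1)]) auto
    then show "(\<lambda>\<alpha>. t \<alpha> * xpow \<alpha> x) summable_on UNIV"
      using summable_on_iff_abs_summable_on_real by blast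
  qed
qed

section \<open>Convergence of \<open>W0\<close> applied to the monomial vector\<close>

lemma symbol_sums:
  assumes f: "has_symbol W f" and s: "(\<lambda>k. f k x) sums \<phi>"
  shows "(\<lambda>k. level_sum W \<beta> k x) sums (xpow \<beta> x * \<phi>)"
proof -
  have "(\<lambda>k. level_sum W \<beta> (k + mdeg \<beta>) x) sums (xpow \<beta> x * \<phi>)"
    unfolding has_symbolD[OF f] using s by (auto intro: sums_mult)
  then show ?thesis by (subst (asm) sums_zero_iff_shift) (auto simp: has_symbolD[OF f])
qed

text \<open>Closed under products, and so suited to the lattice factors of \<open>W0\<close>, of
  which the flow equations use only that they converge independently of the times.\<close>

definition converges_on :: "'d::finite point set \<Rightarrow> 'd smat \<Rightarrow> bool" where
  "converges_on X A \<longleftrightarrow> (\<exists>f \<phi>. has_symbol A f \<and> dominated_sums X f \<phi>)"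

lemma converges_on_sone: "converges_on X sone"
  using has_symbol_sone dominated_sums_one unfolding converges_on_def by blast

lemma converges_on_mult: "converges_on X A \<Longrightarrow> converges_on X B \<Longrightarrow> converges_on X (A \<odot> B)"
  unfolding converges_on_def using has_symbol_mult dominated_sums_conv by blast

lemma converges_on_spow: "converges_on X A \<Longrightarrow> converges_on X (spow A n)"
  by (induction n) (auto intro: converges_on_sone converges_on_mult)

lemma converges_on_sprod_list: "(\<And>A. A \<in> set As \<Longrightarrow> converges_on X A) \<Longrightarrow> converges_on X (sprod_list As)"
  unfolding sprod_list_def by (induction As) (auto intro: converges_on_sone converges_on_mult)

lemma converges_on_lin_Lam:
  assumes "bounded X"
  shows "converges_on X (lin_Lam N q a)"
proof -
  obtain R where R: "\<And>x. x \<in> X \<Longrightarrow> norm x \<le> R" using assms by (auto simp: bounded_iff)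
  define r where "r = norm (N $ a) * \<bar>R\<bar>"
  have r: "\<bar>N $ a \<bullet> x\<bar> \<le> r" if "x \<in> X" for x
    using Cauchy_Schwarz_ineq2[of "N $ a" x] R[OF that] unfolding r_def
    by (smt (verit) mult_left_mono norm_ge_zero)
  let ?c = "\<lambda>k::nat. if k = 0 then \<bar>q $ a\<bar> else if k = 1 then r else 0"
  have "dominated_sums X (\<lambda>k x. if k = 0 then - q $ a else if k = 1 then N $ a \<bullet> x else 0)
    (\<lambda>x. \<Sum>k\<in>{0,1::nat}. if k = 0 then - q $ a else if k = 1 then N $ a \<bullet> x else 0)"
  proof (rule dominated_sumsI[where c = ?c])
    show "summable ?c" by (rule summable_finite[of "{0,1}"]) auto
    show "0 \<le> ?c k" for k by (simp add: r_def)
    show "(\<lambda>k. if k = 0 then - q $ a else if k = 1 then N $ a \<bullet> x else 0) sums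
      (\<Sum>k\<in>{0,1::nat}. if k = 0 then - q $ a else if k = 1 then N $ a \<bullet> x else 0)" for x
      by (rule sums_finite) auto
  qed (auto simp: r)
  with has_symbol_lin_Lam show ?thesis unfolding converges_on_def by blast
qed

lemma converges_on_upper_inv_lin_Lam:
  assumes q: "q $ a \<noteq> 0" and \<rho>: "\<rho> < 1" "\<And>x. x \<in> X \<Longrightarrow> \<bar>N $ a \<bullet> x\<bar> \<le> \<rho> * \<bar>q $ a\<bar>"
  shows "converges_on X (upper_inv (lin_Lam N q a))"
proof -
  let ?f = "\<lambda>k x. - ((N $ a \<bullet> x) ^ k) / (q $ a) ^ Suc k"
  \<comment> \<open>For empty \<open>X\<close> the given ratio may be negative.\<close>
  define r where "r = max \<rho> 0"
  have r: "\<bar>N $ a \<bullet> x\<bar> \<le> r * \<bar>q $ a\<bar>" if "x \<in> X" for x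
    using \<rho>(2)[OF that] mult_right_mono[of \<rho> r "\<bar>q $ a\<bar>"] by (simp add: r_def)
  have r01: "0 \<le> r" "r < 1" using \<rho> by (auto simp: r_def)
  let ?c = "\<lambda>k. r ^ k / \<bar>q $ a\<bar>"
  have c: "summable ?c" using r01 by (intro summable_divide summable_geometric) auto
  have fc: "\<bar>?f k x\<bar> \<le> ?c k" if "x \<in> X" for k x
  proof -
    have "\<bar>N $ a \<bullet> x\<bar> ^ k \<le> (r * \<bar>q $ a\<bar>) ^ k" using r[OF that] by (intro power_mono) auto
    then show ?thesis using q by (simp add: power_abs abs_mult field_simps power_mult_distrib)
  qed
  have "dominated_sums X ?f (\<lambda>x. \<Sum>k. ?f k x)"
  proof (rule dominated_sumsI[OF c])
    show "(\<lambda>k. ?f k x) sums (\<Sum>k. ?f k x)" if "x \<in> X" for x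
      by (rule summable_sums, rule summable_comparison_test'[OF c, of 0]) (use fc[OF that] in auto)
  qed (use r01 fc in auto)
  with has_symbol_upper_inv_lin_Lam[OF q] show ?thesis unfolding converges_on_def by blast
qed

definition times_dominated :: "'d::finite point set \<Rightarrow> 'd flow \<Rightarrow> bool" where
  "times_dominated X t \<longleftrightarrow> (\<exists>b. b summable_on UNIV \<and> (\<forall>\<alpha>. 0 \<le> b \<alpha>) \<and> (\<forall>x\<in>X. \<forall>\<alpha>. \<bar>t \<alpha> * xpow \<alpha> x\<bar> \<le> b \<alpha>))"

text \<open>\<open>\<psi>\<close> is obtained before \<open>t\<close> is fixed: the lattice factors
  contribute one function common to all times, and \<open>t\<close> enters through the exponential
  alone. The set \<open>X\<close> is the support for the moments and a single point for
  \<open>Psi1\<close>.\<close>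

lemma W0_symbol:
  fixes N :: "'d::{finite,linorder} rmat"
  assumes q: "\<And>a. q $ a \<noteq> 0" and X: "bounded X"
    and neg: "\<And>a. m $ a < 0 \<Longrightarrow> \<exists>\<rho><1. \<forall>x\<in>X. \<bar>N $ a \<bullet> x\<bar> \<le> \<rho> * \<bar>q $ a\<bar>"
  obtains \<psi> where "\<And>t. times_dominated X t \<Longrightarrow>
    \<exists>f. has_symbol (W0 N q t m) f \<and> dominated_sums X f (\<lambda>x. exp (\<Sum>\<^sub>\<infinity>\<alpha>. t \<alpha> * xpow \<alpha> x) * \<psi> x)"
proof -
  have "converges_on X (upper_powi (lin_Lam N q a) (m $ a))" for a
  proof (cases "0 \<le> m $ a")
    case True
    then show ?thesis unfolding upper_powi_def by (simp add: converges_on_spow converges_on_lin_Lam[OF X])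
  next
    case False
    then obtain \<rho> where "\<rho> < 1" "\<And>x. x \<in> X \<Longrightarrow> \<bar>N $ a \<bullet> x\<bar> \<le> \<rho> * \<bar>q $ a\<bar>"
      using neg[of a] by auto
    from converges_on_upper_inv_lin_Lam[OF q this] False show ?thesis
      unfolding upper_powi_def by (simp add: converges_on_spow)
  qed
  then have "converges_on X (sprod_list (map (\<lambda>a. upper_powi (lin_Lam N q a) (m $ a)) (sorted_list_of_set UNIV)))"
    by (intro converges_on_sprod_list) auto
  then obtain g \<psi> where g: "has_symbol (sprod_list (map (\<lambda>a. upper_powi (lin_Lam N q a) (m $ a)) (sorted_list_of_set UNIV))) g"
    "dominated_sums X g \<psi>" unfolding converges_on_def by blast
  show thesis
  proof (rule that)
    fix t :: "'d flow" assume "times_dominated X t"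
    then obtain b where "b summable_on UNIV" "\<And>\<alpha>. 0 \<le> b \<alpha>" "\<And>x \<alpha>. x \<in> X \<Longrightarrow> \<bar>t \<alpha> * xpow \<alpha> x\<bar> \<le> b \<alpha>"
      unfolding times_dominated_def by blast
    from dominated_sums_conv[OF dominated_sums_exp[OF dominated_sums_time[OF this(1,3,2)]] g(2)]
      has_symbol_mult[OF has_symbol_sexp[OF has_symbol_time_Lam[of t]] g(1)]
    show "\<exists>f. has_symbol (W0 N q t m) f \<and> dominated_sums X f (\<lambda>x. exp (\<Sum>\<^sub>\<infinity>\<alpha>. t \<alpha> * xpow \<alpha> x) * \<psi> x)"
      unfolding W0_def by blast
  qed
qed

subsection \<open>Moments over a compact support\<close>

lemma continuous_on_xpow: "continuous_on X (xpow \<alpha>)"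
  unfolding xpow_def by (intro continuous_intros)

lemma borel_measurable_xpow [measurable]: "xpow \<alpha> \<in> borel_measurable borel"
  by (intro borel_measurable_continuous_onI continuous_on_xpow)

lemma closed_msupport: "closed (msupport \<mu>)"
proof -
  have "- msupport \<mu> = \<Union>{U. open U \<and> emeasure \<mu> U = 0}"
    by (auto simp: msupport_def)
  then show ?thesis by (metis (mono_tags, lifting) closed_def mem_Collect_eq open_Union)
qed

text \<open>The complement of the support is a union of null open sets, reduced to a countable one
  by second countability.\<close>

lemma AE_msupport:
  fixes \<mu> :: "'a::second_countable_topology measure"
  assumes "sets \<mu> = sets borel"
  shows "AE x in \<mu>. x \<in> msupport \<mu>"
proof -
  obtain F where F: "F \<subseteq> {U. open U \<and> emeasure \<mu> U = 0}" "countable F"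
    "\<Union>F = \<Union>{U. open U \<and> emeasure \<mu> U = 0}"
    by (rule Lindelof[of "{U. open U \<and> emeasure \<mu> U = 0}"]) auto
  have "(\<Union>U\<in>F. U) \<in> null_sets \<mu>"
    using F(1,2) assms by (intro null_sets_UN') (auto simp: null_sets_def)
  moreover have "{x \<in> space \<mu>. \<not> x \<in> msupport \<mu>} \<subseteq> (\<Union>U\<in>F. U)"
    using F(3) by (auto simp: msupport_def)
  ultimately show ?thesis by (rule AE_I')
qed

lemma open_flow_region: "open (flow_region N q)"
proof -
  have "flow_region N q = (\<Inter>a. {x. \<bar>N $ a \<bullet> x\<bar> < \<bar>q $ a\<bar>})" by (auto simp: flow_region_def)
  then show ?thesis by (auto intro!: open_INT open_Collect_less continuous_intros)
qed

text \<open>In the coordinates \<open>N *v x\<close> the region is a box, and the inverse of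
  \<open>N\<close> maps bounded sets to bounded sets.\<close>

lemma bounded_flow_region:
  assumes "invertible N"
  shows "bounded (flow_region N q)"
proof -
  obtain B where B: "B ** N = mat 1" using assms unfolding invertible_def by blast
  let ?Y = "{y. norm y \<le> (\<Sum>a\<in>UNIV. \<bar>q $ a\<bar>)}"
  have "flow_region N q \<subseteq> (*v) B ` ?Y"
  proof
    fix x assume x: "x \<in> flow_region N q"
    have "norm (N *v x) \<le> (\<Sum>a\<in>UNIV. \<bar>(N *v x) $ a\<bar>)" by (rule norm_le_l1_cart)
    also have "\<dots> \<le> (\<Sum>a\<in>UNIV. \<bar>q $ a\<bar>)"
      using x by (intro sum_mono) (auto simp: flow_region_def matrix_vector_mul_component less_imp_le)
    finally have "N *v x \<in> ?Y" by simp
    moreover have "x = B *v (N *v x)"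
      by (simp add: matrix_vector_mul_assoc B)
    ultimately show "x \<in> (*v) B ` ?Y" by blast
  qed
  moreover have "bounded ((*v) B ` ?Y)"
    by (intro bounded_linear_image matrix_vector_mul_bounded_linear) (auto simp: bounded_iff)
  ultimately show ?thesis by (rule bounded_subset[rotated])
qed

lemma abs_xpow_mono:
  assumes "\<And>a. \<bar>x $ a\<bar> \<le> \<bar>y $ a\<bar>"
  shows "\<bar>xpow \<alpha> x\<bar> \<le> \<bar>xpow \<alpha> y\<bar>"
proof -
  have "(\<Prod>a\<in>UNIV. \<bar>x $ a\<bar> ^ (\<alpha> $ a)) \<le> (\<Prod>a\<in>UNIV. \<bar>y $ a\<bar> ^ (\<alpha> $ a))"
    using assms by (intro prod_mono conjI power_mono) simp_all
  then show ?thesis by (simp add: xpow_def abs_prod power_abs)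
qed

lemma times_dominated_compact:
  assumes t: "t \<in> admissible_times N q" and K: "compact K" "K \<subseteq> flow_region N q"
  shows "times_dominated K t"
proof -
  have sm: "(\<lambda>\<alpha>. \<bar>t \<alpha> * xpow \<alpha> y\<bar>) summable_on UNIV" if "y \<in> flow_region N q" for y
  proof -
    have "(\<lambda>\<alpha>. t \<alpha> * xpow \<alpha> y) summable_on UNIV" using t that by (auto simp: admissible_times_def)
    from summable_on_iff_abs_summable_on_real[THEN iffD1, OF this] show ?thesis by simp
  qed
  \<comment> \<open>An open box on which every monomial is bounded by its absolute value at
    \<open>y\<close>; it is empty if some coordinate of \<open>y\<close> is zero.\<close>
  define U where "U y = {x :: 'a point. \<forall>a. \<bar>x $ a\<bar> < \<bar>y $ a\<bar>}" for y
  have "\<exists>y\<in>flow_region N q. x \<in> U y" if "x \<in> K" for x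
  proof -
    \<comment> \<open>moving \<open>x\<close> away from all coordinate hyperplanes gives one point that dominates
      every monomial in a neighbourhood of \<open>x\<close>\<close>
    define v :: "'a point" where "v = (\<chi> a. if 0 \<le> x $ a then 1 else - 1)"
    have "x \<in> flow_region N q" using K(2) that by blast
    with open_flow_region[of N q] obtain e where e: "0 < e" "ball x e \<subseteq> flow_region N q"
      unfolding open_contains_ball by blast
    \<comment> \<open>Any coordinate would do; the point is that \<open>v\<close> is nonzero, so
      that \<open>d\<close> below is defined by a proper division and moves \<open>x\<close> by half
      of \<open>e\<close>.\<close>
    have "v $ undefined \<noteq> 0" by (simp add: v_def)
    then have v: "0 < norm v" by auto
    define d where "d = e / (2 * norm v)"
    have d: "0 < d" using e v by (simp add: d_def)
    have "x + d *\<^sub>R v \<in> ball x e" using e v by (simp add: dist_norm d_def)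
    moreover have "x \<in> U (x + d *\<^sub>R v)" using d by (auto simp: U_def v_def)
    ultimately show ?thesis using e by blast
  qed
  moreover have "open (U y)" for y
  proof -
    have "U y = (\<Inter>a. {x. \<bar>x $ a\<bar> < \<bar>y $ a\<bar>})" by (auto simp: U_def)
    then show ?thesis by (auto intro!: open_INT open_Collect_less continuous_intros)
  qed
  ultimately have "K \<subseteq> (\<Union>y\<in>flow_region N q. U y)" "\<And>y. y \<in> flow_region N q \<Longrightarrow> open (U y)"
    by auto
  then obtain Y where Y: "Y \<subseteq> flow_region N q" "finite Y" "K \<subseteq> (\<Union>y\<in>Y. U y)"
    using compactE_image[OF K(1), of "flow_region N q" U] by metis
  show ?thesis unfolding times_dominated_def
  \<comment> \<open>Each point of \<open>K\<close> lies in one of finitely many boxes, so the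
    absolutely convergent series at the points of \<open>Y\<close> add up to a majorant valid on all
    of \<open>K\<close>.\<close>
  proof (intro exI[of _ "\<lambda>\<alpha>. \<Sum>y\<in>Y. \<bar>t \<alpha> * xpow \<alpha> y\<bar>"] conjI ballI allI)
    show "(\<lambda>\<alpha>. \<Sum>y\<in>Y. \<bar>t \<alpha> * xpow \<alpha> y\<bar>) summable_on UNIV"
      using Y(2,1) by (induction Y rule: finite_induct) (auto intro: summable_on_add sm)
    fix x \<alpha> assume "x \<in> K"
    then obtain y where y: "y \<in> Y" "x \<in> U y" using Y by blast
    then have "\<bar>xpow \<alpha> x\<bar> \<le> \<bar>xpow \<alpha> y\<bar>" by (intro abs_xpow_mono) (auto simp: U_def less_imp_le)
    then have "\<bar>t \<alpha> * xpow \<alpha> x\<bar> \<le> \<bar>t \<alpha> * xpow \<alpha> y\<bar>" by (simp add: abs_mult mult_left_mono)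
    also have "\<dots> \<le> (\<Sum>y\<in>Y. \<bar>t \<alpha> * xpow \<alpha> y\<bar>)" using Y y by (intro member_le_sum) auto
    finally show "\<bar>t \<alpha> * xpow \<alpha> x\<bar> \<le> (\<Sum>y\<in>Y. \<bar>t \<alpha> * xpow \<alpha> y\<bar>)" .
  qed (simp add: sum_nonneg)
qed

text \<open>The strict inequality defining the region becomes uniform because the linear form
  attains its maximal absolute value on \<open>K\<close>.\<close>

lemma flow_region_compact_ratio:
  assumes K: "compact K" "K \<subseteq> flow_region N q" and q: "q $ a \<noteq> 0"
  shows "\<exists>\<rho><1. \<forall>x\<in>K. \<bar>N $ a \<bullet> x\<bar> \<le> \<rho> * \<bar>q $ a\<bar>"
proof (cases "K = {}")
  case True
  then show ?thesis by (auto intro: exI[of _ 0])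
next
  case False
  have "continuous_on K (\<lambda>x. \<bar>N $ a \<bullet> x\<bar>)" by (intro continuous_intros)
  from continuous_attains_sup[OF K(1) False this]
  obtain x where x: "x \<in> K" "\<And>y. y \<in> K \<Longrightarrow> \<bar>N $ a \<bullet> y\<bar> \<le> \<bar>N $ a \<bullet> x\<bar>" by blast
  then have "\<bar>N $ a \<bullet> x\<bar> < \<bar>q $ a\<bar>" using K by (auto simp: flow_region_def)
  with x q show ?thesis by (intro exI[of _ "\<bar>N $ a \<bullet> x\<bar> / \<bar>q $ a\<bar>"]) auto
qed

lemma infsum_time_upd:
  assumes "(\<lambda>\<gamma>. t \<gamma> * xpow \<gamma> x) summable_on UNIV"
  shows "(\<lambda>\<gamma>. (t(\<alpha> := s)) \<gamma> * xpow \<gamma> x) summable_on UNIV"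
    and "(\<Sum>\<^sub>\<infinity>\<gamma>. (t(\<alpha> := s)) \<gamma> * xpow \<gamma> x) = (s - t \<alpha>) * xpow \<alpha> x + (\<Sum>\<^sub>\<infinity>\<gamma>. t \<gamma> * xpow \<gamma> x)"
proof -
  let ?d = "\<lambda>\<gamma>. if \<gamma> = \<alpha> then (s - t \<alpha>) * xpow \<alpha> x else 0"
  have "(?d has_sum (s - t \<alpha>) * xpow \<alpha> x) {\<alpha>}"
    using has_sum_finite[of "{\<alpha>}" ?d] by simp
  then have "(?d has_sum (s - t \<alpha>) * xpow \<alpha> x) UNIV"
    by (subst has_sum_cong_neutral[where T="{\<alpha>}" and f="?d"]) auto
  from has_sum_add[OF this has_sum_infsum[OF assms]]
  have "((\<lambda>\<gamma>. (t(\<alpha> := s)) \<gamma> * xpow \<gamma> x) has_sum (s - t \<alpha>) * xpow \<alpha> x + (\<Sum>\<^sub>\<infinity>\<gamma>. t \<gamma> * xpow \<gamma> x)) UNIV"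
    by (rule has_sum_cong[THEN iffD1, rotated]) (auto simp: algebra_simps)
  then show "(\<lambda>\<gamma>. (t(\<alpha> := s)) \<gamma> * xpow \<gamma> x) summable_on UNIV"
    "(\<Sum>\<^sub>\<infinity>\<gamma>. (t(\<alpha> := s)) \<gamma> * xpow \<gamma> x) = (s - t \<alpha>) * xpow \<alpha> x + (\<Sum>\<^sub>\<infinity>\<gamma>. t \<gamma> * xpow \<gamma> x)"
    by (auto simp: summable_on_def infsumI)
qed

lemma admissible_times_upd: "t \<in> admissible_times N q \<Longrightarrow> t(\<alpha> := s) \<in> admissible_times N q"
  using infsum_time_upd(1) unfolding admissible_times_def by blast

text \<open>Series and integral are exchanged with the majorant \<open>c' k\<close> times the
  absolute value of an integrable monomial. The indicator is there because \<open>\<phi>\<close> is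
  controlled, and even shown measurable, only on \<open>K\<close>, which carries the
  measure.\<close>

lemma symbol_moments:
  fixes \<mu> :: "'d::finite point measure"
  assumes \<mu>: "sets \<mu> = sets borel" "\<And>\<beta>. integrable \<mu> (xpow \<beta>)"
    and K: "closed K" "AE x in \<mu>. x \<in> K"
    and f: "has_symbol W f" "dominated_sums K f \<phi>"
  shows "integrable \<mu> (\<lambda>x. xpow \<delta> x * (indicator K x * \<phi> x))"
    and "(W \<odot> moment_matrix \<mu>) \<beta> \<gamma> = (\<integral>x. xpow (\<beta> + \<gamma>) x * (indicator K x * \<phi> x) \<partial>\<mu>)"
proof -
  note meas = measurable_cong_sets[OF \<mu>(1) refl]
  obtain c where c: "summable c" "\<And>k. 0 \<le> c k" "\<And>k x. x \<in> K \<Longrightarrow> \<bar>f k x\<bar> \<le> c k"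
    "\<And>x. x \<in> K \<Longrightarrow> (\<lambda>k. f k x) sums \<phi> x" by (rule dominated_sumsE[OF f(2)]) blast
  \<comment> \<open>Row \<open>0\<close> of \<open>W\<close> exhibits each component of the symbol
    as a polynomial, hence as a measurable function.\<close>
  have "f k x = level_sum W 0 k x" for k x using has_symbolD[OF f(1), of 0 k x] by simp
  then have "f k = (\<lambda>x. \<Sum>\<delta>\<in>level k. W 0 \<delta> * xpow \<delta> x)" for k
    unfolding level_sum_def by blast
  then have [measurable]: "f k \<in> borel_measurable borel" for k by simp
  have [measurable]: "K \<in> sets borel" using K(1) by simp
  have "(\<lambda>x. indicator K x * \<phi> x) = (\<lambda>x. \<Sum>k. indicator K x * f k x)"
  proof
    fix x show "indicator K x * \<phi> x = (\<Sum>k. indicator K x * f k x)"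
      using c(4)[of x] by (cases "x \<in> K") (auto simp: sums_iff)
  qed
  then have [measurable]: "(\<lambda>x. indicator K x * \<phi> x) \<in> borel_measurable borel" by simp
  have "\<bar>\<phi> x\<bar> \<le> suminf c" if "x \<in> K" for x
    using norm_suminf_le[OF _ c(1), of "\<lambda>k. f k x"] c(3,4)[OF that] by (simp add: sums_iff)
  then have bd: "\<bar>indicator K x * \<phi> x\<bar> \<le> suminf c" for x
    using suminf_nonneg[OF c(1,2)] by (auto simp: indicator_def)
  show "integrable \<mu> (\<lambda>x. xpow \<delta> x * (indicator K x * \<phi> x))" for \<delta>
  proof (rule Bochner_Integration.integrable_bound)
    show "integrable \<mu> (\<lambda>x. suminf c * xpow \<delta> x)" using \<mu>(2) by simp
    show "(\<lambda>x. xpow \<delta> x * (indicator K x * \<phi> x)) \<in> borel_measurable \<mu>"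
      unfolding meas by measurable
    show "AE x in \<mu>. norm (xpow \<delta> x * (indicator K x * \<phi> x)) \<le> norm (suminf c * xpow \<delta> x)"
      using mult_mono[OF bd order_refl[of "\<bar>xpow \<delta> _\<bar>"]] suminf_nonneg[OF c(1,2)]
      by (auto simp: abs_mult mult.commute)
  qed
  define h where "h k x = level_sum W \<beta> k x * xpow \<gamma> x" for k x
  have h: "h k x = (if mdeg \<beta> \<le> k then xpow (\<beta> + \<gamma>) x * f (k - mdeg \<beta>) x else 0)" for k x
    unfolding h_def by (simp add: has_symbolD[OF f(1)] xpow_add)
  \<comment> \<open>Row \<open>\<beta>\<close> of \<open>W\<close> starts in degree
    \<open>mdeg \<beta>\<close>, so the majorant is shifted by that amount.\<close>
  define c' where "c' k = (if mdeg \<beta> \<le> k then c (k - mdeg \<beta>) else 0)" for k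
  have c': "summable c'"
    using c(1) unfolding c'_def by (subst summable_iff_shift[of _ "mdeg \<beta>", symmetric]) simp
  have hc: "\<bar>h k x\<bar> \<le> c' k * \<bar>xpow (\<beta> + \<gamma>) x\<bar>" if "x \<in> K" for k x
    using c(3)[OF that, of "k - mdeg \<beta>"] by (auto simp: h c'_def abs_mult mult.commute[of "c _"] intro: mult_left_mono)
  have h_sums: "(\<lambda>k. h k x) sums (xpow (\<beta> + \<gamma>) x * \<phi> x)" if "x \<in> K" for x
    using sums_mult2[OF symbol_sums[OF f(1) c(4)[OF that], of \<beta>], of "xpow \<gamma> x"]
    by (simp add: h_def xpow_add mult_ac)
  have h_int: "integrable \<mu> (h k)" and h_eq: "(\<integral>x. h k x \<partial>\<mu>) = (\<Sum>\<delta>\<in>level k. W \<beta> \<delta> * moment_matrix \<mu> \<delta> \<gamma>)" for k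
  proof -
    have "h k = (\<lambda>x. \<Sum>\<delta>\<in>level k. W \<beta> \<delta> * xpow (\<delta> + \<gamma>) x)"
      by (simp add: h_def fun_eq_iff level_sum_def sum_distrib_right xpow_add mult.assoc)
    then show "integrable \<mu> (h k)" "(\<integral>x. h k x \<partial>\<mu>) = (\<Sum>\<delta>\<in>level k. W \<beta> \<delta> * moment_matrix \<mu> \<delta> \<gamma>)"
      using \<mu>(2) by (simp_all add: moment_matrix_def chi_def xpow_add[symmetric])
  qed
  have "(W \<odot> moment_matrix \<mu>) \<beta> \<gamma> = (\<Sum>k. \<integral>x. h k x \<partial>\<mu>)"
    unfolding smat_mult_def h_eq ..
  also have "\<dots> = (\<integral>x. (\<Sum>k. h k x) \<partial>\<mu>)"
  proof (rule integral_suminf[symmetric, OF h_int])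
    show "AE x in \<mu>. summable (\<lambda>k. norm (h k x))"
      using K(2)
    proof eventually_elim
      case (elim x)
      show ?case
        by (rule summable_comparison_test'[OF summable_mult2[OF c', of "\<bar>xpow (\<beta> + \<gamma>) x\<bar>"], of 0])
          (use hc[OF elim] in auto)
    qed
    show "summable (\<lambda>k. \<integral>x. norm (h k x) \<partial>\<mu>)"
    proof (rule summable_comparison_test'[OF summable_mult2[OF c', of "\<integral>x. \<bar>xpow (\<beta> + \<gamma>) x\<bar> \<partial>\<mu>"], of 0])
      fix k
      have "(\<integral>x. norm (h k x) \<partial>\<mu>) \<le> (\<integral>x. c' k * \<bar>xpow (\<beta> + \<gamma>) x\<bar> \<partial>\<mu>)"
        using K(2) hc \<mu>(2) h_int by (intro integral_mono_AE) auto
      then show "norm (\<integral>x. norm (h k x) \<partial>\<mu>) \<le> c' k * (\<integral>x. \<bar>xpow (\<beta> + \<gamma>) x\<bar> \<partial>\<mu>)"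
        by simp
    qed
  qed
  also have "\<dots> = (\<integral>x. xpow (\<beta> + \<gamma>) x * (indicator K x * \<phi> x) \<partial>\<mu>)"
  proof (rule integral_cong_AE)
    have "h k \<in> borel_measurable borel" for k
      using borel_measurable_integrable[OF h_int[of k]] unfolding meas .
    then show "(\<lambda>x. \<Sum>k. h k x) \<in> borel_measurable \<mu>" unfolding meas by simp
    show "(\<lambda>x. xpow (\<beta> + \<gamma>) x * (indicator K x * \<phi> x)) \<in> borel_measurable \<mu>"
      unfolding meas by measurable
    show "AE x in \<mu>. (\<Sum>k. h k x) = xpow (\<beta> + \<gamma>) x * (indicator K x * \<phi> x)"
      using K(2) by eventually_elim (use h_sums in \<open>auto simp: sums_iff\<close>)
  qed
  finally show "(W \<odot> moment_matrix \<mu>) \<beta> \<gamma> = (\<integral>x. xpow (\<beta> + \<gamma>) x * (indicator K x * \<phi> x) \<partial>\<mu>)" .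
qed

text \<open>The second order Taylor remainder, with its factor 1/2 discarded.\<close>

lemma abs_exp_diff_le: "\<bar>exp z - 1 - z\<bar> \<le> z\<^sup>2 * exp \<bar>z\<bar>" for z :: real
proof -
  obtain r where r: "\<bar>r\<bar> \<le> \<bar>z\<bar>" "exp z = (\<Sum>m<2. z ^ m / fact m) + exp r / fact 2 * z ^ 2"
    using Maclaurin_exp_le[of z 2] by blast
  then have "\<bar>exp z - 1 - z\<bar> = exp r / 2 * z\<^sup>2"
    by (simp add: numeral_2_eq_2 abs_mult)
  also have "\<dots> \<le> exp \<bar>z\<bar> * z\<^sup>2"
    using r(1) order.trans[of "exp r" "exp \<bar>z\<bar>" "exp \<bar>z\<bar> * 2"] by (intro mult_right_mono) auto
  finally show ?thesis by (simp add: mult.commute)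
qed

text \<open>As \<open>y\<close> is essentially bounded, the second order remainder of the
  exponential gives an error linear in \<open>h\<close> for the difference quotient. Restricting to
  \<open>\<bar>h\<bar> \<le> 1\<close> keeps the factor \<open>exp \<bar>h * y x\<bar>\<close> below
  \<open>exp R\<close>.\<close>

lemma has_derivative_exp_integral:
  fixes w y :: "'a \<Rightarrow> real"
  assumes w: "integrable M w" and y: "y \<in> borel_measurable M" and R: "AE x in M. \<bar>y x\<bar> \<le> R"
  shows "((\<lambda>s. \<integral>x. exp ((s - s0) * y x) * w x \<partial>M) has_real_derivative (\<integral>x. y x * w x \<partial>M)) (at s0)"
proof -
  note [measurable] = y borel_measurable_integrable[OF w]
  have bdd: "integrable M (\<lambda>x. g x * w x)"
    if g[measurable]: "g \<in> borel_measurable M" and B: "AE x in M. \<bar>g x\<bar> \<le> B" for g :: "'a \<Rightarrow> real" and B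
  proof (rule Bochner_Integration.integrable_bound)
    show "integrable M (\<lambda>x. B * w x)" using w by simp
    show "AE x in M. norm (g x * w x) \<le> norm (B * w x)"
      using B by eventually_elim (auto simp: abs_mult intro: mult_right_mono)
  qed measurable
  have e: "integrable M (\<lambda>x. exp (h * y x) * w x)" for h
  proof (rule bdd)
    show "AE x in M. \<bar>exp (h * y x)\<bar> \<le> exp (\<bar>h\<bar> * R)"
      using R
    proof eventually_elim
      case (elim x)
      have "h * y x \<le> \<bar>h * y x\<bar>" by simp
      also have "\<dots> \<le> \<bar>h\<bar> * R" using elim by (auto simp: abs_mult intro: mult_left_mono)
      finally show ?case by simp
    qed
  qed measurable
  have yw: "integrable M (\<lambda>x. y x * w x)" using y R by (rule bdd)
  \<comment> \<open>This is the bound of \<open>abs_exp_diff_le\<close> at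
    \<open>z = h * y x\<close>, without its factor \<open>h\<^sup>2\<close>, integrated against
    \<open>\<bar>w x\<bar>\<close>.\<close>
  define C where "C = R\<^sup>2 * exp R * (\<integral>x. \<bar>w x\<bar> \<partial>M)"
  have est: "\<bar>((\<integral>x. exp (h * y x) * w x \<partial>M) - (\<integral>x. w x \<partial>M)) / h - (\<integral>x. y x * w x \<partial>M)\<bar> \<le> \<bar>h\<bar> * C"
    if h: "h \<noteq> 0" "\<bar>h\<bar> \<le> 1" for h
  proof -
    have "\<bar>(\<integral>x. exp (h * y x) * w x \<partial>M) - (\<integral>x. w x \<partial>M) - h * (\<integral>x. y x * w x \<partial>M)\<bar>
      = \<bar>\<integral>x. exp (h * y x) * w x - w x - h * (y x * w x) \<partial>M\<bar>"
      using e w yw by simp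
    also have "\<dots> \<le> (\<integral>x. h\<^sup>2 * (R\<^sup>2 * exp R) * \<bar>w x\<bar> \<partial>M)"
    proof (rule order.trans[OF integral_abs_bound], rule integral_mono_AE)
      show "AE x in M. \<bar>exp (h * y x) * w x - w x - h * (y x * w x)\<bar> \<le> h\<^sup>2 * (R\<^sup>2 * exp R) * \<bar>w x\<bar>"
        using R
      proof eventually_elim
        case (elim x)
        have R0: "0 \<le> R" using elim by linarith
        have hy: "\<bar>h * y x\<bar> \<le> R"
          using mult_mono[OF h(2) elim] R0 by (simp add: abs_mult)
        have "\<bar>exp (h * y x) - 1 - h * y x\<bar> \<le> (h * y x)\<^sup>2 * exp \<bar>h * y x\<bar>" by (rule abs_exp_diff_le)
        also have "\<dots> \<le> (h\<^sup>2 * R\<^sup>2) * exp R"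
        proof (rule mult_mono)
          have "(y x)\<^sup>2 \<le> R\<^sup>2" using elim R0 by (simp add: abs_le_square_iff[symmetric])
          then show "(h * y x)\<^sup>2 \<le> h\<^sup>2 * R\<^sup>2" by (simp add: power_mult_distrib mult_left_mono)
        qed (use hy in auto)
        finally have "\<bar>exp (h * y x) - 1 - h * y x\<bar> * \<bar>w x\<bar> \<le> h\<^sup>2 * (R\<^sup>2 * exp R) * \<bar>w x\<bar>"
          by (intro mult_right_mono) (auto simp: mult.assoc)
        moreover have "exp (h * y x) * w x - w x - h * (y x * w x) = (exp (h * y x) - 1 - h * y x) * w x"
          by (simp add: algebra_simps)
        ultimately show ?case by (simp only: abs_mult)
      qed
    qed (use e w yw in auto)
    also have "\<dots> = h\<^sup>2 * C" by (simp add: C_def mult.assoc)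
    finally have "\<bar>(\<integral>x. exp (h * y x) * w x \<partial>M) - (\<integral>x. w x \<partial>M) - h * (\<integral>x. y x * w x \<partial>M)\<bar> \<le> \<bar>h\<bar> * C * \<bar>h\<bar>"
      by (simp add: power2_eq_square mult_ac flip: abs_mult)
    moreover have "((\<integral>x. exp (h * y x) * w x \<partial>M) - (\<integral>x. w x \<partial>M)) / h - (\<integral>x. y x * w x \<partial>M) =
      ((\<integral>x. exp (h * y x) * w x \<partial>M) - (\<integral>x. w x \<partial>M) - h * (\<integral>x. y x * w x \<partial>M)) / h"
      using h by (simp add: field_simps)
    ultimately show ?thesis using h by (simp add: abs_divide divide_le_eq)
  qed
  have "((\<lambda>h. ((\<integral>x. exp (h * y x) * w x \<partial>M) - (\<integral>x. w x \<partial>M)) / h) \<longlongrightarrow> (\<integral>x. y x * w x \<partial>M)) (at 0)"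
  proof (rule LIM_zero_cancel, rule Lim_null_comparison)
    have "eventually (\<lambda>h. h \<noteq> 0 \<and> \<bar>h\<bar> \<le> 1) (at (0::real))"
      unfolding eventually_at by (rule exI[of _ 1]) auto
    then show "eventually (\<lambda>h. norm (((\<integral>x. exp (h * y x) * w x \<partial>M) - (\<integral>x. w x \<partial>M)) / h - (\<integral>x. y x * w x \<partial>M)) \<le> \<bar>h\<bar> * C) (at 0)"
      by eventually_elim (simp add: est)
    have "((\<lambda>h. \<bar>h\<bar> * C) \<longlongrightarrow> \<bar>0\<bar> * C) (at (0::real))" by (intro tendsto_intros)
    then show "((\<lambda>h. \<bar>h\<bar> * C) \<longlongrightarrow> 0) (at (0::real))" by simp
  qed
  then show ?thesis by (simp add: DERIV_def)
qed

text \<open>Moments depend only on the sum of the row and column index. Differentiation multiplies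
  the density by the monomial of exponent \<open>\<alpha>\<close>, which therefore amounts to
  shifting the row index by \<open>\<alpha>\<close>.\<close>

lemma G_flow_deriv:
  fixes N :: "'d::{finite,linorder} rmat"
  assumes N: "invertible N" and q: "\<And>b. q $ b \<noteq> 0"
    and \<mu>: "sets \<mu> = sets borel" "\<And>\<beta>. integrable \<mu> (xpow \<beta>)" "msupport \<mu> \<subseteq> flow_region N q"
    and t: "t \<in> admissible_times N q"
  shows "mderiv (\<lambda>s. G_flow N q \<mu> (t(\<alpha> := s)) m) (shift \<alpha> \<odot> G_flow N q \<mu> t m) (t \<alpha>)"
proof -
  define K where "K = msupport \<mu>"
  have clK: "closed K" unfolding K_def by (rule closed_msupport)
  have bK: "bounded K" using bounded_subset[OF bounded_flow_region[OF N] \<mu>(3)] by (simp add: K_def)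
  have cK: "compact K" using clK bK by (simp add: compact_eq_bounded_closed)
  have KN: "K \<subseteq> flow_region N q" using \<mu>(3) by (simp add: K_def)
  have AEK: "AE x in \<mu>. x \<in> K" unfolding K_def by (rule AE_msupport[OF \<mu>(1)])
  obtain \<psi> where \<psi>: "\<And>t. times_dominated K t \<Longrightarrow>
    \<exists>f. has_symbol (W0 N q t m) f \<and> dominated_sums K f (\<lambda>x. exp (\<Sum>\<^sub>\<infinity>\<alpha>. t \<alpha> * xpow \<alpha> x) * \<psi> x)"
    using W0_symbol[OF q bK, where N=N and m=m] flow_region_compact_ratio[OF cK KN q] by blast
  let ?g = "\<lambda>t x. indicator K x * (exp (\<Sum>\<^sub>\<infinity>\<gamma>. t \<gamma> * xpow \<gamma> x) * \<psi> x)"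
  have G: "integrable \<mu> (\<lambda>x. xpow \<delta> x * ?g t x)"
      "G_flow N q \<mu> t m \<beta> \<gamma> = (\<integral>x. xpow (\<beta> + \<gamma>) x * ?g t x \<partial>\<mu>)"
    if adm: "t \<in> admissible_times N q" for t \<beta> \<gamma> \<delta>
  proof -
    obtain f where f: "has_symbol (W0 N q t m) f" "dominated_sums K f (\<lambda>x. exp (\<Sum>\<^sub>\<infinity>\<alpha>. t \<alpha> * xpow \<alpha> x) * \<psi> x)"
      using \<psi>[OF times_dominated_compact[OF adm cK KN]] by blast
    from symbol_moments[OF \<mu>(1,2) clK AEK f] show 
      "integrable \<mu> (\<lambda>x. xpow \<delta> x * ?g t x)"
      "G_flow N q \<mu> t m \<beta> \<gamma> = (\<integral>x. xpow (\<beta> + \<gamma>) x * ?g t x \<partial>\<mu>)"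
      unfolding G_flow_def by auto
  qed
  \<comment> \<open>Changing one time adds a single term to t(x), so the density at \<open>s\<close>
    is that at \<open>t\<close> times an exponential that is linear in \<open>s\<close> in its
    exponent.\<close>
  have upd: "xpow \<delta> x * ?g (t(\<alpha> := s)) x = exp ((s - t \<alpha>) * xpow \<alpha> x) * (xpow \<delta> x * ?g t x)" for s x \<delta>
  proof (cases "x \<in> K")
    case True
    then have "(\<lambda>\<gamma>. t \<gamma> * xpow \<gamma> x) summable_on UNIV" using t KN by (auto simp: admissible_times_def)
    from infsum_time_upd(2)[OF this] show ?thesis by (simp add: exp_add mult_ac)
  qed simp
  have "bounded (xpow \<alpha> ` K)"
    by (rule compact_imp_bounded[OF compact_continuous_image[OF continuous_on_xpow cK]])
  then obtain R where R: "\<And>x. x \<in> K \<Longrightarrow> \<bar>xpow \<alpha> x\<bar> \<le> R"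
    by (auto simp: bounded_iff)
  have "((\<lambda>s. G_flow N q \<mu> (t(\<alpha> := s)) m \<beta> \<gamma>) has_real_derivative (shift \<alpha> \<odot> G_flow N q \<mu> t m) \<beta> \<gamma>) (at (t \<alpha>))" for \<beta> \<gamma>
  proof -
    have "((\<lambda>s. \<integral>x. exp ((s - t \<alpha>) * xpow \<alpha> x) * (xpow (\<beta> + \<gamma>) x * ?g t x) \<partial>\<mu>) has_real_derivative
      (\<integral>x. xpow \<alpha> x * (xpow (\<beta> + \<gamma>) x * ?g t x) \<partial>\<mu>)) (at (t \<alpha>))"
      using AEK R by (intro has_derivative_exp_integral[where R=R] G(1)[OF t] borel_measurable_integrable \<mu>(2)) auto
    moreover have "(\<integral>x. xpow \<alpha> x * (xpow (\<beta> + \<gamma>) x * ?g t x) \<partial>\<mu>) = (shift \<alpha> \<odot> G_flow N q \<mu> t m) \<beta> \<gamma>"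
      by (simp add: G(2)[OF t] xpow_add mult_ac)
    moreover have "G_flow N q \<mu> (t(\<alpha> := s)) m \<beta> \<gamma> = 
       (\<integral>x. exp ((s - t \<alpha>) * xpow \<alpha> x) * (xpow (\<beta> + \<gamma>) x * ?g t x) \<partial>\<mu>)" for s
      unfolding G(2)[OF admissible_times_upd[OF t]] upd ..
    ultimately show ?thesis by simp
  qed
  then show ?thesis by (simp add: mderiv_def)
qed

subsection \<open>Matrix action on vectors\<close>

lemma svec_scale:
  assumes "rowfin A"
  shows "(A \<odot>\<^sub>v (\<lambda>\<gamma> p. c p * V \<gamma> p)) \<beta> p = c p * (A \<odot>\<^sub>v V) \<beta> p"
proof -
  obtain k where k: "\<And>\<gamma>. k < mdeg \<gamma> \<Longrightarrow> A \<beta> \<gamma> = 0" using assms by (metis rowfin_def)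
  have "(A \<odot>\<^sub>v U) \<beta> p = (\<Sum>\<gamma>\<in>dle k. A \<beta> \<gamma> * U \<gamma> p)" for U :: "'a mindex \<Rightarrow> 'b \<Rightarrow> real"
    using k by (intro svec_finite) auto
  then show ?thesis by (simp add: sum_distrib_left mult_ac)
qed

lemma svec_uminus:
  assumes "\<exists>n. \<forall>\<gamma>. n < mdeg \<gamma> \<longrightarrow> A \<beta> \<gamma> * V \<gamma> p = 0"
  shows "((- A) \<odot>\<^sub>v V) \<beta> p = - (A \<odot>\<^sub>v V) \<beta> p"
proof -
  obtain k where k: "\<And>\<gamma>. k < mdeg \<gamma> \<Longrightarrow> A \<beta> \<gamma> * V \<gamma> p = 0" using assms by blast
  have "(A \<odot>\<^sub>v V) \<beta> p = (\<Sum>\<gamma>\<in>dle k. A \<beta> \<gamma> * V \<gamma> p)"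
    using k by (rule svec_finite)
  moreover have "((- A) \<odot>\<^sub>v V) \<beta> p = (\<Sum>\<gamma>\<in>dle k. (- A) \<beta> \<gamma> * V \<gamma> p)"
    using k by (intro svec_finite) simp
  ultimately show ?thesis by (simp add: sum_negf)
qed

lemma svec_has_derivative:
  assumes A: "mderiv A A' s0"
    and fin: "\<exists>n. \<forall>\<gamma>. n < mdeg \<gamma> \<longrightarrow> (\<forall>s. A s \<beta> \<gamma> = 0) \<or> V \<gamma> p = 0"
  shows "((\<lambda>s. (A s \<odot>\<^sub>v V) \<beta> p) has_real_derivative (A' \<odot>\<^sub>v V) \<beta> p) (at s0)"
proof -
  obtain n where n: "\<And>\<gamma>. n < mdeg \<gamma> \<Longrightarrow> (\<forall>s. A s \<beta> \<gamma> = 0) \<or> V \<gamma> p = 0" using fin by blast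
  have "A' \<beta> \<gamma> * V \<gamma> p = 0" if "n < mdeg \<gamma>" for \<gamma>
    using n[OF that] mderiv_const_entry[OF A, of \<beta> \<gamma> 0] by auto
  then have "(A' \<odot>\<^sub>v V) \<beta> p = (\<Sum>\<gamma>\<in>dle n. A' \<beta> \<gamma> * V \<gamma> p)"
    by (rule svec_finite)
  moreover have "(A s \<odot>\<^sub>v V) \<beta> p = (\<Sum>\<gamma>\<in>dle n. A s \<beta> \<gamma> * V \<gamma> p)" for s
    using n by (intro svec_finite) auto
  moreover have "((\<lambda>s. \<Sum>\<gamma>\<in>dle n. A s \<beta> \<gamma> * V \<gamma> p) has_real_derivative (\<Sum>\<gamma>\<in>dle n. A' \<beta> \<gamma> * V \<gamma> p)) (at s0)"
    by (intro DERIV_sum DERIV_cmult_right mderivD[OF A])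
  ultimately show ?thesis by simp
qed

lemma chi_star_finite: "\<exists>n. \<forall>\<gamma>. n < mdeg \<gamma> \<longrightarrow> chi_star \<gamma> e = 0"
proof (intro exI allI impI)
  fix \<gamma> :: "'a mindex"
  assume *: "(\<Sum>a\<in>UNIV. nat (- e $ a - 1)) < mdeg \<gamma>"
  have "e \<noteq> (\<chi> a. - int (\<gamma> $ a) - 1)"
  proof
    assume "e = (\<chi> a. - int (\<gamma> $ a) - 1)"
    then have "nat (- e $ a - 1) = \<gamma> $ a" for a by simp
    with * show False by (simp add: mdeg_def)
  qed
  then show "chi_star \<gamma> e = 0" by (simp add: chi_star_def)
qed

text \<open>\<open>W\<close> has infinite rows and \<open>chi\<close> infinitely many entries, so
  the associativity lemmas do not apply. Instead a row of \<open>S\<close> gives a finite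
  combination of the convergent series for the rows of \<open>W\<close>, taken degree by
  degree.\<close>

lemma lower_symbol_svec_chi:
  assumes S: "block_lower S" and f: "has_symbol W f" and s: "(\<lambda>k. f k x) sums \<phi>"
  shows "((S \<odot> W) \<odot>\<^sub>v chi) \<beta> x = \<phi> * (S \<odot>\<^sub>v chi) \<beta> x"
proof -
  have "(\<Sum>\<gamma>\<in>level k. (S \<odot> W) \<beta> \<gamma> * chi \<gamma> x) = (\<Sum>\<delta>\<in>dle (mdeg \<beta>). S \<beta> \<delta> * level_sum W \<delta> k x)" for k
    unfolding smat_mult_lower[OF S order_refl] level_sum_def chi_def sum_distrib_right sum_distrib_left mult.assoc
    by (rule sum.swap)
  moreover have "(\<lambda>k. \<Sum>\<delta>\<in>dle (mdeg \<beta>). S \<beta> \<delta> * level_sum W \<delta> k x) sums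
      (\<Sum>\<delta>\<in>dle (mdeg \<beta>). S \<beta> \<delta> * (xpow \<delta> x * \<phi>))"
    by (intro sums_sum sums_mult symbol_sums[OF f s])
  moreover have "(S \<odot>\<^sub>v chi) \<beta> x = (\<Sum>\<delta>\<in>dle (mdeg \<beta>). S \<beta> \<delta> * chi \<delta> x)"
    using S by (intro svec_finite) (auto simp: block_lower_def)
  ultimately show ?thesis
    by (simp add: svec_def[of "S \<odot> W"] sums_iff chi_def sum_distrib_left mult_ac)
qed

lemma has_time_deriv_mderiv:
  "mderiv (\<lambda>s. F (t(\<alpha> := s))) F' (t \<alpha>) \<Longrightarrow> has_time_deriv F F' \<alpha> t"
  by (simp add: has_time_deriv_on_def mderiv_def)

subsection \<open>Lax and Zakharov--Shabat equations\<close>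

lemma splus_diff: "splus (A - B) = splus A - splus B"
  and splus_add: "splus (A + B) = splus A + splus B"
  by (auto simp: splus_def fun_eq_iff)

lemma block_upper_splus [simp]: "block_upper (splus A)"
  by (auto simp: block_upper_def splus_def)

lemma block_upper_diff: "block_upper A \<Longrightarrow> block_upper B \<Longrightarrow> block_upper (A - B)"
  by (simp add: block_upper_def)

lemma splus_upper: "block_upper A \<Longrightarrow> splus A = A"
  by (auto simp: block_upper_def splus_def fun_eq_iff)

lemma rowfin_splus: "rowfin A \<Longrightarrow> rowfin (splus A)"
  unfolding rowfin_def splus_def by metis

lemma mderiv_splus: "mderiv F F' s0 \<Longrightarrow> mderiv (\<lambda>s. splus (F s)) (splus F') s0"
  unfolding mderiv_def splus_def by auto

lemma splus_strictly_lower_mult: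
  assumes "splus A = 0" "splus B = 0"
  shows "splus (A \<odot> B) = 0"
proof (intro ext)
  have A: "A \<alpha> \<beta> = 0" and B: "B \<alpha> \<beta> = 0" if "mdeg \<alpha> \<le> mdeg \<beta>" for \<alpha> \<beta>
    using fun_cong[OF fun_cong[OF assms(1)], of \<alpha> \<beta>] fun_cong[OF fun_cong[OF assms(2)], of \<alpha> \<beta>] that
    by (simp_all add: splus_def)
  fix \<alpha> \<beta>
  have "(A \<odot> B) \<alpha> \<beta> = 0" if "mdeg \<alpha> \<le> mdeg \<beta>"
  proof -
    have "(A \<odot> B) \<alpha> \<beta> = (\<Sum>\<gamma>\<in>dle (mdeg \<alpha>). A \<alpha> \<gamma> * B \<gamma> \<beta>)"
      using A by (intro smat_mult_finite) auto
    then show ?thesis using B that by simp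
  qed
  then show "splus (A \<odot> B) \<alpha> \<beta> = 0 \<alpha> \<beta>" by (simp add: splus_def)
qed

text \<open>\<open>X\<close> and \<open>Y\<close> stand for two commuting Jacobi matrices; the first
  two terms are the upper parts of their derivatives as given by the Lax equations.\<close>

lemma zakharov_shabat:
  assumes X: "rowfin X" and Y: "rowfin Y" and XY: "X \<odot> Y = Y \<odot> X"
  shows "splus (scomm (splus Y) X) - splus (scomm (splus X) Y) + scomm (splus X) (splus Y) = 0"
proof -
  let ?p = "splus X" and ?y = "splus Y"
  have up: "splus (scomm ?p ?y) = scomm ?p ?y"
    unfolding scomm_def
    by (intro splus_upper block_upper_diff block_upper_mult block_upper_splus)
  \<comment> \<open>this is the commutator of the strictly lower parts, hence killed by \<open>splus\<close>\<close>
  have "scomm ?y X - scomm ?p Y + scomm ?p ?y = (X - ?p) \<odot> (Y - ?y) - (Y - ?y) \<odot> (X - ?p)"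
    using X Y by (simp add: scomm_def smat_mult_diff_left smat_mult_diff_right rowfin_diff rowfin_splus XY algebra_simps)
  moreover have "splus ((X - ?p) \<odot> (Y - ?y)) = 0" "splus ((Y - ?y) \<odot> (X - ?p)) = 0"
    by (intro splus_strictly_lower_mult; simp add: splus_def fun_eq_iff)+
  ultimately have "splus (scomm ?y X - scomm ?p Y + scomm ?p ?y) = 0"
    by (simp add: splus_diff)
  then show ?thesis by (simp add: splus_diff splus_add up)
qed

text \<open>The left and right dressings are kept independent, so that one computation covers the
  Jacobi matrices (both at the same lattice site) and the resolvent (neighbouring sites).\<close>

lemma mderiv_dressing:
  assumes S1: "mderiv S1 (D1 \<odot> S1 s0) s0" "\<And>s. block_lower (S1 s)" "rowfin D1"
    and L: "mderiv L (- (L s0 \<odot> D)) s0" "block_lower (L s0)" and A: "rowfin A"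
  defines "\<omega> \<equiv> S1 s0 \<odot> A \<odot> L s0"
  shows "mderiv (\<lambda>s. S1 s \<odot> A \<odot> L s) (D1 \<odot> \<omega> - \<omega> \<odot> D) s0"
proof -
  have rf: "rowfin (S1 s)" "rowfin (L s0)" for s using S1 L by (auto intro: rowfin_lower)
  have "mderiv (\<lambda>s. S1 s \<odot> (A \<odot> L s)) (D1 \<odot> S1 s0 \<odot> (A \<odot> L s0) + S1 s0 \<odot> (A \<odot> (- (L s0 \<odot> D)))) s0"
    by (intro mderiv_mult_lower S1 mderiv_const_mult A L)
  moreover have "S1 s \<odot> (A \<odot> L s) = S1 s \<odot> A \<odot> L s" for s
    using rf A by (simp add: smat_mult_assoc_rr)
  moreover have "D1 \<odot> S1 s0 \<odot> (A \<odot> L s0) = D1 \<odot> \<omega>"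
    unfolding \<omega>_def using rf A S1 by (simp add: smat_mult_assoc_rr rowfin_mult)
  moreover have "S1 s0 \<odot> (A \<odot> (- (L s0 \<odot> D))) = - (\<omega> \<odot> D)"
    unfolding \<omega>_def using rf A by (simp add: smat_mult_minus_right smat_mult_assoc_rr rowfin_mult)
  ultimately show ?thesis by simp
qed

theorem proposition4p2p3:
  fixes N :: "'d::{finite,linorder} rmat"
    and q :: "'d point"
    and \<mu> :: "'d point measure"
    and S H :: "'d flow \<Rightarrow> 'd lattice \<Rightarrow> 'd smat"
    and t :: "'d flow" and m :: "'d lattice"
    and \<alpha> \<alpha>' :: "'d mindex" and a :: 'd
  assumes "invertible N"
    and "\<And>b. q $ b \<noteq> 0"
    and "sets \<mu> = sets borel"
    and "\<And>\<beta>. integrable \<mu> (xpow \<beta>)"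
    and "msupport \<mu> \<subseteq> flow_region N q"
    and "\<And>t' m'. t' \<in> admissible_times N q \<Longrightarrow>
           gauss_borel (G_flow N q \<mu> t' m') (S t' m') (H t' m')"
    and "t \<in> admissible_times N q"
  shows
    "has_time_deriv_on (Psi1_domain N q t m)
       (\<lambda>t. Psi1 (W0 N q t m) (S t m))
       (splus (jacobi (S t m) \<alpha>') \<odot>\<^sub>v Psi1 (W0 N q t m) (S t m)) \<alpha>' t \<and>
     has_time_deriv
       (\<lambda>t. Psi2 (S t m) (H t m))
       (splus (jacobi (S t m) \<alpha>') \<odot>\<^sub>v Psi2 (S t m) (H t m)) \<alpha>' t \<and>
     has_time_deriv
       (\<lambda>t. Psi1_adj (moment_matrix \<mu>) (S t m) (H t m))
       (- (strans (splus (jacobi (S t m) \<alpha>')) \<odot>\<^sub>v Psi1_adj (moment_matrix \<mu>) (S t m) (H t m)))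
       \<alpha>' t \<and>
     has_time_deriv
       (\<lambda>t. Psi2_adj (S t m) (H t m))
       (- (strans (splus (jacobi (S t m) \<alpha>')) \<odot>\<^sub>v Psi2_adj (S t m) (H t m))) \<alpha>' t \<and>
     has_time_deriv
       (\<lambda>t. orth_poly (S t m))
       ((\<lambda>\<beta> x. - xpow \<alpha>' x * orth_poly (S t m) \<beta> x)
          + (splus (jacobi (S t m) \<alpha>') \<odot>\<^sub>v orth_poly (S t m))) \<alpha>' t \<and>
     has_time_deriv
       (\<lambda>t. second_kind (S t m) (H t m))
       (splus (jacobi (S t m) \<alpha>') \<odot>\<^sub>v second_kind (S t m) (H t m)) \<alpha>' t \<and>
     has_time_deriv
       (\<lambda>t. jacobi (S t m) \<alpha>)
       (scomm (splus (jacobi (S t m) \<alpha>')) (jacobi (S t m) \<alpha>)) \<alpha>' t \<and>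
     (\<exists>A A'. has_time_deriv (\<lambda>t. splus (jacobi (S t m) \<alpha>)) A \<alpha>' t \<and>
            has_time_deriv (\<lambda>t. splus (jacobi (S t m) \<alpha>')) A' \<alpha> t \<and>
            A - A' + scomm (splus (jacobi (S t m) \<alpha>)) (splus (jacobi (S t m) \<alpha>')) = 0) \<and>
     (\<exists>A. has_time_deriv (\<lambda>t. resolvent N q (S t) a m) A \<alpha> t \<and>
         A - splus (jacobi (S t (m + axis a 1)) \<alpha>) \<odot> resolvent N q (S t) a m
           + resolvent N q (S t) a m \<odot> splus (jacobi (S t m) \<alpha>) = 0)"
proof -
  note q = assms(2) and adm = assms(7)
  have upd: "t(\<gamma> := t \<gamma>) = t" for \<gamma> by simp
  \<comment> \<open>Varying one time over the whole real line stays within the admissible times, so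
    the factorization is available for every \<open>s\<close>.\<close>
  have gb: "gauss_borel (G_flow N q \<mu> (t(\<gamma> := s)) m') (S (t(\<gamma> := s)) m') (H (t(\<gamma> := s)) m')" for \<gamma> s m'
    using assms(6) admissible_times_upd[OF adm] by blast
  have uni: "block_unilower (S (t(\<gamma> := s)) m')" for \<gamma> s m'
    using gb[of \<gamma> s m'] by (simp add: gauss_borel_def)
  have unit: "block_unilower (S t m')" for m' using uni[of undefined "t undefined" m'] by simp
  note Sl = block_unilower_lower[OF uni] and Slt = block_unilower_lower[OF unit]
  note Ll = block_unilower_lower[OF block_unilower_lower_inv[OF unit]]
  have rfS: "rowfin (S t m')" and rfL: "rowfin (lower_inv (S t m'))" for m'
    using Slt Ll by (auto intro: rowfin_lower)
  \<comment> \<open>The site \<open>m'\<close> is left free because the resolvent involves both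
    \<open>m\<close> and its neighbour.\<close>
  define J where "J m' \<gamma> = jacobi (S t m') \<gamma>" for m' \<gamma>
  have J: "J m' \<gamma> = S t m' \<odot> Lam_mi \<gamma> \<odot> lower_inv (S t m')" for m' \<gamma>
    by (simp add: J_def jacobi_def)
  have rfLam: "rowfin (Lam_mi \<gamma> :: 'd smat)" for \<gamma> by (simp add: Lam_mi_eq_shift)
  have rfJ: "rowfin (J m' \<gamma>)" for m' \<gamma> unfolding J by (intro rowfin_mult rfS rfL rfLam)
  note rfJp = rowfin_splus[OF rfJ]
  note rf = rfS rfL rfLam rfJ rfJp rowfin_mult rowfin_diff
  have dG: "mderiv (\<lambda>s. G_flow N q \<mu> (t(\<gamma> := s)) m') 
      (Lam_mi \<gamma> \<odot> G_flow N q \<mu> (t(\<gamma> := t \<gamma>)) m') (t \<gamma>)" for \<gamma> m'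
    unfolding upd Lam_mi_eq_shift using assms by (intro G_flow_deriv) auto
  note d = gauss_borel_factors_deriv[where S="\<lambda>s. S (t(\<gamma> := s)) m'" and H="\<lambda>s. H (t(\<gamma> := s)) m'"
      and G="\<lambda>s. G_flow N q \<mu> (t(\<gamma> := s)) m'" and ?s0.0="t \<gamma>" for \<gamma> m', OF gb rfLam dG, 
      unfolded upd, folded J]
  have LS: "lower_inv (S t m') \<odot> S t m' = sone" "S t m' \<odot> lower_inv (S t m') = sone" for m'
    using lower_inv_mult[OF unit] mult_lower_inv[OF unit] by auto
  have JS: "J m' \<gamma> \<odot> S t m' = S t m' \<odot> Lam_mi \<gamma>" for m' \<gamma>
    unfolding J by (simp add: smat_mult_assoc_rr rf LS)
  have LL: "lower_inv (S t m') \<odot> (S t m' \<odot> Z) = Z" for m' Z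
    by (simp add: smat_mult_assoc_rr[symmetric] rf LS)
  have JJ: "J m' \<gamma> \<odot> J m' \<delta> = J m' \<delta> \<odot> J m' \<gamma>" for m' \<gamma> \<delta>
  proof -
    have "J m' \<gamma> \<odot> J m' \<delta> = S t m' \<odot> (Lam_mi \<gamma> \<odot> Lam_mi \<delta>) \<odot> lower_inv (S t m')" for \<gamma> \<delta>
      unfolding J by (simp add: smat_mult_assoc_rr rf LL)
    moreover have "Lam_mi \<gamma> \<odot> Lam_mi \<delta> = (Lam_mi \<delta> \<odot> Lam_mi \<gamma> :: 'd smat)"
      by (simp add: Lam_mi_eq_shift shift_commute)
    ultimately show ?thesis by simp
  qed

  \<comment> \<open>Derivatives of the dressing, Jacobi and resolvent matrices\<close>
  define D where "D m' \<gamma> = splus (J m' \<gamma>) - J m' \<gamma>" for m' \<gamma>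
  have rfD: "rowfin (D m' \<gamma>)" for m' \<gamma> unfolding D_def by (intro rf)
  have dS: "mderiv (\<lambda>s. S (t(\<gamma> := s)) m') (D m' \<gamma> \<odot> S t m') (t \<gamma>)" for \<gamma> m'
    unfolding D_def by (rule d(1))
  have dL: "mderiv (\<lambda>s. lower_inv (S (t(\<gamma> := s)) m')) (- (lower_inv (S t m') \<odot> D m' \<gamma>)) (t \<gamma>)" for \<gamma> m'
  proof -
    have "J m' \<gamma> - splus (J m' \<gamma>) = - D m' \<gamma>" by (simp add: D_def)
    with d(2)[of \<gamma> m'] show ?thesis by (simp add: smat_mult_minus_right rf)
  qed
  have dJ: "mderiv (\<lambda>s. jacobi (S (t(\<gamma> := s)) m') \<delta>) (scomm (splus (J m' \<gamma>)) (J m' \<delta>)) (t \<gamma>)" for \<gamma> \<delta> m'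
  proof -
    have "mderiv (\<lambda>s. jacobi (S (t(\<gamma> := s)) m') \<delta>) (D m' \<gamma> \<odot> J m' \<delta> - J m' \<delta> \<odot> D m' \<gamma>) (t \<gamma>)"
      using mderiv_dressing[where ?s0.0="t \<gamma>" and L="\<lambda>s. lower_inv (S (t(\<gamma> := s)) m')" and ?S1.0="\<lambda>s. S (t(\<gamma> := s)) m'",
        unfolded upd, OF dS Sl rfD dL Ll rfLam] by (simp add: jacobi_def J)
    \<comment> \<open>The full Jacobi matrices contained in \<open>D\<close> commute with
      \<open>J m' \<delta>\<close> and drop out of the commutator.\<close>
    moreover have "D m' \<gamma> \<odot> J m' \<delta> - J m' \<delta> \<odot> D m' \<gamma> = scomm (splus (J m' \<gamma>)) (J m' \<delta>)"
      unfolding D_def scomm_def by (simp add: smat_mult_diff_left smat_mult_diff_right rf JJ)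
    ultimately show ?thesis by simp
  qed
  have dR: "mderiv (\<lambda>s. resolvent N q (S (t(\<gamma> := s))) a m)
      (splus (J (m + axis a 1) \<gamma>) \<odot> resolvent N q (S t) a m - resolvent N q (S t) a m \<odot> splus (J m \<gamma>)) (t \<gamma>)" for \<gamma>
  proof -
    let ?w = "resolvent N q (S t) a m" and ?m = "m + axis a 1"
    have rfw: "rowfin ?w" unfolding resolvent_def by (intro rf rowfin_lin_Lam)
    have "mderiv (\<lambda>s. resolvent N q (S (t(\<gamma> := s))) a m) (D ?m \<gamma> \<odot> ?w - ?w \<odot> D m \<gamma>) (t \<gamma>)"
      using mderiv_dressing[where ?s0.0="t \<gamma>" and L="\<lambda>s. lower_inv (S (t(\<gamma> := s)) m)" and ?S1.0="\<lambda>s. S (t(\<gamma> := s)) ?m",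
        unfolded upd, OF dS Sl rfD dL Ll rowfin_lin_Lam] by (simp add: resolvent_def)
    \<comment> \<open>This intertwining cancels the full Jacobi matrices contained in the two
      factors \<open>D\<close>, leaving only their upper parts.\<close>
    moreover have "J ?m \<gamma> \<odot> ?w = ?w \<odot> J m \<gamma>"
    proof -
      have "J ?m \<gamma> \<odot> ?w = S t ?m \<odot> (Lam_mi \<gamma> \<odot> lin_Lam N q a) \<odot> lower_inv (S t m)"
        unfolding J resolvent_def by (simp add: smat_mult_assoc_rr rf LL)
      moreover have "?w \<odot> J m \<gamma> = S t ?m \<odot> (lin_Lam N q a \<odot> Lam_mi \<gamma>) \<odot> lower_inv (S t m)"
        unfolding J resolvent_def by (simp add: smat_mult_assoc_rr rf LL)
      ultimately show ?thesis by (simp add: Lam_mi_eq_shift lin_Lam_shift_commute)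
    qed
    ultimately show ?thesis
      unfolding D_def using rfw by (simp add: smat_mult_diff_left smat_mult_diff_right rf)
  qed

  \<comment> \<open>Polynomials, second kind functions and Baker functions\<close>
  let ?Jp = "splus (J m \<alpha>')"
  have dP: "((\<lambda>s. orth_poly (S (t(\<alpha>' := s)) m) \<beta> x) has_real_derivative
      (?Jp \<odot>\<^sub>v orth_poly (S t m)) \<beta> x - xpow \<alpha>' x * orth_poly (S t m) \<beta> x) (at (t \<alpha>'))" for \<beta> x
  proof -
    have P: "((\<lambda>s. orth_poly (S (t(\<alpha>' := s)) m) \<beta> x) has_real_derivative ((D m \<alpha>' \<odot> S t m) \<odot>\<^sub>v chi) \<beta> x) (at (t \<alpha>'))"
      unfolding orth_poly_def using Sl
      by (intro svec_has_derivative[OF dS] exI[of _ "mdeg \<beta>"]) (auto simp: block_lower_def)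
    have "D m \<alpha>' \<odot> S t m = ?Jp \<odot> S t m - S t m \<odot> Lam_mi \<alpha>'"
      unfolding D_def by (simp add: smat_mult_diff_left rf JS)
    then have "((D m \<alpha>' \<odot> S t m) \<odot>\<^sub>v chi) \<beta> x = 
        ((?Jp \<odot> S t m) \<odot>\<^sub>v chi) \<beta> x - ((S t m \<odot> Lam_mi \<alpha>') \<odot>\<^sub>v chi) \<beta> x"
      by (simp add: svec_eq_mult[where \<delta>=\<beta>] smat_mult_diff_left rf)
    \<comment> \<open>The shift acts on \<open>chi\<close> as multiplication by a monomial, which
      turns the subtracted Jacobi matrix into the scalar term of the equation.\<close>
    also have "((S t m \<odot> Lam_mi \<alpha>') \<odot>\<^sub>v chi) \<beta> x = xpow \<alpha>' x * (S t m \<odot>\<^sub>v chi) \<beta> x"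
    proof -
      have "Lam_mi \<alpha>' \<odot>\<^sub>v chi = (\<lambda>\<gamma> x. xpow \<alpha>' x * chi \<gamma> x)"
        by (simp add: Lam_mi_eq_shift fun_eq_iff chi_def xpow_add)
      then show ?thesis by (simp add: svec_assoc rf svec_scale)
    qed
    finally have "((D m \<alpha>' \<odot> S t m) \<odot>\<^sub>v chi) \<beta> x = 
        (?Jp \<odot>\<^sub>v orth_poly (S t m)) \<beta> x - xpow \<alpha>' x * orth_poly (S t m) \<beta> x"
      by (simp add: orth_poly_def svec_assoc rf)
    with P show ?thesis by (simp only:)
  qed
  \<comment> \<open>At a fixed point \<open>Psi1\<close> is a scalar times the polynomial vector.
    The logarithmic derivative \<open>xpow \<alpha>' x\<close> of the scalar cancels the scalar term
    in \<open>dP\<close>.\<close>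
  have c1: "has_time_deriv_on (Psi1_domain N q t m) (\<lambda>t. Psi1 (W0 N q t m) (S t m))
       (?Jp \<odot>\<^sub>v Psi1 (W0 N q t m) (S t m)) \<alpha>' t"
    unfolding has_time_deriv_on_def
  proof (intro allI ballI)
    fix \<beta> x assume x: "x \<in> Psi1_domain N q t m"
    then have tx: "(\<lambda>\<gamma>. t \<gamma> * xpow \<gamma> x) summable_on UNIV" by (simp add: Psi1_domain_def)
    \<comment> \<open>On a singleton the strict inequality at \<open>x\<close> itself provides the
      ratio.\<close>
    have neg: "\<exists>\<rho><1. \<forall>y\<in>{x}. \<bar>N $ b \<bullet> y\<bar> \<le> \<rho> * \<bar>q $ b\<bar>" if "m $ b < 0" for b
      using x that q[of b] by (intro exI[of _ "\<bar>N $ b \<bullet> x\<bar> / \<bar>q $ b\<bar>"]) (auto simp: Psi1_domain_def)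
    have bdd: "bounded {x}" by simp
    obtain \<psi> where \<psi>: "\<And>t. times_dominated {x} t \<Longrightarrow>
      \<exists>f. has_symbol (W0 N q t m) f \<and> dominated_sums {x} f (\<lambda>x. exp (\<Sum>\<^sub>\<infinity>\<alpha>. t \<alpha> * xpow \<alpha> x) * \<psi> x)"
      using W0_symbol[OF q bdd, where N=N and m=m] neg by blast
    have Psi: "Psi1 (W0 N q t' m) S' \<gamma> x = exp (\<Sum>\<^sub>\<infinity>\<alpha>. t' \<alpha> * xpow \<alpha> x) * \<psi> x * orth_poly S' \<gamma> x"
      if t': "(\<lambda>\<gamma>. t' \<gamma> * xpow \<gamma> x) summable_on UNIV" and S': "block_lower S'" for t' S' \<gamma>
    proof -
      have "times_dominated {x} t'" unfolding times_dominated_def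
        using t'[THEN summable_on_iff_abs_summable_on_real[THEN iffD1]]
        by (intro exI[of _ "\<lambda>\<alpha>. \<bar>t' \<alpha> * xpow \<alpha> x\<bar>"]) auto
      from \<psi>[OF this] obtain f where "has_symbol (W0 N q t' m) f" 
        "(\<lambda>k. f k x) sums (exp (\<Sum>\<^sub>\<infinity>\<alpha>. t' \<alpha> * xpow \<alpha> x) * \<psi> x)"
        unfolding dominated_sums_def by auto
      from lower_symbol_svec_chi[OF S' this] show ?thesis
        by (simp add: Psi1_def W1_def orth_poly_def)
    qed
    define c where "c = exp (\<Sum>\<^sub>\<infinity>\<alpha>. t \<alpha> * xpow \<alpha> x) * \<psi> x"
    let ?P = "orth_poly (S t m)"
    have F: "Psi1 (W0 N q (t(\<alpha>' := s)) m) (S (t(\<alpha>' := s)) m) \<beta> x =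
       c * exp ((s - t \<alpha>') * xpow \<alpha>' x) * orth_poly (S (t(\<alpha>' := s)) m) \<beta> x" for s
      unfolding Psi[OF infsum_time_upd(1)[OF tx] Sl] infsum_time_upd(2)[OF tx] c_def
      by (simp add: exp_add mult_ac)
    have "(?Jp \<odot>\<^sub>v Psi1 (W0 N q t m) (S t m)) \<beta> x = (?Jp \<odot>\<^sub>v (\<lambda>\<gamma> x. c * ?P \<gamma> x)) \<beta> x"
      unfolding svec_def Psi[OF tx Slt] c_def ..
    also have "\<dots> = c * (?Jp \<odot>\<^sub>v ?P) \<beta> x" by (rule svec_scale[OF rfJp])
    finally have R: "(?Jp \<odot>\<^sub>v Psi1 (W0 N q t m) (S t m)) \<beta> x = c * (?Jp \<odot>\<^sub>v ?P) \<beta> x" .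
    show "((\<lambda>s. Psi1 (W0 N q (t(\<alpha>' := s)) m) (S (t(\<alpha>' := s)) m) \<beta> x) has_real_derivative
       (?Jp \<odot>\<^sub>v Psi1 (W0 N q t m) (S t m)) \<beta> x) (at (t \<alpha>'))"
      unfolding F R by (auto intro!: derivative_eq_intros dP simp: algebra_simps)
  qed
  have c2: "has_time_deriv (\<lambda>t. Psi2 (S t m) (H t m)) (?Jp \<odot>\<^sub>v Psi2 (S t m) (H t m)) \<alpha>' t"
    unfolding has_time_deriv_on_def
  proof (intro allI ballI)
    fix \<beta> e
    have "((\<lambda>s. Psi2 (S (t(\<alpha>' := s)) m) (H (t(\<alpha>' := s)) m) \<beta> e) has_real_derivative
      ((?Jp \<odot> W2 (S t m) (H t m)) \<odot>\<^sub>v chi_star) \<beta> e) (at (t \<alpha>'))"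
      unfolding Psi2_def using chi_star_finite[of e] by (intro svec_has_derivative[OF d(3)]) blast
    then show "((\<lambda>s. Psi2 (S (t(\<alpha>' := s)) m) (H (t(\<alpha>' := s)) m) \<beta> e) has_real_derivative
      (?Jp \<odot>\<^sub>v Psi2 (S t m) (H t m)) \<beta> e) (at (t \<alpha>'))"
      unfolding Psi2_def by (simp add: svec_assoc_finite[OF rfJp chi_star_finite])
  qed
  have V: "block_upper (upper_inv (W2 (S (t(\<gamma> := s)) m) (H (t(\<gamma> := s)) m)))" for \<gamma> s
  proof -
    have "block_diagonal (H (t(\<gamma> := s)) m)" using gb[of \<gamma> s m] by (simp add: gauss_borel_def)
    moreover obtain K where "block_diagonal K" "H (t(\<gamma> := s)) m \<odot> K = sone" "K \<odot> H (t(\<gamma> := s)) m = sone"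
      by (rule gauss_borel_inverse_factor[OF gb[of \<gamma> s m]])
    ultimately show ?thesis by (simp add: upper_inv_W2[OF uni] block_upper_strans_mult[OF uni])
  qed
  have Vt: "block_upper (upper_inv (W2 (S t m) (H t m)))" using V[of undefined "t undefined"] by simp
  \<comment> \<open>Transposing the upper part gives a lower triangular matrix, which is why the
    adjoint equations are finite sums in each row.\<close>
  have rfJt: "rowfin (strans ?Jp)" "colfin ?Jp" by (auto intro: colfin_upper)
  have c3: "has_time_deriv (\<lambda>t. Psi1_adj (moment_matrix \<mu>) (S t m) (H t m))
       (- (strans ?Jp \<odot>\<^sub>v Psi1_adj (moment_matrix \<mu>) (S t m) (H t m))) \<alpha>' t"
    unfolding has_time_deriv_on_def
  proof (intro allI ballI)
    fix \<beta> e
    let ?M = "moment_matrix \<mu>" and ?V = "upper_inv (W2 (S t m) (H t m))"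
    \<comment> \<open>The initial moment matrix does not depend on the times, so only the inverse of
      \<open>W2\<close> is differentiated.\<close>
    have "mderiv (\<lambda>s. W1_inv ?M (S (t(\<alpha>' := s)) m) (H (t(\<alpha>' := s)) m)) (0 \<odot> ?V + ?M \<odot> (- (?V \<odot> ?Jp))) (t \<alpha>')"
      unfolding W1_inv_def using mderiv_mult_upper[OF mderiv_const d(4) V] by simp
    moreover have "0 \<odot> ?V = 0" by (simp add: fun_eq_iff smat_mult_def)
    moreover have "?M \<odot> (- (?V \<odot> ?Jp)) = - (W1_inv ?M (S t m) (H t m) \<odot> ?Jp)"
      using Vt rfJt by (simp add: W1_inv_def smat_mult_minus_right smat_mult_assoc_cc colfin_upper colfin_mult)
    ultimately have "mderiv (\<lambda>s. W1_inv ?M (S (t(\<alpha>' := s)) m) (H (t(\<alpha>' := s)) m)) 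
        (- (W1_inv ?M (S t m) (H t m) \<odot> ?Jp)) (t \<alpha>')" by simp
    from mderiv_strans[OF this]
    have "((\<lambda>s. Psi1_adj ?M (S (t(\<alpha>' := s)) m) (H (t(\<alpha>' := s)) m) \<beta> e) has_real_derivative
      (strans (- (W1_inv ?M (S t m) (H t m) \<odot> ?Jp)) \<odot>\<^sub>v chi_star) \<beta> e) (at (t \<alpha>'))"
      unfolding Psi1_adj_def using chi_star_finite[of e] by (intro svec_has_derivative) blast+
    also have "strans (- (W1_inv ?M (S t m) (H t m) \<odot> ?Jp)) = - (strans ?Jp \<odot> strans (W1_inv ?M (S t m) (H t m)))"
      by (simp add: strans_mult[symmetric] fun_eq_iff)
    also have "((- (strans ?Jp \<odot> strans (W1_inv ?M (S t m) (H t m)))) \<odot>\<^sub>v chi_star) \<beta> e = 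
        - (strans ?Jp \<odot>\<^sub>v Psi1_adj ?M (S t m) (H t m)) \<beta> e"
      unfolding Psi1_adj_def svec_assoc_finite[OF rfJt(1) chi_star_finite, symmetric]
      using chi_star_finite[of e] by (intro svec_uminus) (metis mult_zero_right)
    finally show "((\<lambda>s. Psi1_adj ?M (S (t(\<alpha>' := s)) m) (H (t(\<alpha>' := s)) m) \<beta> e) has_real_derivative
      (- (strans ?Jp \<odot>\<^sub>v Psi1_adj ?M (S t m) (H t m))) \<beta> e) (at (t \<alpha>'))" by (simp del: fun_upd_apply)
  qed
  have c4: "has_time_deriv (\<lambda>t. Psi2_adj (S t m) (H t m))
       (- (strans ?Jp \<odot>\<^sub>v Psi2_adj (S t m) (H t m))) \<alpha>' t"
    unfolding has_time_deriv_on_def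
  proof (intro allI ballI)
    fix \<beta> x
    let ?V = "upper_inv (W2 (S t m) (H t m))"
    have rV: "rowfin (strans ?V)" using Vt by (simp add: colfin_upper)
    have "((\<lambda>s. Psi2_adj (S (t(\<alpha>' := s)) m) (H (t(\<alpha>' := s)) m) \<beta> x) has_real_derivative
      (strans (- (?V \<odot> ?Jp)) \<odot>\<^sub>v chi) \<beta> x) (at (t \<alpha>'))"
      unfolding Psi2_adj_def using V[of \<alpha>'] 
      by (intro svec_has_derivative mderiv_strans d(4) exI[of _ "mdeg \<beta>"]) (auto simp: block_upper_def)
    also have "strans (- (?V \<odot> ?Jp)) = - (strans ?Jp \<odot> strans ?V)"
      by (simp add: strans_mult[symmetric] fun_eq_iff)
    also have "((- (strans ?Jp \<odot> strans ?V)) \<odot>\<^sub>v chi) \<beta> x = - (strans ?Jp \<odot>\<^sub>v Psi2_adj (S t m) (H t m)) \<beta> x"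
      unfolding Psi2_adj_def svec_assoc[OF rfJt(1) rV, symmetric]
      using rowfin_mult[OF rfJt(1) rV] by (intro svec_uminus) (metis rowfin_def mult_zero_left)
    finally show "((\<lambda>s. Psi2_adj (S (t(\<alpha>' := s)) m) (H (t(\<alpha>' := s)) m) \<beta> x) has_real_derivative
      (- (strans ?Jp \<odot>\<^sub>v Psi2_adj (S t m) (H t m))) \<beta> x) (at (t \<alpha>'))" by (simp del: fun_upd_apply)
  qed
  have c5: "has_time_deriv (\<lambda>t. orth_poly (S t m))
       ((\<lambda>\<beta> x. - xpow \<alpha>' x * orth_poly (S t m) \<beta> x) + (?Jp \<odot>\<^sub>v orth_poly (S t m))) \<alpha>' t"
    unfolding has_time_deriv_on_def using dP by simp
  \<comment> \<open>The second kind functions are \<open>Psi2\<close> itself once the definitions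
    are unfolded.\<close>
  have c6: "has_time_deriv (\<lambda>t. second_kind (S t m) (H t m)) (?Jp \<odot>\<^sub>v second_kind (S t m) (H t m)) \<alpha>' t"
    using c2 unfolding Psi2_def W2_def second_kind_def .
  have c7: "has_time_deriv (\<lambda>t. jacobi (S t m) \<alpha>) (scomm ?Jp (J m \<alpha>)) \<alpha>' t"
    using dJ by (rule has_time_deriv_mderiv)
  have c8: "\<exists>A A'. has_time_deriv (\<lambda>t. splus (jacobi (S t m) \<alpha>)) A \<alpha>' t \<and>
            has_time_deriv (\<lambda>t. splus (jacobi (S t m) \<alpha>')) A' \<alpha> t \<and>
            A - A' + scomm (splus (J m \<alpha>)) ?Jp = 0"
  proof (intro exI conjI)
    show "has_time_deriv (\<lambda>t. splus (jacobi (S t m) \<alpha>)) (splus (scomm ?Jp (J m \<alpha>))) \<alpha>' t"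
      by (rule has_time_deriv_mderiv, rule mderiv_splus, rule dJ)
    show "has_time_deriv (\<lambda>t. splus (jacobi (S t m) \<alpha>')) (splus (scomm (splus (J m \<alpha>)) (J m \<alpha>'))) \<alpha> t"
      by (rule has_time_deriv_mderiv, rule mderiv_splus, rule dJ)
  qed (rule zakharov_shabat[OF rfJ rfJ JJ])
  have c9: "\<exists>A. has_time_deriv (\<lambda>t. resolvent N q (S t) a m) A \<alpha> t \<and>
         A - splus (J (m + axis a 1) \<alpha>) \<odot> resolvent N q (S t) a m
           + resolvent N q (S t) a m \<odot> splus (J m \<alpha>) = 0"
    by (intro exI conjI) (rule has_time_deriv_mderiv, rule dR, simp)
  show ?thesis
    using c1 c2 c3 c4 c5 c6 c7 c8 c9 unfolding J_def by (intro conjI)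
qed

end
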